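(* Let $R$ be a commutative noetherian ring, $\mathfrak a$ an ideal of $R$, and $f:M\to N$ a homomorphism of $R$-modules, where $M$ and $N$ are $\mathfrak a$-cofinite modules in $\mathcal D_{\leq 3}$. Then $\operatorname{Ker}f$ and $\operatorname{Coker}f$ are $\mathfrak a$-cofinite if and only if $(0:_{\operatorname{Coker}f}\mathfrak a)$ is finitely generated.
   Context: An $R$-module $M$ is $\mathfrak a$-cofinite if $\operatorname{Supp}_RM\subseteq V(\mathfrak a)$ and $\operatorname{Ext}_R^i(R/\mathfrak a,M)$ is finitely generated for all $i\geq 0$. For an $R$-module $M$, $\overline{\dim}\,M=\dim R/\operatorname{Ann}_RM$, and $\mathcal D_{\leq n}$ is the full subcategory of all $R$-modules $M$ with $\overline{\dim}\,M\leq n$. For an $R$-module $X$, $(0:_X\mathfrak a)=\{x\in X\mid \mathfrak a x=0\}$. *)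

theory Defs
  imports "HOL-Algebra.Module" "HOL-Algebra.QuotRing" "HOL-Algebra.Ring_Divisibility" "HOL-Library.Extended_Real"
begin

text \<open>Modules are the records of \<^theory>\<open>HOL-Algebra.Module\<close>; the ring fields \<open>mult\<close> and \<open>one\<close>
  of such a record carry no information and are left \<open>undefined\<close>.\<close>

section \<open>Homomorphisms, quotients, finite generation\<close>

definition mod_hom ::
    "('a, 'r) ring_scheme \<Rightarrow> ('a, 'm, 'k) module_scheme \<Rightarrow> ('a, 'n, 'l) module_scheme \<Rightarrow> ('m \<Rightarrow> 'n) set"
  where "mod_hom R M N =
    {f \<in> carrier M \<rightarrow> carrier N.
       (\<forall>x\<in>carrier M. \<forall>y\<in>carrier M. f (x \<oplus>\<^bsub>M\<^esub> y) = f x \<oplus>\<^bsub>N\<^esub> f y) \<and>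
       (\<forall>r\<in>carrier R. \<forall>x\<in>carrier M. f (r \<odot>\<^bsub>M\<^esub> x) = r \<odot>\<^bsub>N\<^esub> f x)}"

text \<open>Homomorphisms are taken extensional, so that equality in \<open>Hom\<close> is equality on the carrier.\<close>

definition Hom_module ::
    "('a, 'r) ring_scheme \<Rightarrow> ('a, 'm, 'k) module_scheme \<Rightarrow> ('a, 'n, 'l) module_scheme \<Rightarrow> ('a, 'm \<Rightarrow> 'n) module"
  where "Hom_module R M N =
    \<lparr>carrier = mod_hom R M N \<inter> extensional (carrier M), monoid.mult = undefined, one = undefined,
     ring.zero = (\<lambda>x\<in>carrier M. \<zero>\<^bsub>N\<^esub>), add = (\<lambda>f g. \<lambda>x\<in>carrier M. f x \<oplus>\<^bsub>N\<^esub> g x),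
     smult = (\<lambda>r f. \<lambda>x\<in>carrier M. r \<odot>\<^bsub>N\<^esub> f x)\<rparr>"

definition regular_module :: "('a, 'r) ring_scheme \<Rightarrow> ('a, 'a) module"
  where "regular_module R =
    \<lparr>carrier = carrier R, monoid.mult = undefined, one = undefined,
     ring.zero = \<zero>\<^bsub>R\<^esub>, add = (\<oplus>\<^bsub>R\<^esub>), smult = (\<otimes>\<^bsub>R\<^esub>)\<rparr>"

definition quotient_module :: "('a, 'm, 'k) module_scheme \<Rightarrow> 'm set \<Rightarrow> ('a, 'm set) module"
  where "quotient_module M H =
    \<lparr>carrier = a_rcosets\<^bsub>M\<^esub> H, monoid.mult = undefined, one = undefined, ring.zero = H, add = set_add M,
     smult = (\<lambda>r C. \<Union>x\<in>C. H +>\<^bsub>M\<^esub> (r \<odot>\<^bsub>M\<^esub> x))\<rparr>"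

definition ker_module ::
    "('a, 'm, 'k) module_scheme \<Rightarrow> ('a, 'n, 'l) module_scheme \<Rightarrow> ('m \<Rightarrow> 'n) \<Rightarrow> ('a, 'm, 'k) module_scheme"
  where "ker_module M N f = M\<lparr>carrier := a_kernel M N f\<rparr>"

definition coker_module ::
    "('a, 'm, 'k) module_scheme \<Rightarrow> ('a, 'n, 'l) module_scheme \<Rightarrow> ('m \<Rightarrow> 'n) \<Rightarrow> ('a, 'n set) module"
  where "coker_module M N f = quotient_module N (f ` carrier M)"

definition finitely_generated :: "('a, 'r) ring_scheme \<Rightarrow> ('a, 'm, 'k) module_scheme \<Rightarrow> bool"
  where "finitely_generated R M \<longleftrightarrow>
    (\<exists>S. finite S \<and> S \<subseteq> carrier M \<and> (\<lambda>H. submodule H R M) hull S = carrier M)"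

definition annihilator :: "('a, 'r) ring_scheme \<Rightarrow> ('a, 'm, 'k) module_scheme \<Rightarrow> 'a set"
  where "annihilator R M = {r \<in> carrier R. \<forall>x\<in>carrier M. r \<odot>\<^bsub>M\<^esub> x = \<zero>\<^bsub>M\<^esub>}"

text \<open>\<open>(0 :\<^sub>M \<aa>)\<close>, as a submodule of \<open>M\<close>.\<close>

definition torsion_module :: "('a, 'm, 'k) module_scheme \<Rightarrow> 'a set \<Rightarrow> ('a, 'm, 'k) module_scheme"
  where "torsion_module M \<aa> = M\<lparr>carrier := {x \<in> carrier M. \<forall>r\<in>\<aa>. r \<odot>\<^bsub>M\<^esub> x = \<zero>\<^bsub>M\<^esub>}\<rparr>"


section \<open>Dimension\<close>

text \<open>With values in the extended reals, the dimension of the zero ring is \<open>-\<infinity>\<close>.\<close>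

definition krull_dim :: "('a, 'r) ring_scheme \<Rightarrow> ereal"
  where "krull_dim R =
    (SUP n \<in> {n. \<exists>P :: nat \<Rightarrow> 'a set. (\<forall>i\<le>n. primeideal (P i) R) \<and> (\<forall>i<n. P i \<subset> P (Suc i))}.
      ereal (real n))"

definition dim_bar :: "('a, 'r) ring_scheme \<Rightarrow> ('a, 'm, 'k) module_scheme \<Rightarrow> ereal"
  where "dim_bar R M = krull_dim (R Quot annihilator R M)"

definition in_D_le :: "('a, 'r) ring_scheme \<Rightarrow> nat \<Rightarrow> ('a, 'm, 'k) module_scheme \<Rightarrow> bool"
  where "in_D_le R n M \<longleftrightarrow> module R M \<and> dim_bar R M \<le> ereal (real n)"


section \<open>Localization and support\<close>

definition frac_rel ::
    "'a set \<Rightarrow> ('a, 'm, 'k) module_scheme \<Rightarrow> (('m \<times> 'a) \<times> ('m \<times> 'a)) set"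
  where "frac_rel S M =
    {((m, s), (n, t)). m \<in> carrier M \<and> n \<in> carrier M \<and> s \<in> S \<and> t \<in> S \<and>
       (\<exists>u\<in>S. u \<odot>\<^bsub>M\<^esub> (t \<odot>\<^bsub>M\<^esub> m) = u \<odot>\<^bsub>M\<^esub> (s \<odot>\<^bsub>M\<^esub> n))}"

text \<open>\<open>S\<^sup>-\<^sup>1M\<close> as an \<open>R\<close>-module, for a multiplicative subset \<open>S\<close> of \<open>R\<close>; the pair \<open>(m, s)\<close>
  represents the fraction \<open>m/s\<close>.\<close>

definition localization ::
    "('a, 'r) ring_scheme \<Rightarrow> 'a set \<Rightarrow> ('a, 'm, 'k) module_scheme \<Rightarrow> ('a, ('m \<times> 'a) set) module"
  where "localization R S M =
    \<lparr>carrier = (carrier M \<times> S) // frac_rel S M, monoid.mult = undefined, one = undefined,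
     ring.zero = frac_rel S M `` {(\<zero>\<^bsub>M\<^esub>, \<one>\<^bsub>R\<^esub>)},
     add = (\<lambda>C D. \<Union>(m, s)\<in>C. \<Union>(n, t)\<in>D.
       frac_rel S M `` {(t \<odot>\<^bsub>M\<^esub> m \<oplus>\<^bsub>M\<^esub> s \<odot>\<^bsub>M\<^esub> n, s \<otimes>\<^bsub>R\<^esub> t)}),
     smult = (\<lambda>r C. \<Union>(m, s)\<in>C. frac_rel S M `` {(r \<odot>\<^bsub>M\<^esub> m, s)})\<rparr>"

definition Supp :: "('a, 'r) ring_scheme \<Rightarrow> ('a, 'm, 'k) module_scheme \<Rightarrow> 'a set set"
  where "Supp R M =
    {\<pp>. primeideal \<pp> R \<and>
       carrier (localization R (carrier R - \<pp>) M) \<noteq> {\<zero>\<^bsub>localization R (carrier R - \<pp>) M\<^esub>}}"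

definition zero_locus :: "('a, 'r) ring_scheme \<Rightarrow> 'a set \<Rightarrow> 'a set set"
  where "zero_locus R \<aa> = {\<pp>. primeideal \<pp> R \<and> \<aa> \<subseteq> \<pp>}"


section \<open>Free modules and a canonical free resolution\<close>

definition free_module :: "('a, 'r) ring_scheme \<Rightarrow> 'x set \<Rightarrow> ('a, 'x \<Rightarrow> 'a) module"
  where "free_module R B =
    \<lparr>carrier = {f. (\<forall>x. f x \<in> carrier R) \<and> (\<forall>x. x \<notin> B \<longrightarrow> f x = \<zero>\<^bsub>R\<^esub>) \<and> finite {x. f x \<noteq> \<zero>\<^bsub>R\<^esub>}},
     monoid.mult = undefined, one = undefined, ring.zero = (\<lambda>_. \<zero>\<^bsub>R\<^esub>),
     add = (\<lambda>f g x. f x \<oplus>\<^bsub>R\<^esub> g x), smult = (\<lambda>r f x. r \<otimes>\<^bsub>R\<^esub> f x)\<rparr>"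

text \<open>The linear map from a free module to \<open>M\<close> that sends the basis element \<open>x\<close> to \<open>\<phi> x\<close>.\<close>

definition lin_ext ::
    "('a, 'r) ring_scheme \<Rightarrow> ('a, 'm, 'k) module_scheme \<Rightarrow> ('x \<Rightarrow> 'm) \<Rightarrow> ('x \<Rightarrow> 'a) \<Rightarrow> 'm"
  where "lin_ext R M \<phi> f = (\<Oplus>\<^bsub>M\<^esub>x\<in>{x. f x \<noteq> \<zero>\<^bsub>R\<^esub>}. f x \<odot>\<^bsub>M\<^esub> \<phi> x)"

text \<open>The list \<open>[(r\<^sub>1, x\<^sub>1), \<dots>, (r\<^sub>k, x\<^sub>k)]\<close> denotes the element \<open>r\<^sub>1 x\<^sub>1 + \<dots> + r\<^sub>k x\<^sub>k\<close> of a free module.\<close>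

primrec formal_sum :: "('a, 'r) ring_scheme \<Rightarrow> ('a \<times> 'x) list \<Rightarrow> 'x \<Rightarrow> 'a"
  where
    "formal_sum R [] = (\<lambda>_. \<zero>\<^bsub>R\<^esub>)"
  | "formal_sum R (p # l) = (formal_sum R l)(snd p := fst p \<oplus>\<^bsub>R\<^esub> formal_sum R l (snd p))"

text \<open>In the standard free resolution of \<open>A\<close>, degree \<open>0\<close> is free on the elements of \<open>A\<close>, and degree
  \<open>n + 1\<close> is free on the formal sums that represent an element of the kernel of the preceding map
  (the augmentation if \<open>n = 0\<close>). The nested type of generators accommodates all degrees at once.\<close>

datatype ('a, 'c) gen = Base (base_elem: 'c) | Rel "('a \<times> ('a, 'c) gen) list"

primrec boundary :: "('a, 'r) ring_scheme \<Rightarrow> ('a, 'c) gen \<Rightarrow> ('a, 'c) gen \<Rightarrow> 'a"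
  where
    "boundary R (Base c) = (\<lambda>_. \<zero>\<^bsub>R\<^esub>)"
  | "boundary R (Rel l) = formal_sum R l"

fun gens :: "('a, 'r) ring_scheme \<Rightarrow> ('a, 'c, 'k) module_scheme \<Rightarrow> nat \<Rightarrow> ('a, 'c) gen set"
  where
    "gens R A 0 = Base ` carrier A"
  | "gens R A (Suc 0) =
      {Rel l |l. set l \<subseteq> carrier R \<times> gens R A 0 \<and> lin_ext R A base_elem (formal_sum R l) = \<zero>\<^bsub>A\<^esub>}"
  | "gens R A (Suc (Suc n)) =
      {Rel l |l. set l \<subseteq> carrier R \<times> gens R A (Suc n) \<and>
         lin_ext R (free_module R (gens R A n)) (boundary R) (formal_sum R l)
           = \<zero>\<^bsub>free_module R (gens R A n)\<^esub>}"

definition std_res ::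
    "('a, 'r) ring_scheme \<Rightarrow> ('a, 'c, 'k) module_scheme \<Rightarrow> nat \<Rightarrow> ('a, ('a, 'c) gen \<Rightarrow> 'a) module"
  where "std_res R A n = free_module R (gens R A n)"

definition std_aug ::
    "('a, 'r) ring_scheme \<Rightarrow> ('a, 'c, 'k) module_scheme \<Rightarrow> (('a, 'c) gen \<Rightarrow> 'a) \<Rightarrow> 'c"
  where "std_aug R A = lin_ext R A base_elem"

text \<open>\<open>std_diff R A n\<close> is the differential from degree \<open>n + 1\<close> to degree \<open>n\<close>.\<close>

definition std_diff ::
    "('a, 'r) ring_scheme \<Rightarrow> ('a, 'c, 'k) module_scheme \<Rightarrow> nat
      \<Rightarrow> (('a, 'c) gen \<Rightarrow> 'a) \<Rightarrow> (('a, 'c) gen \<Rightarrow> 'a)"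
  where "std_diff R A n = lin_ext R (std_res R A n) (boundary R)"

text \<open>The standard resolution is a resolution of the given module by free modules.\<close>

lemma (in cring) module_free_module: "module R (free_module R B)"
proof (rule moduleI)
  show "cring R" ..
  let ?F = "free_module R B"
  have add_closed: "f \<oplus>\<^bsub>?F\<^esub> g \<in> carrier ?F" if f: "f \<in> carrier ?F" and g: "g \<in> carrier ?F" for f g
  proof -
    have "finite ({x. f x \<noteq> \<zero>} \<union> {x. g x \<noteq> \<zero>})"
      using f g by (simp add: free_module_def)
    then have "finite {x. f x \<oplus> g x \<noteq> \<zero>}"
      by (rule rev_finite_subset) auto
    then show ?thesis using f g by (simp add: free_module_def)
  qed
  show "abelian_group ?F"
  proof (rule abelian_groupI)
    fix f assume f: "f \<in> carrier ?F"
    have "{x. \<ominus> f x \<noteq> \<zero>} \<subseteq> {x. f x \<noteq> \<zero>}" by auto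
    then have "(\<lambda>x. \<ominus> f x) \<in> carrier ?F"
      using f by (auto simp: free_module_def intro: finite_subset)
    moreover have "(\<lambda>x. \<ominus> f x) \<oplus>\<^bsub>?F\<^esub> f = \<zero>\<^bsub>?F\<^esub>"
      using f by (auto simp: free_module_def l_neg)
    ultimately show "\<exists>g\<in>carrier ?F. g \<oplus>\<^bsub>?F\<^esub> f = \<zero>\<^bsub>?F\<^esub>" by blast
  qed (simp add: add_closed, auto simp: free_module_def a_ac)
next
  fix a f assume "a \<in> carrier R" "f \<in> carrier (free_module R B)"
  moreover have "{x. a \<otimes> f x \<noteq> \<zero>} \<subseteq> {x. f x \<noteq> \<zero>}"
    using calculation by auto
  ultimately show "a \<odot>\<^bsub>free_module R B\<^esub> f \<in> carrier (free_module R B)"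
    by (auto simp: free_module_def intro: finite_subset)
qed (auto simp: free_module_def l_distr r_distr m_assoc)

lemma (in module) lin_ext_eq:
  assumes f: "f \<in> carrier (free_module R B)" and \<phi>: "\<phi> \<in> B \<rightarrow> carrier M"
    and S: "finite S" "{x. f x \<noteq> \<zero>\<^bsub>R\<^esub>} \<subseteq> S" "S \<subseteq> B"
  shows "lin_ext R M \<phi> f = (\<Oplus>\<^bsub>M\<^esub>x\<in>S. f x \<odot>\<^bsub>M\<^esub> \<phi> x)"
  unfolding lin_ext_def
proof (rule M.add.finprod_mono_neutral_cong_left)
  fix i assume "i \<in> S - {x. f x \<noteq> \<zero>\<^bsub>R\<^esub>}"
  then show "f i \<odot>\<^bsub>M\<^esub> \<phi> i = \<zero>\<^bsub>M\<^esub>"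
    using S \<phi> by (auto simp: Pi_iff)
next
  show "(\<lambda>x. f x \<odot>\<^bsub>M\<^esub> \<phi> x) \<in> S \<rightarrow> carrier M"
    using S \<phi> f by (auto simp: Pi_iff free_module_def)
qed (use S in auto)

lemma (in module) lin_ext_hom:
  assumes \<phi>: "\<phi> \<in> B \<rightarrow> carrier M"
  shows "lin_ext R M \<phi> \<in> mod_hom R (free_module R B) M"
proof -
  let ?F = "free_module R B"
  interpret F: module R ?F by (rule R.module_free_module)
  have supp: "finite {x. f x \<noteq> \<zero>\<^bsub>R\<^esub>}" "{x. f x \<noteq> \<zero>\<^bsub>R\<^esub>} \<subseteq> B" if "f \<in> carrier ?F" for f
    using that by (auto simp: free_module_def)
  have 1: "lin_ext R M \<phi> f \<in> carrier M" if "f \<in> carrier ?F" for f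
    unfolding lin_ext_def using that \<phi> by (intro M.finsum_closed) (auto simp: free_module_def Pi_iff)
  have 2: "lin_ext R M \<phi> (f \<oplus>\<^bsub>?F\<^esub> g) = lin_ext R M \<phi> f \<oplus>\<^bsub>M\<^esub> lin_ext R M \<phi> g"
    if f: "f \<in> carrier ?F" and g: "g \<in> carrier ?F" for f g
  proof -
    let ?S = "{x. f x \<noteq> \<zero>\<^bsub>R\<^esub>} \<union> {x. g x \<noteq> \<zero>\<^bsub>R\<^esub>}"
    have S: "finite ?S" "?S \<subseteq> B" using supp f g by auto
    have fS: "lin_ext R M \<phi> f = (\<Oplus>\<^bsub>M\<^esub>x\<in>?S. f x \<odot>\<^bsub>M\<^esub> \<phi> x)"
      by (rule lin_ext_eq[OF f \<phi> S(1) _ S(2)]) auto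
    have gS: "lin_ext R M \<phi> g = (\<Oplus>\<^bsub>M\<^esub>x\<in>?S. g x \<odot>\<^bsub>M\<^esub> \<phi> x)"
      by (rule lin_ext_eq[OF g \<phi> S(1) _ S(2)]) auto
    have "lin_ext R M \<phi> (f \<oplus>\<^bsub>?F\<^esub> g) = (\<Oplus>\<^bsub>M\<^esub>x\<in>?S. (f \<oplus>\<^bsub>?F\<^esub> g) x \<odot>\<^bsub>M\<^esub> \<phi> x)"
      by (rule lin_ext_eq[OF F.M.a_closed[OF f g] \<phi> S(1) _ S(2)]) (auto simp: free_module_def)
    also have "\<dots> = (\<Oplus>\<^bsub>M\<^esub>x\<in>?S. f x \<odot>\<^bsub>M\<^esub> \<phi> x \<oplus>\<^bsub>M\<^esub> g x \<odot>\<^bsub>M\<^esub> \<phi> x)"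
      using f g \<phi> S by (intro M.finsum_cong') (auto simp: free_module_def Pi_iff smult_l_distr subset_iff)
    also have "\<dots> = lin_ext R M \<phi> f \<oplus>\<^bsub>M\<^esub> lin_ext R M \<phi> g"
      unfolding fS gS
      using f g \<phi> S by (intro M.finsum_addf) (auto simp: free_module_def Pi_iff subset_iff)
    finally show ?thesis .
  qed
  have 3: "lin_ext R M \<phi> (r \<odot>\<^bsub>?F\<^esub> f) = r \<odot>\<^bsub>M\<^esub> lin_ext R M \<phi> f"
    if r: "r \<in> carrier R" and f: "f \<in> carrier ?F" for r f
  proof -
    let ?S = "{x. f x \<noteq> \<zero>\<^bsub>R\<^esub>}"
    have "lin_ext R M \<phi> (r \<odot>\<^bsub>?F\<^esub> f) = (\<Oplus>\<^bsub>M\<^esub>x\<in>?S. (r \<odot>\<^bsub>?F\<^esub> f) x \<odot>\<^bsub>M\<^esub> \<phi> x)"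
      using r by (intro lin_ext_eq[OF F.smult_closed[OF r f] \<phi>] supp[OF f]) (auto simp: free_module_def)
    also have "\<dots> = (\<Oplus>\<^bsub>M\<^esub>x\<in>?S. r \<odot>\<^bsub>M\<^esub> (f x \<odot>\<^bsub>M\<^esub> \<phi> x))"
      using f r \<phi> supp[OF f] by (intro M.finsum_cong') (auto simp: free_module_def Pi_iff smult_assoc1 subset_iff)
    also have "\<dots> = r \<odot>\<^bsub>M\<^esub> lin_ext R M \<phi> f"
      unfolding lin_ext_def using f r \<phi> supp[OF f]
      by (intro finsum_smult_ldistr[symmetric]) (auto simp: free_module_def Pi_iff)
    finally show ?thesis .
  qed
  show ?thesis using 1 2 3 by (auto simp: mod_hom_def)
qed

lemma (in cring) formal_sum_closed:
  assumes "set l \<subseteq> carrier R \<times> B"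
  shows "formal_sum R l \<in> carrier (free_module R B)"
  using assms
proof (induction l)
  case Nil
  then show ?case by (simp add: free_module_def)
next
  case (Cons p l)
  then have "formal_sum R l \<in> carrier (free_module R B)" by auto
  moreover have "finite {x. ((formal_sum R l)(snd p := fst p \<oplus> formal_sum R l (snd p))) x \<noteq> \<zero>}"
    if "finite {x. formal_sum R l x \<noteq> \<zero>}"
    by (rule finite_subset[OF _ finite.insertI[OF that, of "snd p"]]) auto
  ultimately show ?case
    using Cons.prems by (auto simp: free_module_def)
qed

lemma (in cring) formal_sum_surj:
  assumes "f \<in> carrier (free_module R B)"
  shows "\<exists>l. set l \<subseteq> carrier R \<times> B \<and> formal_sum R l = f"
proof -
  have "\<forall>f\<in>carrier (free_module R B). {x. f x \<noteq> \<zero>} = S \<longrightarrow>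
    (\<exists>l. set l \<subseteq> carrier R \<times> B \<and> formal_sum R l = f)" if "finite S" for S
    using that
  proof induction
    case empty
    then show ?case by (auto intro!: exI[of _ "[]"])
  next
    case (insert x S)
    show ?case
    proof (intro ballI impI)
      fix f assume f: "f \<in> carrier (free_module R B)" and S: "{x. f x \<noteq> \<zero>} = insert x S"
      let ?g = "f(x := \<zero>)"
      have gS: "{y. ?g y \<noteq> \<zero>} = S" using S insert.hyps by auto
      moreover have "?g \<in> carrier (free_module R B)"
        using f gS insert.hyps by (auto simp: free_module_def)
      ultimately obtain l where l: "set l \<subseteq> carrier R \<times> B" "formal_sum R l = ?g"
        using insert.IH by blast
      have "x \<in> B" "f x \<in> carrier R" using f S by (auto simp: free_module_def)
      then show "\<exists>l. set l \<subseteq> carrier R \<times> B \<and> formal_sum R l = f"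
        using l by (intro exI[of _ "(f x, x) # l"]) auto
    qed
  qed
  then show ?thesis using assms by (auto simp: free_module_def)
qed

lemma (in module) lin_ext_basis:
  assumes \<phi>: "\<phi> \<in> B \<rightarrow> carrier M" and x: "x \<in> B"
  shows "lin_ext R M \<phi> (formal_sum R [(\<one>\<^bsub>R\<^esub>, x)]) = \<phi> x"
proof -
  have "formal_sum R [(\<one>\<^bsub>R\<^esub>, x)] \<in> carrier (free_module R B)"
    using x by (intro R.formal_sum_closed) auto
  then have "lin_ext R M \<phi> (formal_sum R [(\<one>\<^bsub>R\<^esub>, x)])
      = (\<Oplus>\<^bsub>M\<^esub>y\<in>{x}. formal_sum R [(\<one>\<^bsub>R\<^esub>, x)] y \<odot>\<^bsub>M\<^esub> \<phi> y)"
    using x by (intro lin_ext_eq[OF _ \<phi>]) (auto split: if_splits)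
  also have "\<dots> = \<phi> x"
    using x \<phi> by (auto simp: Pi_iff)
  finally show ?thesis .
qed

lemma mod_hom_lin_ext_zero:
  assumes M: "module R M" and N: "module R N" and h: "h \<in> mod_hom R M N"
    and \<phi>: "\<And>x. x \<in> B \<Longrightarrow> \<phi> x \<in> carrier M \<and> h (\<phi> x) = \<zero>\<^bsub>N\<^esub>"
    and f: "f \<in> carrier (free_module R B)"
  shows "h (lin_ext R M \<phi> f) = \<zero>\<^bsub>N\<^esub>"
proof -
  interpret M: module R M by fact
  interpret N: module R N by fact
  have h0: "h \<zero>\<^bsub>M\<^esub> = \<zero>\<^bsub>N\<^esub>"
  proof -
    have "h (\<zero>\<^bsub>R\<^esub> \<odot>\<^bsub>M\<^esub> \<zero>\<^bsub>M\<^esub>) = \<zero>\<^bsub>R\<^esub> \<odot>\<^bsub>N\<^esub> h \<zero>\<^bsub>M\<^esub>"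
      using h unfolding mod_hom_def by blast
    moreover have "h \<zero>\<^bsub>M\<^esub> \<in> carrier N" using h by (auto simp: mod_hom_def)
    ultimately show ?thesis by simp
  qed
  have "(\<Oplus>\<^bsub>M\<^esub>x\<in>S. f x \<odot>\<^bsub>M\<^esub> \<phi> x) \<in> carrier M \<and> h (\<Oplus>\<^bsub>M\<^esub>x\<in>S. f x \<odot>\<^bsub>M\<^esub> \<phi> x) = \<zero>\<^bsub>N\<^esub>"
    if "finite S" "S \<subseteq> B" for S
    using that
  proof induction
    case (insert x S)
    have fc: "\<And>y. f y \<in> carrier R" using f by (simp add: free_module_def)
    have c: "(\<lambda>x. f x \<odot>\<^bsub>M\<^esub> \<phi> x) \<in> S \<rightarrow> carrier M" "f x \<odot>\<^bsub>M\<^esub> \<phi> x \<in> carrier M"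
      using insert.prems \<phi> fc by auto
    moreover have "h (f x \<odot>\<^bsub>M\<^esub> \<phi> x) = \<zero>\<^bsub>N\<^esub>"
      using h \<phi>[of x] insert.prems fc[of x] by (simp add: mod_hom_def)
    ultimately show ?case
      using insert h by (simp add: mod_hom_def)
  qed (simp add: h0)
  then show ?thesis using f by (auto simp: lin_ext_def free_module_def)
qed

lemma base_gens_0: "base_elem \<in> gens R A 0 \<rightarrow> carrier A"
  by auto

lemma (in cring) boundary_gens:
  "boundary R \<in> gens R A (Suc n) \<rightarrow> carrier (std_res R A n)"
  by (cases n) (auto simp: std_res_def formal_sum_closed)

theorem (in module) std_res_resolution:
  shows "module R (std_res R M n)"
    and "std_aug R M \<in> mod_hom R (std_res R M 0) M"
    and "std_diff R M n \<in> mod_hom R (std_res R M (Suc n)) (std_res R M n)"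
    and "std_aug R M ` carrier (std_res R M 0) = carrier M"
    and "std_diff R M 0 ` carrier (std_res R M 1)
         = {x \<in> carrier (std_res R M 0). std_aug R M x = \<zero>\<^bsub>M\<^esub>}"
    and "std_diff R M (Suc n) ` carrier (std_res R M (Suc (Suc n)))
         = {x \<in> carrier (std_res R M (Suc n)). std_diff R M n x = \<zero>\<^bsub>std_res R M n\<^esub>}"
proof -
  show mod: "module R (std_res R M n)" for n
    unfolding std_res_def by (rule R.module_free_module)
  show aug: "std_aug R M \<in> mod_hom R (std_res R M 0) M"
    unfolding std_res_def std_aug_def by (rule lin_ext_hom[OF base_gens_0])
  show diff: "std_diff R M n \<in> mod_hom R (std_res R M (Suc n)) (std_res R M n)" for n
    unfolding std_diff_def std_res_def[of R M "Suc n"]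
    by (rule module.lin_ext_hom[OF mod R.boundary_gens])
  have basis: "std_diff R M n (formal_sum R [(\<one>\<^bsub>R\<^esub>, x)]) = boundary R x"
      "formal_sum R [(\<one>\<^bsub>R\<^esub>, x)] \<in> carrier (std_res R M (Suc n))" if "x \<in> gens R M (Suc n)" for x n
    unfolding std_diff_def std_res_def[of R M "Suc n"]
    using module.lin_ext_basis[OF mod R.boundary_gens that] that by (auto intro!: R.formal_sum_closed simp del: formal_sum.simps)
  show "std_aug R M ` carrier (std_res R M 0) = carrier M"
  proof (intro equalityI subsetI)
    fix x assume "x \<in> carrier M"
    then have b: "Base x \<in> gens R M 0" by simp
    then have "formal_sum R [(\<one>\<^bsub>R\<^esub>, Base x)] \<in> carrier (std_res R M 0)"
      unfolding std_res_def by (intro R.formal_sum_closed) auto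
    moreover have "std_aug R M (formal_sum R [(\<one>\<^bsub>R\<^esub>, Base x)]) = x"
      unfolding std_aug_def using lin_ext_basis[OF base_gens_0 b] by simp
    ultimately show "x \<in> std_aug R M ` carrier (std_res R M 0)" by (metis imageI)
  qed (use aug in \<open>auto simp: mod_hom_def\<close>)
  show "std_diff R M 0 ` carrier (std_res R M 1)
         = {x \<in> carrier (std_res R M 0). std_aug R M x = \<zero>\<^bsub>M\<^esub>}" (is "?L = ?R")
  proof (intro equalityI subsetI)
    fix y assume "y \<in> ?L"
    then obtain f where f: "f \<in> carrier (std_res R M (Suc 0))" "y = std_diff R M 0 f" by auto
    have "std_aug R M (lin_ext R (std_res R M 0) (boundary R) f) = \<zero>\<^bsub>M\<^esub>"
      by (rule mod_hom_lin_ext_zero[OF mod module_axioms aug _ f(1)[unfolded std_res_def]])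
        (auto simp: std_res_def std_aug_def R.formal_sum_closed)
    then show "y \<in> ?R" using f diff[of 0] by (auto simp: std_diff_def mod_hom_def)
  next
    fix y assume y: "y \<in> ?R"
    then obtain l where l: "set l \<subseteq> carrier R \<times> gens R M 0" "formal_sum R l = y"
      using R.formal_sum_surj unfolding std_res_def by blast
    then have "Rel l \<in> gens R M (Suc 0)" using y by (simp add: std_aug_def)
    from basis[OF this] l show "y \<in> ?L" by (simp del: formal_sum.simps) (metis imageI)
  qed
  show "std_diff R M (Suc n) ` carrier (std_res R M (Suc (Suc n)))
         = {x \<in> carrier (std_res R M (Suc n)). std_diff R M n x = \<zero>\<^bsub>std_res R M n\<^esub>}" (is "?L = ?R")
  proof (intro equalityI subsetI)
    fix y assume "y \<in> ?L"
    then obtain f where f: "f \<in> carrier (std_res R M (Suc (Suc n)))" "y = std_diff R M (Suc n) f" by auto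
    have "std_diff R M n (lin_ext R (std_res R M (Suc n)) (boundary R) f) = \<zero>\<^bsub>std_res R M n\<^esub>"
      by (rule mod_hom_lin_ext_zero[OF mod mod diff _ f(1)[unfolded std_res_def]])
        (auto simp: std_res_def std_diff_def R.formal_sum_closed)
    then show "y \<in> ?R" using f diff[of "Suc n"] by (auto simp: std_diff_def mod_hom_def)
  next
    fix y assume y: "y \<in> ?R"
    then obtain l where l: "set l \<subseteq> carrier R \<times> gens R M (Suc n)" "formal_sum R l = y"
      using R.formal_sum_surj unfolding std_res_def by blast
    then have "Rel l \<in> gens R M (Suc (Suc n))" using y by (simp add: std_diff_def std_res_def)
    from basis[OF this] l show "y \<in> ?L" by (simp del: formal_sum.simps) (metis imageI)
  qed
qed


section \<open>Ext and cofinite modules\<close>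

text \<open>Cohomology of the complex \<open>Hom(P\<^sub>0, M) \<rightarrow> Hom(P\<^sub>1, M) \<rightarrow> \<dots>\<close>, where \<open>d n\<close> maps \<open>P (n + 1)\<close> to \<open>P n\<close>.\<close>

definition cocycles ::
    "('a, 'r) ring_scheme \<Rightarrow> (nat \<Rightarrow> ('a, 'p, 'k) module_scheme) \<Rightarrow> (nat \<Rightarrow> 'p \<Rightarrow> 'p)
      \<Rightarrow> ('a, 'm, 'l) module_scheme \<Rightarrow> nat \<Rightarrow> ('p \<Rightarrow> 'm) set"
  where "cocycles R P d M n =
    {\<phi> \<in> carrier (Hom_module R (P n) M). \<forall>x\<in>carrier (P (Suc n)). \<phi> (d n x) = \<zero>\<^bsub>M\<^esub>}"

primrec coboundaries ::
    "('a, 'r) ring_scheme \<Rightarrow> (nat \<Rightarrow> ('a, 'p, 'k) module_scheme) \<Rightarrow> (nat \<Rightarrow> 'p \<Rightarrow> 'p)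
      \<Rightarrow> ('a, 'm, 'l) module_scheme \<Rightarrow> nat \<Rightarrow> ('p \<Rightarrow> 'm) set"
  where
    "coboundaries R P d M 0 = {\<zero>\<^bsub>Hom_module R (P 0) M\<^esub>}"
  | "coboundaries R P d M (Suc n) =
      (\<lambda>\<psi>. \<lambda>x\<in>carrier (P (Suc n)). \<psi> (d n x)) ` carrier (Hom_module R (P n) M)"

definition Hom_cohomology ::
    "('a, 'r) ring_scheme \<Rightarrow> (nat \<Rightarrow> ('a, 'p, 'k) module_scheme) \<Rightarrow> (nat \<Rightarrow> 'p \<Rightarrow> 'p)
      \<Rightarrow> ('a, 'm, 'l) module_scheme \<Rightarrow> nat \<Rightarrow> ('a, ('p \<Rightarrow> 'm) set) module"
  where "Hom_cohomology R P d M n =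
    quotient_module (Hom_module R (P n) M\<lparr>carrier := cocycles R P d M n\<rparr>) (coboundaries R P d M n)"

definition Ext ::
    "('a, 'r) ring_scheme \<Rightarrow> nat \<Rightarrow> ('a, 'c, 'k) module_scheme \<Rightarrow> ('a, 'm, 'l) module_scheme
      \<Rightarrow> ('a, ((('a, 'c) gen \<Rightarrow> 'a) \<Rightarrow> 'm) set) module"
  where "Ext R n A M = Hom_cohomology R (std_res R A) (std_diff R A) M n"

definition cofinite_module ::
    "('a, 'r) ring_scheme \<Rightarrow> 'a set \<Rightarrow> ('a, 'm, 'k) module_scheme \<Rightarrow> bool"
  where "cofinite_module R \<aa> M \<longleftrightarrow>
    module R M \<and> Supp R M \<subseteq> zero_locus R \<aa> \<and>
    (\<forall>i. finitely_generated R (Ext R i (quotient_module (regular_module R) \<aa>) M))"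

end

theory Submission
  imports Defs
begin

text \<open>Let \<open>K\<close>, \<open>I\<close> and \<open>C\<close> be the kernel, image and cokernel of \<open>f\<close>, and write \<open>E\<^sup>i(X)\<close> for
  \<open>Ext\<^sup>i(R/\<aa>, X)\<close>. If \<open>E\<^sup>0(C) = (0 : \<aa>)\<close> is finitely generated, the long exact sequences show that
  \<open>E\<^sup>0(I)\<close>, \<open>E\<^sup>1(I)\<close> and then \<open>E\<^sup>0(K)\<close>, \<open>E\<^sup>1(K)\<close>, \<open>E\<^sup>2(K)\<close> are finitely generated. The key point is that
  for an \<open>\<aa>\<close>-torsion module \<open>K\<close> with \<open>dim R/Ann K \<le> 3\<close> all \<open>E\<^sup>i(K)\<close> are then finitely generated;
  from \<open>K\<close> one passes back to \<open>I\<close> and \<open>C\<close>.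

  The key point is proved by induction on the dimension. Up to a finitely generated quotient one may
  assume that \<open>Ann K\<close> is saturated with respect to \<open>\<aa>\<close>; then some \<open>x \<in> \<aa>\<close> lies in no minimal prime of
  \<open>Ann K\<close>, and the assertion holds for \<open>(0 : x)\<close> and \<open>K/xK\<close> by induction. It follows for \<open>K\<close> since
  multiplication by \<open>x\<close> factors through \<open>xK\<close> and is zero on every \<open>E\<^sup>i\<close>.\<close>

section \<open>Finite generation modulo a submodule\<close>

text \<open>A quotient module has a new element type, while the induction passes to subquotients
  again and again. Every statement about a subquotient Z/H is therefore made by means of two
  submodules H and Z of one fixed module; \<open>fg_over\<close> is finite generation in this form.
  Ext is defined by the standard resolution, whose free modules are in general not finitely
  generated. What a resolution by finitely generated free modules would give is recovered from a
  homotopy into a finitely generated subcomplex. With the zero subcomplex the same construction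
  shows that elements of \<aa> act as zero on Ext. The reduction to a saturated annihilator is
  forced: minimal primes of the annihilator may contain \<aa>, and no element of \<aa> avoids those.
  The bound 3 is where two counts meet. The induction starts from degree 0 in dimensions 0 and 1,
  from degrees 0 and 1 in dimension 2, and from degrees 0, 1, 2 in dimension 3. The long exact
  sequences hand over just these three degrees for the kernel; inside the induction (0 : x) gets
  degrees 0 and 1, enough for dimension 2. Dimension 1 rests on descending chains instead, since
  degree 0 of K/xK is not at hand there.\<close>

definition fg_over ::
    "('a, 'r) ring_scheme \<Rightarrow> ('a, 'm, 'k) module_scheme \<Rightarrow> 'm set \<Rightarrow> 'm set \<Rightarrow> bool"
  where "fg_over R X H Z \<longleftrightarrow>
    (\<exists>S. finite S \<and> S \<subseteq> Z \<and> (\<forall>T. submodule T R X \<and> H \<subseteq> T \<and> S \<subseteq> T \<longrightarrow> Z \<subseteq> T))"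

definition adjoin ::
    "('a, 'r) ring_scheme \<Rightarrow> ('a, 'm, 'k) module_scheme \<Rightarrow> 'm set \<Rightarrow> 'm \<Rightarrow> 'm set"
  where "adjoin R X T s = {r \<odot>\<^bsub>X\<^esub> s \<oplus>\<^bsub>X\<^esub> t |r t. r \<in> carrier R \<and> t \<in> T}"

context module
begin

lemma submodule_mem: "submodule H R M \<Longrightarrow> x \<in> H \<Longrightarrow> x \<in> carrier M"
  using submoduleE(1) by blast

lemma submodule_zero: "submodule H R M \<Longrightarrow> \<zero>\<^bsub>M\<^esub> \<in> H"
  using submoduleE(2)[of H] submoduleE(4)[of H "\<zero>"] submodule_mem[of H]
  by (metis R.zero_closed ex_in_conv smult_l_null)

lemma submodule_minus: "submodule H R M \<Longrightarrow> x \<in> H \<Longrightarrow> y \<in> H \<Longrightarrow> x \<ominus>\<^bsub>M\<^esub> y \<in> H"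
  by (simp add: a_minus_def submoduleE)

lemmas submodule_closed = submoduleE(3-5) submodule_zero submodule_minus

lemma submodule_minus_cancel:
  "submodule H R M \<Longrightarrow> x \<in> carrier M \<Longrightarrow> y \<in> H \<Longrightarrow> x \<ominus>\<^bsub>M\<^esub> y \<in> H \<Longrightarrow> x \<in> H"
  by (metis M.add.inv_solve_right' M.minus_closed a_minus_def submoduleE(5) submodule_mem)

lemma minus_add_cancel: "x \<in> carrier M \<Longrightarrow> y \<in> carrier M \<Longrightarrow> (x \<ominus>\<^bsub>M\<^esub> y) \<oplus>\<^bsub>M\<^esub> y = x"
  by (simp add: M.a_assoc M.l_neg a_minus_def)

lemma minus_add_distrib4:
  "\<lbrakk>a \<in> carrier M; b \<in> carrier M; c \<in> carrier M; d \<in> carrier M\<rbrakk>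
    \<Longrightarrow> (a \<oplus>\<^bsub>M\<^esub> b) \<ominus>\<^bsub>M\<^esub> (c \<oplus>\<^bsub>M\<^esub> d) = (a \<ominus>\<^bsub>M\<^esub> c) \<oplus>\<^bsub>M\<^esub> (b \<ominus>\<^bsub>M\<^esub> d)"
  by (simp add: a_minus_def M.minus_add M.a_ac)

lemma minus_trans:
  "\<lbrakk>a \<in> carrier M; b \<in> carrier M; c \<in> carrier M\<rbrakk> \<Longrightarrow> (a \<ominus>\<^bsub>M\<^esub> b) \<oplus>\<^bsub>M\<^esub> (b \<ominus>\<^bsub>M\<^esub> c) = a \<ominus>\<^bsub>M\<^esub> c"
  by (metis M.a_assoc M.minus_closed a_minus_def minus_add_cancel M.a_inv_closed)

lemma minus_self: "x \<in> carrier M \<Longrightarrow> x \<ominus>\<^bsub>M\<^esub> x = \<zero>\<^bsub>M\<^esub>"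
  by (simp add: M.r_neg a_minus_def)

lemma minus_eq_zero: "x \<in> carrier M \<Longrightarrow> y \<in> carrier M \<Longrightarrow> x \<ominus>\<^bsub>M\<^esub> y = \<zero>\<^bsub>M\<^esub> \<longleftrightarrow> x = y"
  by (metis M.l_zero minus_add_cancel minus_self)

lemma smult_minus_distr:
  "\<lbrakk>r \<in> carrier R; x \<in> carrier M; y \<in> carrier M\<rbrakk> \<Longrightarrow> r \<odot>\<^bsub>M\<^esub> (x \<ominus>\<^bsub>M\<^esub> y) = r \<odot>\<^bsub>M\<^esub> x \<ominus>\<^bsub>M\<^esub> r \<odot>\<^bsub>M\<^esub> y"
  by (simp add: a_minus_def smult_r_distr smult_r_minus)

lemma submoduleI':
  assumes "H \<subseteq> carrier M" "\<zero>\<^bsub>M\<^esub> \<in> H" "\<And>a b. \<lbrakk>a \<in> H; b \<in> H\<rbrakk> \<Longrightarrow> a \<oplus>\<^bsub>M\<^esub> b \<in> H"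
    "\<And>a x. \<lbrakk>a \<in> carrier R; x \<in> H\<rbrakk> \<Longrightarrow> a \<odot>\<^bsub>M\<^esub> x \<in> H"
  shows "submodule H R M"
proof (rule submoduleI)
  fix x assume "x \<in> H"
  then have "(\<ominus> \<one>) \<odot>\<^bsub>M\<^esub> x \<in> H" "x \<in> carrier M" using assms by auto
  then show "\<ominus>\<^bsub>M\<^esub> x \<in> H" by (simp add: smult_l_minus)
qed (use assms in auto)

lemma submodule_trivial: "submodule {\<zero>\<^bsub>M\<^esub>} R M"
  by (rule submoduleI') auto

lemma submodule_inter: "submodule H R M \<Longrightarrow> submodule K R M \<Longrightarrow> submodule (H \<inter> K) R M"
  by (rule submoduleI') (auto simp: submodule_closed dest: submodule_mem)

lemma submodule_colon:
  assumes "submodule Z R M" "submodule H R M" "J \<subseteq> carrier R"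
  shows "submodule {z \<in> Z. \<forall>r\<in>J. r \<odot>\<^bsub>M\<^esub> z \<in> H} R M"
proof (rule submoduleI')
  fix s x assume s: "s \<in> carrier R" and x: "x \<in> {z \<in> Z. \<forall>r\<in>J. r \<odot>\<^bsub>M\<^esub> z \<in> H}"
  have "r \<odot>\<^bsub>M\<^esub> (s \<odot>\<^bsub>M\<^esub> x) = s \<odot>\<^bsub>M\<^esub> (r \<odot>\<^bsub>M\<^esub> x)" if "r \<in> J" for r
  proof -
    have "r \<in> carrier R" "x \<in> carrier M" using assms that x submodule_mem[OF assms(1)] by auto
    then show ?thesis using s by (metis smult_assoc1 R.m_comm)
  qed
  then show "s \<odot>\<^bsub>M\<^esub> x \<in> {z \<in> Z. \<forall>r\<in>J. r \<odot>\<^bsub>M\<^esub> z \<in> H}"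
    using assms s x by (auto simp: submodule_closed)
next
  have ZM: "z \<in> Z \<Longrightarrow> z \<in> carrier M" for z using submodule_mem[OF assms(1)] .
  show "{z \<in> Z. \<forall>r\<in>J. r \<odot>\<^bsub>M\<^esub> z \<in> H} \<subseteq> carrier M" using ZM by auto
  show "\<zero>\<^bsub>M\<^esub> \<in> {z \<in> Z. \<forall>r\<in>J. r \<odot>\<^bsub>M\<^esub> z \<in> H}"
    using assms submodule_zero by (auto simp: subset_iff)
  fix x y assume "x \<in> {z \<in> Z. \<forall>r\<in>J. r \<odot>\<^bsub>M\<^esub> z \<in> H}" "y \<in> {z \<in> Z. \<forall>r\<in>J. r \<odot>\<^bsub>M\<^esub> z \<in> H}"
  then show "x \<oplus>\<^bsub>M\<^esub> y \<in> {z \<in> Z. \<forall>r\<in>J. r \<odot>\<^bsub>M\<^esub> z \<in> H}"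
    using assms ZM submodule_closed(3)[OF assms(1)] submodule_closed(3)[OF assms(2)]
    by (auto simp: smult_r_distr subset_iff)
qed

lemma submodule_adjoin:
  assumes T: "submodule T R M" and s: "s \<in> carrier M"
  shows "submodule (adjoin R M T s) R M"
proof (rule submoduleI')
  have TM: "T \<subseteq> carrier M" by (rule submoduleE(1)[OF T])
  show "adjoin R M T s \<subseteq> carrier M" using TM s by (auto simp: adjoin_def)
  have "\<zero>\<^bsub>M\<^esub> = \<zero> \<odot>\<^bsub>M\<^esub> s \<oplus>\<^bsub>M\<^esub> \<zero>\<^bsub>M\<^esub>" using s by simp
  then show "\<zero>\<^bsub>M\<^esub> \<in> adjoin R M T s"
    unfolding adjoin_def using submodule_zero[OF T] by blast
  fix x y assume "x \<in> adjoin R M T s" "y \<in> adjoin R M T s"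
  then obtain r t r' t' where *: "x = r \<odot>\<^bsub>M\<^esub> s \<oplus>\<^bsub>M\<^esub> t" "y = r' \<odot>\<^bsub>M\<^esub> s \<oplus>\<^bsub>M\<^esub> t'"
    "r \<in> carrier R" "r' \<in> carrier R" "t \<in> T" "t' \<in> T" unfolding adjoin_def by blast
  then have "x \<oplus>\<^bsub>M\<^esub> y = (r \<oplus> r') \<odot>\<^bsub>M\<^esub> s \<oplus>\<^bsub>M\<^esub> (t \<oplus>\<^bsub>M\<^esub> t')"
    using s TM by (simp add: smult_l_distr M.a_ac subset_iff)
  then show "x \<oplus>\<^bsub>M\<^esub> y \<in> adjoin R M T s"
    unfolding adjoin_def using * submoduleE(5)[OF T] by blast
next
  have TM: "T \<subseteq> carrier M" by (rule submoduleE(1)[OF T])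
  fix c x assume c: "c \<in> carrier R" and "x \<in> adjoin R M T s"
  then obtain r t where *: "x = r \<odot>\<^bsub>M\<^esub> s \<oplus>\<^bsub>M\<^esub> t" "r \<in> carrier R" "t \<in> T"
    unfolding adjoin_def by blast
  then have "c \<odot>\<^bsub>M\<^esub> x = (c \<otimes> r) \<odot>\<^bsub>M\<^esub> s \<oplus>\<^bsub>M\<^esub> c \<odot>\<^bsub>M\<^esub> t"
    using c s TM by (simp add: smult_r_distr smult_assoc1 subset_iff)
  then show "c \<odot>\<^bsub>M\<^esub> x \<in> adjoin R M T s"
    unfolding adjoin_def using * c submoduleE(4)[OF T] by blast
qed

lemma subset_adjoin:
  assumes T: "submodule T R M" and s: "s \<in> carrier M"
  shows "T \<subseteq> adjoin R M T s"
proof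
  fix t assume t: "t \<in> T"
  then have "t = \<zero> \<odot>\<^bsub>M\<^esub> s \<oplus>\<^bsub>M\<^esub> t" using s submodule_mem[OF T] by simp
  then show "t \<in> adjoin R M T s" unfolding adjoin_def using t by blast
qed

lemma mem_adjoin:
  assumes T: "submodule T R M" and s: "s \<in> carrier M"
  shows "s \<in> adjoin R M T s"
proof -
  have "s = \<one> \<odot>\<^bsub>M\<^esub> s \<oplus>\<^bsub>M\<^esub> \<zero>\<^bsub>M\<^esub>" using s by simp
  then show ?thesis unfolding adjoin_def using submodule_zero[OF T] by blast
qed

lemma adjoin_least: "submodule U R M \<Longrightarrow> T \<subseteq> U \<Longrightarrow> s \<in> U \<Longrightarrow> adjoin R M T s \<subseteq> U"
  by (auto simp: adjoin_def submodule_closed subset_iff)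

lemma fg_over_induct:
  assumes fg: "fg_over R M H Z" and H: "submodule H R M" and ZM: "Z \<subseteq> carrier M"
    and Q0: "Q H"
    and QS: "\<And>T s. \<lbrakk>submodule T R M; H \<subseteq> T; s \<in> Z; Q T\<rbrakk> \<Longrightarrow> Q (adjoin R M T s)"
  shows "\<exists>T. submodule T R M \<and> Z \<subseteq> T \<and> Q T"
proof -
  obtain S where S: "finite S" "S \<subseteq> Z" "\<And>T. \<lbrakk>submodule T R M; H \<subseteq> T; S \<subseteq> T\<rbrakk> \<Longrightarrow> Z \<subseteq> T"
    using fg unfolding fg_over_def by metis
  have "\<exists>T. submodule T R M \<and> H \<subseteq> T \<and> S \<subseteq> T \<and> Q T" using S(1,2)
  proof induction
    case empty
    then show ?case using H Q0 by blast
  next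
    case (insert s S)
    then obtain T where T: "submodule T R M" "H \<subseteq> T" "S \<subseteq> T" "Q T" by auto
    moreover have "s \<in> carrier M" "s \<in> Z" using insert.prems ZM by auto
    ultimately show ?case
      using QS[of T s] submodule_adjoin[of T s] subset_adjoin[of T s] mem_adjoin[of T s]
      by (intro exI[of _ "adjoin R M T s"]) auto
  qed
  then show ?thesis using S(3) by blast
qed

lemma fg_over_mono_base: "fg_over R M H Z \<Longrightarrow> H \<subseteq> H' \<Longrightarrow> fg_over R M H' Z"
  unfolding fg_over_def by (meson order_trans)

lemma fg_over_subset_base: "Z \<subseteq> H \<Longrightarrow> fg_over R M H Z"
  unfolding fg_over_def by (intro exI[of _ "{}"]) auto

text \<open>The analogue of the leading coefficients in Hilbert's basis theorem: for D inside Rs +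
  T, finitely many generators of this ideal control D up to \<open>D \<inter> T\<close>.\<close>

lemma coefficient_ideal:
  assumes T: "submodule T R M" and D: "submodule D R M" and s: "s \<in> carrier M"
  shows "ideal {r \<in> carrier R. \<exists>t\<in>T. r \<odot>\<^bsub>M\<^esub> s \<oplus>\<^bsub>M\<^esub> t \<in> D} R" (is "ideal ?I R")
proof (rule idealI)
  note TM = submodule_mem[OF T]
  show "ring R" by (rule R.ring_axioms)
  show "subgroup ?I (add_monoid R)"
  proof (rule R.add.subgroupI)
    have "\<zero> \<odot>\<^bsub>M\<^esub> s \<oplus>\<^bsub>M\<^esub> \<zero>\<^bsub>M\<^esub> \<in> D" using submodule_zero[OF D] s by simp
    then have "\<zero> \<in> ?I" using submodule_zero[OF T] by blast
    then show "?I \<noteq> {}" by blast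
  next
    fix r assume "r \<in> ?I"
    then obtain t where t: "r \<in> carrier R" "t \<in> T" "r \<odot>\<^bsub>M\<^esub> s \<oplus>\<^bsub>M\<^esub> t \<in> D" by auto
    have "(\<ominus> r) \<odot>\<^bsub>M\<^esub> s \<oplus>\<^bsub>M\<^esub> (\<ominus>\<^bsub>M\<^esub> t) = \<ominus>\<^bsub>M\<^esub> (r \<odot>\<^bsub>M\<^esub> s \<oplus>\<^bsub>M\<^esub> t)"
      using t s TM by (simp add: smult_l_minus M.minus_add)
    then have "(\<ominus> r) \<odot>\<^bsub>M\<^esub> s \<oplus>\<^bsub>M\<^esub> (\<ominus>\<^bsub>M\<^esub> t) \<in> D"
      using submodule_closed(1)[OF D t(3)] by simp
    then show "\<ominus> r \<in> ?I" using t submodule_closed[OF T] by auto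
  next
    fix r r' assume "r \<in> ?I" "r' \<in> ?I"
    then obtain t t' where t: "r \<in> carrier R" "t \<in> T" "r \<odot>\<^bsub>M\<^esub> s \<oplus>\<^bsub>M\<^esub> t \<in> D"
      "r' \<in> carrier R" "t' \<in> T" "r' \<odot>\<^bsub>M\<^esub> s \<oplus>\<^bsub>M\<^esub> t' \<in> D" by auto
    have "(r \<oplus> r') \<odot>\<^bsub>M\<^esub> s \<oplus>\<^bsub>M\<^esub> (t \<oplus>\<^bsub>M\<^esub> t') = (r \<odot>\<^bsub>M\<^esub> s \<oplus>\<^bsub>M\<^esub> t) \<oplus>\<^bsub>M\<^esub> (r' \<odot>\<^bsub>M\<^esub> s \<oplus>\<^bsub>M\<^esub> t')"
      using t s TM by (simp add: smult_l_distr M.a_ac)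
    then have "(r \<oplus> r') \<odot>\<^bsub>M\<^esub> s \<oplus>\<^bsub>M\<^esub> (t \<oplus>\<^bsub>M\<^esub> t') \<in> D"
      using submodule_closed(3)[OF D t(3,6)] by simp
    then show "r \<oplus> r' \<in> ?I" using t submodule_closed(3)[OF T] by auto
  qed auto
  fix r c assume "r \<in> ?I" and c: "c \<in> carrier R"
  then obtain t where t: "r \<in> carrier R" "t \<in> T" "r \<odot>\<^bsub>M\<^esub> s \<oplus>\<^bsub>M\<^esub> t \<in> D" by auto
  have "(c \<otimes> r) \<odot>\<^bsub>M\<^esub> s \<oplus>\<^bsub>M\<^esub> (c \<odot>\<^bsub>M\<^esub> t) = c \<odot>\<^bsub>M\<^esub> (r \<odot>\<^bsub>M\<^esub> s \<oplus>\<^bsub>M\<^esub> t)"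
    using t c s TM by (simp add: smult_r_distr smult_assoc1)
  then have "(c \<otimes> r) \<odot>\<^bsub>M\<^esub> s \<oplus>\<^bsub>M\<^esub> (c \<odot>\<^bsub>M\<^esub> t) \<in> D"
    using submodule_closed(2)[OF D c t(3)] by simp
  then show "c \<otimes> r \<in> ?I" using t c submodule_closed(2)[OF T c] by auto
  then show "r \<otimes> c \<in> ?I" using t c by (simp add: R.m_comm)
qed

end

lemma noetherian_ideal_fg:
  assumes "cring R" "noetherian_ring R" "ideal I R"
  obtains S where "finite S" "S \<subseteq> I" "\<And>J. ideal J R \<Longrightarrow> S \<subseteq> J \<Longrightarrow> I \<subseteq> J"
proof -
  interpret noetherian_ring R by fact
  obtain S where "S \<subseteq> carrier R" "finite S" "I = Idl\<^bsub>R\<^esub> S" using finetely_gen[OF assms(3)] by blast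
  then show thesis
    using genideal_self genideal_minimal by (intro that[of S]) auto
qed

locale noetherian_module = module R M for R (structure) and M (structure) +
  assumes noetherian: "noetherian_ring R"
begin

text \<open>If D lies in Rs + T, finitely many elements of D realise generators of its ideal of
  coefficients at s. What remains after subtracting them lies in \<open>D \<inter> T\<close>, which
  the induction over generators covers.\<close>

theorem fg_over_submodule:
  assumes H: "submodule H R M" and ZM: "Z \<subseteq> carrier M" and fg: "fg_over R M H Z"
    and D: "submodule D R M" "D \<subseteq> Z"
  shows "fg_over R M H D"
proof -
  let ?Q = "\<lambda>T. \<forall>D. submodule D R M \<and> D \<subseteq> T \<longrightarrow> fg_over R M H D"
  have "\<exists>T. submodule T R M \<and> Z \<subseteq> T \<and> ?Q T"
  proof (rule fg_over_induct[OF fg H ZM])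
    show "?Q H" using fg_over_subset_base by blast
    fix T s assume T: "submodule T R M" "H \<subseteq> T" and "s \<in> Z" and Q: "?Q T"
    then have s: "s \<in> carrier M" using ZM by auto
    have TM: "t \<in> T \<Longrightarrow> t \<in> carrier M" for t using submodule_mem[OF T(1)] .
    show "?Q (adjoin R M T s)"
    proof (intro allI impI, elim conjE)
      fix D assume D: "submodule D R M" "D \<subseteq> adjoin R M T s"
      let ?I = "{r \<in> carrier R. \<exists>t\<in>T. r \<odot>\<^bsub>M\<^esub> s \<oplus>\<^bsub>M\<^esub> t \<in> D}"
      have I_ideal: "ideal ?I R" by (rule coefficient_ideal[OF T(1) D(1) s])
      obtain S where S: "finite S" "S \<subseteq> ?I" "\<And>J. \<lbrakk>ideal J R; S \<subseteq> J\<rbrakk> \<Longrightarrow> ?I \<subseteq> J"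
        by (rule noetherian_ideal_fg[OF R.is_cring noetherian I_ideal]) (rule that, assumption+)
      have "\<forall>r\<in>S. \<exists>t\<in>T. r \<odot>\<^bsub>M\<^esub> s \<oplus>\<^bsub>M\<^esub> t \<in> D" using S(2) by auto
      then obtain t where t: "\<And>r. r \<in> S \<Longrightarrow> t r \<in> T \<and> r \<odot>\<^bsub>M\<^esub> s \<oplus>\<^bsub>M\<^esub> t r \<in> D" by metis
      let ?G = "(\<lambda>r. r \<odot>\<^bsub>M\<^esub> s \<oplus>\<^bsub>M\<^esub> t r) ` S"
      have "submodule (D \<inter> T) R M" by (rule submodule_inter[OF D(1) T(1)])
      then have "fg_over R M H (D \<inter> T)" using Q by auto
      then obtain S' where S': "finite S'" "S' \<subseteq> D \<inter> T"
        "\<And>U. \<lbrakk>submodule U R M; H \<subseteq> U; S' \<subseteq> U\<rbrakk> \<Longrightarrow> D \<inter> T \<subseteq> U"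
        unfolding fg_over_def by metis
      show "fg_over R M H D"
        unfolding fg_over_def
      proof (intro exI[of _ "?G \<union> S'"] conjI allI impI; (elim conjE)?)
        show "finite (?G \<union> S')" using S S' by auto
        show "?G \<union> S' \<subseteq> D" using S' t by auto
        fix U assume U: "submodule U R M" "H \<subseteq> U" "?G \<union> S' \<subseteq> U"
        have DT: "D \<inter> T \<subseteq> U" using S'(3)[OF U(1,2)] U(3) by auto
        \<comment> \<open>Coefficients are taken in \<open>U \<inter> D\<close> and not in U: the
          element found for a coefficient must lie in D as well, so that its difference from x falls
          into \<open>D \<inter> T\<close>.\<close>
        have UD: "submodule (U \<inter> D) R M" by (rule submodule_inter[OF U(1) D(1)])
        let ?J = "{r \<in> carrier R. \<exists>t\<in>T. r \<odot>\<^bsub>M\<^esub> s \<oplus>\<^bsub>M\<^esub> t \<in> U \<inter> D}"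
        have "ideal ?J R" by (rule coefficient_ideal[OF T(1) UD s])
        moreover have "S \<subseteq> ?J"
        proof
          fix r assume "r \<in> S"
          then show "r \<in> ?J" using t[of r] U(3) S(2) by auto
        qed
        ultimately have IJ: "?I \<subseteq> ?J" using S(3) by blast
        show "D \<subseteq> U"
        proof
          fix x assume x: "x \<in> D"
          then obtain r t where rt: "x = r \<odot>\<^bsub>M\<^esub> s \<oplus>\<^bsub>M\<^esub> t" "r \<in> carrier R" "t \<in> T"
            using D(2) unfolding adjoin_def by blast
          then have "r \<in> ?J" using IJ x by blast
          then obtain t' where t': "t' \<in> T" "r \<odot>\<^bsub>M\<^esub> s \<oplus>\<^bsub>M\<^esub> t' \<in> U" "r \<odot>\<^bsub>M\<^esub> s \<oplus>\<^bsub>M\<^esub> t' \<in> D" by auto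
          have "x \<ominus>\<^bsub>M\<^esub> (r \<odot>\<^bsub>M\<^esub> s \<oplus>\<^bsub>M\<^esub> t') = t \<ominus>\<^bsub>M\<^esub> t'"
            using rt s t' TM by (simp add: minus_add_distrib4 minus_self)
          then have "x \<ominus>\<^bsub>M\<^esub> (r \<odot>\<^bsub>M\<^esub> s \<oplus>\<^bsub>M\<^esub> t') \<in> D \<inter> T"
            using submodule_minus[OF D(1) x t'(3)] submodule_minus[OF T(1) rt(3) t'(1)] by simp
          then show "x \<in> U"
            using submodule_minus_cancel[OF U(1) submodule_mem[OF D(1) x] t'(2)] DT by blast
        qed
      qed
    qed
  qed
  then show ?thesis using D by blast
qed

end

section \<open>Homomorphisms and subquotients\<close>

lemma fg_overE:
  assumes "fg_over R X H Z"
  obtains S where "finite S" "S \<subseteq> Z"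
    "\<And>T. submodule T R X \<Longrightarrow> H \<subseteq> T \<Longrightarrow> S \<subseteq> T \<Longrightarrow> Z \<subseteq> T"
  using assms unfolding fg_over_def by auto

lemma mod_homD:
  assumes "g \<in> mod_hom R X Y"
  shows "x \<in> carrier X \<Longrightarrow> g x \<in> carrier Y"
    and "x \<in> carrier X \<Longrightarrow> y \<in> carrier X \<Longrightarrow> g (x \<oplus>\<^bsub>X\<^esub> y) = g x \<oplus>\<^bsub>Y\<^esub> g y"
    and "r \<in> carrier R \<Longrightarrow> x \<in> carrier X \<Longrightarrow> g (r \<odot>\<^bsub>X\<^esub> x) = r \<odot>\<^bsub>Y\<^esub> g x"
  using assms by (auto simp: mod_hom_def)

lemma mod_hom_zero:
  assumes "module R X" "module R Y" "g \<in> mod_hom R X Y"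
  shows "g \<zero>\<^bsub>X\<^esub> = \<zero>\<^bsub>Y\<^esub>"
proof -
  interpret X: module R X by fact
  interpret Y: module R Y by fact
  have "g (\<zero>\<^bsub>R\<^esub> \<odot>\<^bsub>X\<^esub> \<zero>\<^bsub>X\<^esub>) = \<zero>\<^bsub>R\<^esub> \<odot>\<^bsub>Y\<^esub> g \<zero>\<^bsub>X\<^esub>" using assms(3) by (rule mod_homD) auto
  then show ?thesis using mod_homD(1)[OF assms(3)] by simp
qed

lemma mod_hom_minus:
  assumes "module R X" "module R Y" "g \<in> mod_hom R X Y" "x \<in> carrier X" "y \<in> carrier X"
  shows "g (x \<ominus>\<^bsub>X\<^esub> y) = g x \<ominus>\<^bsub>Y\<^esub> g y"
proof -
  interpret X: module R X by fact
  interpret Y: module R Y by fact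
  have "x \<ominus>\<^bsub>X\<^esub> y = x \<oplus>\<^bsub>X\<^esub> (\<ominus>\<^bsub>R\<^esub> \<one>\<^bsub>R\<^esub>) \<odot>\<^bsub>X\<^esub> y"
    using assms by (simp add: X.smult_l_minus a_minus_def)
  also have "g \<dots> = g x \<oplus>\<^bsub>Y\<^esub> (\<ominus>\<^bsub>R\<^esub> \<one>\<^bsub>R\<^esub>) \<odot>\<^bsub>Y\<^esub> g y"
    using assms by (simp add: mod_homD[OF assms(3)])
  also have "\<dots> = g x \<ominus>\<^bsub>Y\<^esub> g y"
    using assms mod_homD(1)[OF assms(3)] by (simp add: Y.smult_l_minus a_minus_def)
  finally show ?thesis .
qed

lemma mod_hom_compose:
  "g \<in> mod_hom R X Y \<Longrightarrow> h \<in> mod_hom R Y W \<Longrightarrow> (\<lambda>x. h (g x)) \<in> mod_hom R X W"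
  by (auto simp: mod_hom_def Pi_iff)

lemma submodule_vimage:
  assumes X: "module R X" and Y: "module R Y" and g: "g \<in> mod_hom R X Y"
    and Z: "submodule Z R X" and K: "submodule K R Y"
  shows "submodule {z \<in> Z. g z \<in> K} R X"
proof -
  interpret X: module R X by fact
  interpret Y: module R Y by fact
  have ZX: "z \<in> Z \<Longrightarrow> z \<in> carrier X" for z using X.submodule_mem[OF Z] .
  show ?thesis
    by (rule X.submoduleI')
      (use ZX in \<open>auto simp: mod_homD[OF g] mod_hom_zero[OF X Y g]
        X.submodule_closed[OF Z] Y.submodule_closed[OF K]\<close>)
qed

text \<open>This is g(Z) + K, written so that the only witness is an element of Z. With K = 0 it
  describes an image, which is how boundaries and coboundaries become submodules.\<close>

lemma submodule_image_plus:
  assumes X: "module R X" and Y: "module R Y" and g: "g \<in> mod_hom R X Y"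
    and Z: "submodule Z R X" and K: "submodule K R Y"
  shows "submodule {y \<in> carrier Y. \<exists>z\<in>Z. y \<ominus>\<^bsub>Y\<^esub> g z \<in> K} R Y"
proof -
  interpret X: module R X by fact
  interpret Y: module R Y by fact
  have ZX: "z \<in> Z \<Longrightarrow> z \<in> carrier X" for z using X.submodule_mem[OF Z] .
  note gc = mod_homD(1)[OF g]
  show ?thesis
  proof (rule Y.submoduleI'; clarsimp)
    show "\<exists>z\<in>Z. \<zero>\<^bsub>Y\<^esub> \<ominus>\<^bsub>Y\<^esub> g z \<in> K"
      using X.submodule_zero[OF Z] Y.submodule_zero[OF K]
      by (intro bexI[of _ "\<zero>\<^bsub>X\<^esub>"]) (auto simp: mod_hom_zero[OF X Y g] Y.minus_self)
  next
    fix a b z z' assume *: "a \<in> carrier Y" "b \<in> carrier Y" "z \<in> Z" "z' \<in> Z"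
      "a \<ominus>\<^bsub>Y\<^esub> g z \<in> K" "b \<ominus>\<^bsub>Y\<^esub> g z' \<in> K"
    have "(a \<oplus>\<^bsub>Y\<^esub> b) \<ominus>\<^bsub>Y\<^esub> g (z \<oplus>\<^bsub>X\<^esub> z') = (a \<ominus>\<^bsub>Y\<^esub> g z) \<oplus>\<^bsub>Y\<^esub> (b \<ominus>\<^bsub>Y\<^esub> g z')"
      using * ZX gc by (simp add: mod_homD(2)[OF g] Y.minus_add_distrib4)
    then show "\<exists>z\<in>Z. (a \<oplus>\<^bsub>Y\<^esub> b) \<ominus>\<^bsub>Y\<^esub> g z \<in> K"
      using * X.submodule_closed(3)[OF Z] Y.submodule_closed(3)[OF K]
      by (intro bexI[of _ "z \<oplus>\<^bsub>X\<^esub> z'"]) auto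
  next
    fix r a z assume *: "r \<in> carrier R" "a \<in> carrier Y" "z \<in> Z" "a \<ominus>\<^bsub>Y\<^esub> g z \<in> K"
    have "(r \<odot>\<^bsub>Y\<^esub> a) \<ominus>\<^bsub>Y\<^esub> g (r \<odot>\<^bsub>X\<^esub> z) = r \<odot>\<^bsub>Y\<^esub> (a \<ominus>\<^bsub>Y\<^esub> g z)"
      using * ZX gc by (simp add: mod_homD(3)[OF g] Y.smult_minus_distr)
    then show "\<exists>z\<in>Z. (r \<odot>\<^bsub>Y\<^esub> a) \<ominus>\<^bsub>Y\<^esub> g z \<in> K"
      using * X.submodule_closed(2)[OF Z] Y.submodule_closed(2)[OF K]
      by (intro bexI[of _ "r \<odot>\<^bsub>X\<^esub> z"]) auto
  qed
qed

text \<open>A surjection Z/H \<rightarrow> Z'/H' carries generators over: a test submodule of Y is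
  pulled back along g and tested there. Surjectivity is asked modulo H' only.\<close>

lemma fg_over_image:
  assumes X: "module R X" and Y: "module R Y" and g: "g \<in> mod_hom R X Y"
    and Z: "submodule Z R X" and H': "submodule H' R Y" and ZY: "Z' \<subseteq> carrier Y"
    and gZ: "g ` Z \<subseteq> Z'" and gH: "g ` (H \<inter> Z) \<subseteq> H'"
    and onto: "\<And>z'. z' \<in> Z' \<Longrightarrow> \<exists>z\<in>Z. z' \<ominus>\<^bsub>Y\<^esub> g z \<in> H'"
    and fg: "fg_over R X H Z" and HZ: "H \<subseteq> Z"
  shows "fg_over R Y H' Z'"
proof -
  interpret X: module R X by fact
  interpret Y: module R Y by fact
  obtain S where S: "finite S" "S \<subseteq> Z" "\<And>T. submodule T R X \<Longrightarrow> H \<subseteq> T \<Longrightarrow> S \<subseteq> T \<Longrightarrow> Z \<subseteq> T"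
    by (rule fg_overE[OF fg]) (rule that, assumption+)
  show ?thesis
    unfolding fg_over_def
  proof (intro exI[of _ "g ` S"] conjI allI impI; (elim conjE)?)
    show "finite (g ` S)" "g ` S \<subseteq> Z'" using S gZ by auto
    fix T assume T: "submodule T R Y" "H' \<subseteq> T" "g ` S \<subseteq> T"
    have "Z \<subseteq> {z \<in> Z. g z \<in> T}"
      using T S(2) gH HZ by (intro S(3) submodule_vimage[OF X Y g Z T(1)]) blast+
    then show "Z' \<subseteq> T"
      using onto T(2) ZY Y.submodule_minus_cancel[OF T(1)] by blast
  qed
qed

text \<open>The image of Z in Z'/H' is a submodule of a finitely generated module, and this is where
  the noetherian ring enters. Lifts of its generators are joined to generators of the
  kernel.\<close>

lemma fg_over_exact:
  assumes Y: "module R Y" and W: "noetherian_module R W" and f: "f \<in> mod_hom R Y W"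
    and Z: "submodule Z R Y" and H: "submodule H R Y"
    and Z': "submodule Z' R W" and H': "submodule H' R W"
    and fZ: "f ` Z \<subseteq> Z'" and fg': "fg_over R W H' Z'" and HZ': "H' \<subseteq> Z'"
    and fg: "fg_over R Y H {z \<in> Z. f z \<in> H'}"
  shows "fg_over R Y H Z"
proof -
  interpret Y: module R Y by fact
  interpret W: noetherian_module R W by fact
  have ZY: "z \<in> Z \<Longrightarrow> z \<in> carrier Y" for z using Y.submodule_mem[OF Z] .
  note fc = mod_homD(1)[OF f]
  have Wm: "module R W" ..
  \<comment> \<open>\<open>?U T\<close> is f(T) + H'. Once \<open>?U Z\<close> is inside
    \<open>?U (T \<inter> Z)\<close>, every z in Z can be corrected by an element of T into the
    kernel.\<close>
  let ?U = "\<lambda>T. {w \<in> carrier W. \<exists>t\<in>T. w \<ominus>\<^bsub>W\<^esub> f t \<in> H'}"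
  note U = submodule_image_plus[OF Y Wm f _ H']
  have U_mem: "f t \<in> ?U T" if "t \<in> T" "T \<subseteq> Z" for t T
    using that ZY fc W.submodule_zero[OF H'] by (auto simp: W.minus_self subset_iff intro!: bexI[of _ t])
  have "?U Z \<subseteq> Z'"
    using fZ HZ' W.submodule_minus_cancel[OF Z'] by blast
  then have "fg_over R W H' (?U Z)"
    using W.fg_over_submodule[OF H' _ fg' U[OF Z]] W.submoduleE(1)[OF Z'] by blast
  then obtain S where S: "finite S" "S \<subseteq> ?U Z"
    "\<And>T. submodule T R W \<Longrightarrow> H' \<subseteq> T \<Longrightarrow> S \<subseteq> T \<Longrightarrow> ?U Z \<subseteq> T"
    by (rule fg_overE) (rule that, assumption+)
  have "\<forall>w\<in>S. \<exists>t\<in>Z. w \<ominus>\<^bsub>W\<^esub> f t \<in> H'" using S(2) by auto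
  then obtain p where p: "\<And>w. w \<in> S \<Longrightarrow> p w \<in> Z \<and> w \<ominus>\<^bsub>W\<^esub> f (p w) \<in> H'" by metis
  obtain S1 where S1: "finite S1" "S1 \<subseteq> {z \<in> Z. f z \<in> H'}"
    "\<And>T. submodule T R Y \<Longrightarrow> H \<subseteq> T \<Longrightarrow> S1 \<subseteq> T \<Longrightarrow> {z \<in> Z. f z \<in> H'} \<subseteq> T"
    by (rule fg_overE[OF fg]) (rule that, assumption+)
  show ?thesis
    unfolding fg_over_def
  proof (intro exI[of _ "p ` S \<union> S1"] conjI allI impI; (elim conjE)?)
    show "finite (p ` S \<union> S1)" "p ` S \<union> S1 \<subseteq> Z" using S S1 p by auto
    fix T assume T: "submodule T R Y" "H \<subseteq> T" "p ` S \<union> S1 \<subseteq> T"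
    have TZ: "submodule (T \<inter> Z) R Y" by (rule Y.submodule_inter[OF T(1) Z])
    have D: "{z \<in> Z. f z \<in> H'} \<subseteq> T" using S1(3)[OF T(1,2)] T(3) by auto
    have "S \<subseteq> ?U (T \<inter> Z)" using p T(3) S(2) by blast
    moreover have "H' \<subseteq> ?U (T \<inter> Z)"
    proof
      fix h assume h: "h \<in> H'"
      then have "h \<in> carrier W" using W.submodule_mem[OF H'] by auto
      then show "h \<in> ?U (T \<inter> Z)"
        using h Y.submodule_zero[OF TZ] W.submodule_minus[OF H' h W.submodule_zero[OF H']]
        by (auto intro!: bexI[of _ "\<zero>\<^bsub>Y\<^esub>"] simp: mod_hom_zero[OF Y Wm f])
    qed
    ultimately have sub: "?U Z \<subseteq> ?U (T \<inter> Z)" using S(3) U[OF TZ] by blast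
    show "Z \<subseteq> T"
    proof
      fix z assume z: "z \<in> Z"
      then have "f z \<in> ?U (T \<inter> Z)" using U_mem[of z Z] sub by blast
      then obtain t where t: "t \<in> T" "t \<in> Z" "f z \<ominus>\<^bsub>W\<^esub> f t \<in> H'" by auto
      then have "z \<ominus>\<^bsub>Y\<^esub> t \<in> {z \<in> Z. f z \<in> H'}"
        using z ZY Y.submodule_minus[OF Z z] by (simp add: mod_hom_minus[OF Y Wm f])
      then show "z \<in> T" using D t ZY[OF z] Y.submodule_minus_cancel[OF T(1)] by blast
    qed
  qed
qed

text \<open>A finite family of maps into Z'/H' acts as one map into a finite power of it. The kernel
  is cut down one map at a time, which avoids forming the power.\<close>

lemma fg_over_family:
  assumes Y: "module R Y" and W: "noetherian_module R W"
    and Z: "submodule Z R Y" and H: "submodule H R Y"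
    and Z': "submodule Z' R W" and H': "submodule H' R W" and HZ': "H' \<subseteq> Z'"
    and fg': "fg_over R W H' Z'" and "finite I"
    and f: "\<And>i. i \<in> I \<Longrightarrow> f i \<in> mod_hom R Y W" and fZ: "\<And>i z. i \<in> I \<Longrightarrow> z \<in> Z \<Longrightarrow> f i z \<in> Z'"
    and fg: "fg_over R Y H {z \<in> Z. \<forall>i\<in>I. f i z \<in> H'}"
  shows "fg_over R Y H Z"
  using \<open>finite I\<close> Z f fZ fg
proof (induction arbitrary: Z)
  case empty
  then show ?case by simp
next
  case (insert i I)
  have Wm: "module R W" using W by (simp add: noetherian_module_def)
  have *: "{z \<in> {z \<in> Z. f i z \<in> H'}. \<forall>j\<in>I. f j z \<in> H'} = {z \<in> Z. \<forall>j\<in>insert i I. f j z \<in> H'}"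
    by auto
  have "fg_over R Y H {z \<in> Z. f i z \<in> H'}"
  proof (rule insert.IH)
    show "submodule {z \<in> Z. f i z \<in> H'} R Y"
      using insert.prems by (intro submodule_vimage[OF Y Wm _ _ H']) auto
  qed (use insert.prems * in auto)
  moreover have "f i ` Z \<subseteq> Z'" "f i \<in> mod_hom R Y W" using insert.prems(2,3) by auto
  ultimately show ?case
    using fg_over_exact[OF Y W _ insert.prems(1) H Z' H' _ fg' HZ'] by simp
qed

context module begin

lemma fg_over_trans:
  assumes fg: "fg_over R M K Z" "fg_over R M H K" and "K \<subseteq> Z"
  shows "fg_over R M H Z"
proof -
  obtain S where S: "finite S" "S \<subseteq> Z" "\<And>T. submodule T R M \<Longrightarrow> K \<subseteq> T \<Longrightarrow> S \<subseteq> T \<Longrightarrow> Z \<subseteq> T"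
    by (rule fg_overE[OF fg(1)]) (rule that, assumption+)
  obtain S' where S': "finite S'" "S' \<subseteq> K" "\<And>T. submodule T R M \<Longrightarrow> H \<subseteq> T \<Longrightarrow> S' \<subseteq> T \<Longrightarrow> K \<subseteq> T"
    by (rule fg_overE[OF fg(2)]) (rule that, assumption+)
  show ?thesis unfolding fg_over_def
  proof (intro exI[of _ "S \<union> S'"] conjI allI impI; (elim conjE)?)
    show "finite (S \<union> S')" "S \<union> S' \<subseteq> Z" using S S' assms(3) by auto
    fix T assume T: "submodule T R M" "H \<subseteq> T" "S \<union> S' \<subseteq> T"
    then have "K \<subseteq> T" by (intro S'(3)) simp_all
    then show "Z \<subseteq> T" using T by (intro S(3)) simp_all
  qed
qed

lemma smult_smult_commute:
  assumes "x \<in> carrier R" "r \<in> carrier R" "m \<in> carrier M"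
  shows "x \<odot>\<^bsub>M\<^esub> (r \<odot>\<^bsub>M\<^esub> m) = r \<odot>\<^bsub>M\<^esub> (x \<odot>\<^bsub>M\<^esub> m)"
  using assms smult_assoc1[of x r m] smult_assoc1[of r x m] R.m_comm[of x r] by simp

lemma smult_hom: "x \<in> carrier R \<Longrightarrow> (\<lambda>m. x \<odot>\<^bsub>M\<^esub> m) \<in> mod_hom R M M"
  by (simp add: mod_hom_def smult_r_distr smult_smult_commute)

lemma id_hom: "(\<lambda>m. m) \<in> mod_hom R M M"
  by (auto simp: mod_hom_def)

end

section \<open>Homomorphism modules and free modules\<close>

lemma Hom_carrierD:
  assumes "\<phi> \<in> carrier (Hom_module R P M)"
  shows "\<phi> \<in> mod_hom R P M" "\<phi> \<in> extensional (carrier P)"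
  using assms by (auto simp: Hom_module_def)

lemma Hom_carrierI:
  assumes "module R P" "g \<in> mod_hom R P M"
  shows "restrict g (carrier P) \<in> carrier (Hom_module R P M)"
proof -
  interpret P: module R P by fact
  show ?thesis using assms(2) by (auto simp: Hom_module_def mod_hom_def)
qed

lemma Hom_eqI:
  assumes "\<phi> \<in> carrier (Hom_module R P M)" "\<psi> \<in> carrier (Hom_module R P M)"
    and "\<And>x. x \<in> carrier P \<Longrightarrow> \<phi> x = \<psi> x"
  shows "\<phi> = \<psi>"
  using assms by (auto simp: Hom_module_def intro: extensionalityI)

lemma module_Hom:
  assumes P: "module R P" and M: "module R M"
  shows "module R (Hom_module R P M)"
proof -
  interpret P: module R P by fact
  interpret M: module R M by fact
  let ?H = "Hom_module R P M"
  have memI: "restrict g (carrier P) \<in> carrier ?H"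
    if "\<And>x. x \<in> carrier P \<Longrightarrow> g x \<in> carrier M"
      "\<And>x y. x \<in> carrier P \<Longrightarrow> y \<in> carrier P \<Longrightarrow> g (x \<oplus>\<^bsub>P\<^esub> y) = g x \<oplus>\<^bsub>M\<^esub> g y"
      "\<And>r x. r \<in> carrier R \<Longrightarrow> x \<in> carrier P \<Longrightarrow> g (r \<odot>\<^bsub>P\<^esub> x) = r \<odot>\<^bsub>M\<^esub> g x" for g
    using that by (intro Hom_carrierI[OF P]) (auto simp: mod_hom_def)
  have memD: "x \<in> carrier P \<Longrightarrow> \<phi> x \<in> carrier M"
      "x \<in> carrier P \<Longrightarrow> y \<in> carrier P \<Longrightarrow> \<phi> (x \<oplus>\<^bsub>P\<^esub> y) = \<phi> x \<oplus>\<^bsub>M\<^esub> \<phi> y"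
      "r \<in> carrier R \<Longrightarrow> x \<in> carrier P \<Longrightarrow> \<phi> (r \<odot>\<^bsub>P\<^esub> x) = r \<odot>\<^bsub>M\<^esub> \<phi> x"
    if "\<phi> \<in> carrier ?H" for \<phi> x y r
    using mod_homD[OF Hom_carrierD(1)[OF that]] by blast+
  have add_eq: "\<phi> \<oplus>\<^bsub>?H\<^esub> \<psi> = (\<lambda>x\<in>carrier P. \<phi> x \<oplus>\<^bsub>M\<^esub> \<psi> x)" for \<phi> \<psi>
    by (simp add: Hom_module_def)
  have smult_eq: "r \<odot>\<^bsub>?H\<^esub> \<phi> = (\<lambda>x\<in>carrier P. r \<odot>\<^bsub>M\<^esub> \<phi> x)" for r \<phi>
    by (simp add: Hom_module_def)
  have zero_eq: "\<zero>\<^bsub>?H\<^esub> = (\<lambda>x\<in>carrier P. \<zero>\<^bsub>M\<^esub>)"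
    by (simp add: Hom_module_def)
  have add: "\<phi> \<oplus>\<^bsub>?H\<^esub> \<psi> \<in> carrier ?H" if "\<phi> \<in> carrier ?H" "\<psi> \<in> carrier ?H" for \<phi> \<psi>
    unfolding add_eq using that
    by (intro memI) (auto simp: memD M.smult_r_distr M.M.a_ac)
  have smult: "r \<odot>\<^bsub>?H\<^esub> \<phi> \<in> carrier ?H" if "r \<in> carrier R" "\<phi> \<in> carrier ?H" for r \<phi>
    unfolding smult_eq using that
    by (intro memI) (auto simp: memD M.smult_r_distr M.smult_smult_commute[of r])
  have zero: "\<zero>\<^bsub>?H\<^esub> \<in> carrier ?H"
    unfolding zero_eq by (intro memI) auto
  note ext = Hom_eqI[of _ R P M]
  show ?thesis
  proof (rule moduleI)
    show "cring R" by (rule P.R.is_cring)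
    show "abelian_group ?H"
    proof (rule abelian_groupI)
      fix \<phi> assume \<phi>: "\<phi> \<in> carrier ?H"
      have "(\<ominus>\<^bsub>R\<^esub> \<one>\<^bsub>R\<^esub>) \<odot>\<^bsub>?H\<^esub> \<phi> \<oplus>\<^bsub>?H\<^esub> \<phi> = \<zero>\<^bsub>?H\<^esub>"
      proof (rule ext)
        show "((\<ominus>\<^bsub>R\<^esub> \<one>\<^bsub>R\<^esub>) \<odot>\<^bsub>?H\<^esub> \<phi> \<oplus>\<^bsub>?H\<^esub> \<phi>) x = \<zero>\<^bsub>?H\<^esub> x" if "x \<in> carrier P" for x
          using that \<phi> by (simp add: add_eq smult_eq zero_eq memD M.smult_l_minus M.M.l_neg)
      qed (use \<phi> in \<open>auto intro!: add smult zero\<close>)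
      then show "\<exists>\<psi>\<in>carrier ?H. \<psi> \<oplus>\<^bsub>?H\<^esub> \<phi> = \<zero>\<^bsub>?H\<^esub>" using smult[OF _ \<phi>] by blast
    next
      fix \<phi> \<psi> \<chi> assume *: "\<phi> \<in> carrier ?H" "\<psi> \<in> carrier ?H" "\<chi> \<in> carrier ?H"
      show "\<phi> \<oplus>\<^bsub>?H\<^esub> \<psi> \<oplus>\<^bsub>?H\<^esub> \<chi> = \<phi> \<oplus>\<^bsub>?H\<^esub> (\<psi> \<oplus>\<^bsub>?H\<^esub> \<chi>)"
        by (rule ext) (use * in \<open>auto intro!: add\<close>, use * in \<open>simp add: add_eq memD M.M.a_assoc\<close>)
    next
      fix \<phi> \<psi> assume *: "\<phi> \<in> carrier ?H" "\<psi> \<in> carrier ?H"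
      show "\<phi> \<oplus>\<^bsub>?H\<^esub> \<psi> = \<psi> \<oplus>\<^bsub>?H\<^esub> \<phi>"
        by (rule ext) (use * in \<open>auto intro!: add\<close>, use * in \<open>simp add: add_eq memD M.M.a_comm\<close>)
      show "\<zero>\<^bsub>?H\<^esub> \<oplus>\<^bsub>?H\<^esub> \<phi> = \<phi>"
        by (rule ext) (use * in \<open>auto intro!: add zero\<close>, use * in \<open>simp add: add_eq zero_eq memD\<close>)
    qed (auto intro: add zero)
  next
    fix r s \<phi> assume *: "r \<in> carrier R" "s \<in> carrier R" "\<phi> \<in> carrier ?H"
    show "(r \<oplus>\<^bsub>R\<^esub> s) \<odot>\<^bsub>?H\<^esub> \<phi> = r \<odot>\<^bsub>?H\<^esub> \<phi> \<oplus>\<^bsub>?H\<^esub> s \<odot>\<^bsub>?H\<^esub> \<phi>"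
      by (rule ext) (use * in \<open>auto intro!: add smult\<close>,
          use * in \<open>simp add: add_eq smult_eq memD M.smult_l_distr\<close>)
    show "(r \<otimes>\<^bsub>R\<^esub> s) \<odot>\<^bsub>?H\<^esub> \<phi> = r \<odot>\<^bsub>?H\<^esub> (s \<odot>\<^bsub>?H\<^esub> \<phi>)"
      by (rule ext) (use * in \<open>auto intro!: smult\<close>,
          use * in \<open>simp add: smult_eq memD M.smult_assoc1\<close>)
  next
    fix r \<phi> \<psi> assume *: "r \<in> carrier R" "\<phi> \<in> carrier ?H" "\<psi> \<in> carrier ?H"
    show "r \<odot>\<^bsub>?H\<^esub> (\<phi> \<oplus>\<^bsub>?H\<^esub> \<psi>) = r \<odot>\<^bsub>?H\<^esub> \<phi> \<oplus>\<^bsub>?H\<^esub> r \<odot>\<^bsub>?H\<^esub> \<psi>"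
      by (rule ext) (use * in \<open>auto intro!: add smult\<close>,
          use * in \<open>simp add: add_eq smult_eq memD M.smult_r_distr\<close>)
  next
    fix \<phi> assume *: "\<phi> \<in> carrier ?H"
    show "\<one>\<^bsub>R\<^esub> \<odot>\<^bsub>?H\<^esub> \<phi> = \<phi>"
      by (rule ext) (use * in \<open>auto intro!: smult\<close>, use * in \<open>simp add: smult_eq memD\<close>)
  qed (rule smult)
qed

lemma Hom_apply:
  assumes "x \<in> carrier P"
  shows "(\<phi> \<oplus>\<^bsub>Hom_module R P M\<^esub> \<psi>) x = \<phi> x \<oplus>\<^bsub>M\<^esub> \<psi> x"
    and "(r \<odot>\<^bsub>Hom_module R P M\<^esub> \<phi>) x = r \<odot>\<^bsub>M\<^esub> \<phi> x"
    and "\<zero>\<^bsub>Hom_module R P M\<^esub> x = \<zero>\<^bsub>M\<^esub>"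
  using assms by (auto simp: Hom_module_def)

lemma Hom_eval:
  assumes "x \<in> carrier P"
  shows "(\<lambda>\<phi>. \<phi> x) \<in> mod_hom R (Hom_module R P M) M"
  using assms by (auto simp: mod_hom_def Hom_module_def)

lemma Hom_minus_apply:
  assumes "module R P" "module R M" "x \<in> carrier P"
    and "\<phi> \<in> carrier (Hom_module R P M)" "\<psi> \<in> carrier (Hom_module R P M)"
  shows "(\<phi> \<ominus>\<^bsub>Hom_module R P M\<^esub> \<psi>) x = \<phi> x \<ominus>\<^bsub>M\<^esub> \<psi> x"
  using mod_hom_minus[OF module_Hom[OF assms(1,2)] assms(2) Hom_eval[OF assms(3)] assms(4,5)] .

section \<open>Functoriality of Hom in both arguments\<close>

definition post_comp :: "('a, 'p, 'k) module_scheme \<Rightarrow> ('m \<Rightarrow> 'n) \<Rightarrow> ('p \<Rightarrow> 'm) \<Rightarrow> 'p \<Rightarrow> 'n"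
  where "post_comp P g \<phi> = (\<lambda>x\<in>carrier P. g (\<phi> x))"

definition pre_comp :: "('a, 'p, 'k) module_scheme \<Rightarrow> ('p \<Rightarrow> 'q) \<Rightarrow> ('q \<Rightarrow> 'm) \<Rightarrow> 'p \<Rightarrow> 'm"
  where "pre_comp P d \<phi> = (\<lambda>x\<in>carrier P. \<phi> (d x))"

lemma post_comp_hom:
  assumes P: "module R P" and M: "module R M" and N: "module R N" and g: "g \<in> mod_hom R M N"
  shows "post_comp P g \<in> mod_hom R (Hom_module R P M) (Hom_module R P N)"
proof -
  interpret P: module R P by fact
  interpret HM: module R "Hom_module R P M" by (rule module_Hom[OF P M])
  interpret HN: module R "Hom_module R P N" by (rule module_Hom[OF P N])
  have mem: "post_comp P g \<phi> \<in> carrier (Hom_module R P N)" if "\<phi> \<in> carrier (Hom_module R P M)" for \<phi>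
    unfolding post_comp_def
    by (rule Hom_carrierI[OF P mod_hom_compose[OF Hom_carrierD(1)[OF that] g]])
  note vals = mod_homD(1)[OF Hom_carrierD(1)]
  have "post_comp P g (\<phi> \<oplus>\<^bsub>Hom_module R P M\<^esub> \<psi>) = post_comp P g \<phi> \<oplus>\<^bsub>Hom_module R P N\<^esub> post_comp P g \<psi>"
    if "\<phi> \<in> carrier (Hom_module R P M)" "\<psi> \<in> carrier (Hom_module R P M)" for \<phi> \<psi>
    by (rule Hom_eqI[of _ R P N], use that mem in simp, use that mem in simp)
      (use that vals[OF that(1)] vals[OF that(2)] in \<open>simp add: post_comp_def Hom_apply mod_homD(2)[OF g]\<close>)
  moreover have "post_comp P g (r \<odot>\<^bsub>Hom_module R P M\<^esub> \<phi>) = r \<odot>\<^bsub>Hom_module R P N\<^esub> post_comp P g \<phi>"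
    if "r \<in> carrier R" "\<phi> \<in> carrier (Hom_module R P M)" for \<phi> r
    by (rule Hom_eqI[of _ R P N], use that mem in simp, use that mem in simp)
      (use that vals[OF that(2)] in \<open>simp add: post_comp_def Hom_apply mod_homD(3)[OF g]\<close>)
  ultimately show ?thesis using mem by (auto simp: mod_hom_def)
qed

lemma pre_comp_hom:
  assumes P: "module R P" and Q: "module R Q" and M: "module R M" and d: "d \<in> mod_hom R P Q"
  shows "pre_comp P d \<in> mod_hom R (Hom_module R Q M) (Hom_module R P M)"
proof -
  interpret P: module R P by fact
  interpret HQ: module R "Hom_module R Q M" by (rule module_Hom[OF Q M])
  interpret HP: module R "Hom_module R P M" by (rule module_Hom[OF P M])
  have mem: "pre_comp P d \<phi> \<in> carrier (Hom_module R P M)" if "\<phi> \<in> carrier (Hom_module R Q M)" for \<phi>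
    unfolding pre_comp_def
    by (rule Hom_carrierI[OF P mod_hom_compose[OF d Hom_carrierD(1)[OF that]]])
  have "pre_comp P d (\<phi> \<oplus>\<^bsub>Hom_module R Q M\<^esub> \<psi>) = pre_comp P d \<phi> \<oplus>\<^bsub>Hom_module R P M\<^esub> pre_comp P d \<psi>"
    if "\<phi> \<in> carrier (Hom_module R Q M)" "\<psi> \<in> carrier (Hom_module R Q M)" for \<phi> \<psi>
    by (rule Hom_eqI[of _ R P M], use that mem in simp, use that mem in simp)
      (simp add: pre_comp_def Hom_apply mod_homD(1)[OF d])
  moreover have "pre_comp P d (r \<odot>\<^bsub>Hom_module R Q M\<^esub> \<phi>) = r \<odot>\<^bsub>Hom_module R P M\<^esub> pre_comp P d \<phi>"
    if "r \<in> carrier R" "\<phi> \<in> carrier (Hom_module R Q M)" for \<phi> r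
    by (rule Hom_eqI[of _ R P M], use that mem in simp, use that mem in simp)
      (simp add: pre_comp_def Hom_apply mod_homD(1)[OF d])
  ultimately show ?thesis using mem by (auto simp: mod_hom_def)
qed

section \<open>Maps out of free modules\<close>

abbreviation basis :: "('a, 'r) ring_scheme \<Rightarrow> 'x \<Rightarrow> 'x \<Rightarrow> 'a"
  where "basis R b \<equiv> formal_sum R [(\<one>\<^bsub>R\<^esub>, b)]"

lemma (in cring) basis_closed: "b \<in> B \<Longrightarrow> basis R b \<in> carrier (free_module R B)"
  by (rule formal_sum_closed) auto

lemma (in cring) free_module_span:
  assumes T: "submodule T R (free_module R B)" and b: "\<And>b. b \<in> B \<Longrightarrow> basis R b \<in> T"
  shows "carrier (free_module R B) \<subseteq> T"
proof
  interpret F: module R "free_module R B" by (rule module_free_module)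
  have "formal_sum R l \<in> T" if "set l \<subseteq> carrier R \<times> B" for l
    using that
  proof (induction l)
    case Nil
    then show ?case using F.submodule_zero[OF T] by (simp add: free_module_def)
  next
    case (Cons p l)
    then have p: "fst p \<in> carrier R" "snd p \<in> B" "formal_sum R l \<in> T" by auto
    have c: "formal_sum R l x \<in> carrier R" for x
      using formal_sum_closed[of l B] Cons.prems by (auto simp: free_module_def)
    have "formal_sum R (p # l) = fst p \<odot>\<^bsub>free_module R B\<^esub> basis R (snd p) \<oplus>\<^bsub>free_module R B\<^esub> formal_sum R l"
      using p c by (auto simp: free_module_def fun_eq_iff)
    then show ?case
      using F.submodule_closed(3)[OF T F.submodule_closed(2)[OF T p(1) b[OF p(2)]] p(3)] by simp
  qed
  then show "f \<in> T" if "f \<in> carrier (free_module R B)" for f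
    using formal_sum_surj[OF that] by blast
qed

text \<open>Values on the basis are free, so a pointwise existence statement yields one linear map.
  Membership in Z passes from the basis to its span, while Q is asserted on the basis only.\<close>

lemma (in module) free_module_choose:
  assumes Z: "submodule Z R M" and ex: "\<And>b. b \<in> B \<Longrightarrow> \<exists>m\<in>Z. Q b m"
  shows "\<exists>g \<in> mod_hom R (free_module R B) M.
    (\<forall>x\<in>carrier (free_module R B). g x \<in> Z) \<and> (\<forall>b\<in>B. Q b (g (basis R b)))"
proof -
  obtain \<phi> where \<phi>: "\<And>b. b \<in> B \<Longrightarrow> \<phi> b \<in> Z \<and> Q b (\<phi> b)" using ex by metis
  then have \<phi>M: "\<phi> \<in> B \<rightarrow> carrier M" using submodule_mem[OF Z] by blast
  let ?g = "lin_ext R M \<phi>"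
  have F: "module R (free_module R B)" by (rule R.module_free_module)
  have M: "module R M" ..
  have g: "?g \<in> mod_hom R (free_module R B) M" by (rule lin_ext_hom[OF \<phi>M])
  have b: "?g (basis R b) = \<phi> b" if "b \<in> B" for b by (rule lin_ext_basis[OF \<phi>M that])
  have sub: "submodule {x \<in> carrier (free_module R B). ?g x \<in> Z} R (free_module R B)"
    by (rule submodule_vimage[OF F M g module.carrier_is_submodule[OF F] Z])
  have "carrier (free_module R B) \<subseteq> {x \<in> carrier (free_module R B). ?g x \<in> Z}"
  proof (rule R.free_module_span[OF sub])
    show "basis R y \<in> {x \<in> carrier (free_module R B). ?g x \<in> Z}" if "y \<in> B" for y
      using R.basis_closed[OF that] b[OF that] \<phi>[OF that] by (simp del: formal_sum.simps)
  qed
  then have "\<forall>x\<in>carrier (free_module R B). ?g x \<in> Z" by blast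
  moreover have "\<forall>b\<in>B. Q b (?g (basis R b))"
    using b \<phi> by (simp del: formal_sum.simps)
  ultimately show ?thesis using g by (intro bexI[of _ ?g] conjI)
qed

text \<open>Projectivity of free modules, relative to H': a lift modulo H' on the basis is one
  everywhere, since the elements at which it is correct form a submodule.\<close>

lemma free_module_lift:
  assumes M: "module R M" and N: "module R N" and g: "g \<in> mod_hom R M N"
    and Z: "submodule Z R M" and H': "submodule H' R N"
    and \<psi>: "\<psi> \<in> mod_hom R (free_module R B) N" "\<And>x. x \<in> carrier (free_module R B) \<Longrightarrow> \<psi> x \<in> Z'"
    and onto: "\<And>z'. z' \<in> Z' \<Longrightarrow> \<exists>z\<in>Z. z' \<ominus>\<^bsub>N\<^esub> g z \<in> H'"
  shows "\<exists>\<phi> \<in> mod_hom R (free_module R B) M. \<forall>x\<in>carrier (free_module R B).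
    \<phi> x \<in> Z \<and> \<psi> x \<ominus>\<^bsub>N\<^esub> g (\<phi> x) \<in> H'"
proof -
  interpret M: module R M by fact
  interpret N: module R N by fact
  let ?F = "free_module R B"
  interpret F: module R ?F by (rule M.R.module_free_module)
  have F: "module R ?F" ..
  have "\<exists>\<phi>\<in>mod_hom R ?F M. (\<forall>x\<in>carrier ?F. \<phi> x \<in> Z) \<and>
      (\<forall>b\<in>B. \<psi> (basis R b) \<ominus>\<^bsub>N\<^esub> g (\<phi> (basis R b)) \<in> H')"
    by (rule M.free_module_choose[OF Z]) (rule onto[OF \<psi>(2)[OF M.R.basis_closed]])
  then obtain \<phi> where \<phi>: "\<phi> \<in> mod_hom R ?F M" "\<forall>x\<in>carrier ?F. \<phi> x \<in> Z"
    "\<forall>b\<in>B. \<psi> (basis R b) \<ominus>\<^bsub>N\<^esub> g (\<phi> (basis R b)) \<in> H'"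
    by (elim bexE conjE)
  note vN = mod_homD[OF \<psi>(1)] mod_homD[OF mod_hom_compose[OF \<phi>(1) g]]
  have sub: "submodule {x \<in> carrier ?F. \<psi> x \<ominus>\<^bsub>N\<^esub> g (\<phi> x) \<in> H'} R ?F"
  proof (rule F.submoduleI'; clarsimp)
    have "\<psi> \<zero>\<^bsub>?F\<^esub> \<ominus>\<^bsub>N\<^esub> g (\<phi> \<zero>\<^bsub>?F\<^esub>) = \<zero>\<^bsub>N\<^esub>"
      by (simp add: mod_hom_zero[OF F N \<psi>(1)] mod_hom_zero[OF F M \<phi>(1)] mod_hom_zero[OF M N g] N.minus_self)
    then show "\<psi> \<zero>\<^bsub>?F\<^esub> \<ominus>\<^bsub>N\<^esub> g (\<phi> \<zero>\<^bsub>?F\<^esub>) \<in> H'" using N.submodule_zero[OF H'] by simp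
  next
    fix x y assume *: "x \<in> carrier ?F" "y \<in> carrier ?F" "\<psi> x \<ominus>\<^bsub>N\<^esub> g (\<phi> x) \<in> H'" "\<psi> y \<ominus>\<^bsub>N\<^esub> g (\<phi> y) \<in> H'"
    then show "\<psi> (x \<oplus>\<^bsub>?F\<^esub> y) \<ominus>\<^bsub>N\<^esub> g (\<phi> (x \<oplus>\<^bsub>?F\<^esub> y)) \<in> H'"
      using N.submodule_closed(3)[OF H' *(3,4)] by (simp add: vN N.minus_add_distrib4)
  next
    fix r x assume *: "r \<in> carrier R" "x \<in> carrier ?F" "\<psi> x \<ominus>\<^bsub>N\<^esub> g (\<phi> x) \<in> H'"
    then show "\<psi> (r \<odot>\<^bsub>?F\<^esub> x) \<ominus>\<^bsub>N\<^esub> g (\<phi> (r \<odot>\<^bsub>?F\<^esub> x)) \<in> H'"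
      using N.submodule_closed(2)[OF H' *(1,3)] by (simp add: vN N.smult_minus_distr)
  qed
  have "carrier ?F \<subseteq> {x \<in> carrier ?F. \<psi> x \<ominus>\<^bsub>N\<^esub> g (\<phi> x) \<in> H'}"
  proof (rule M.R.free_module_span[OF sub])
    show "basis R y \<in> {x \<in> carrier ?F. \<psi> x \<ominus>\<^bsub>N\<^esub> g (\<phi> x) \<in> H'}" if "y \<in> B" for y
      using M.R.basis_closed[OF that] \<phi>(3) that by (simp del: formal_sum.simps)
  qed
  then show ?thesis using \<phi> by blast
qed

lemma (in module) minus_minus_cancel:
  assumes "x \<in> carrier M" "y \<in> carrier M" shows "x \<ominus>\<^bsub>M\<^esub> (x \<ominus>\<^bsub>M\<^esub> y) = y"
proof -
  have "x \<ominus>\<^bsub>M\<^esub> (x \<ominus>\<^bsub>M\<^esub> y) = (x \<ominus>\<^bsub>M\<^esub> x) \<oplus>\<^bsub>M\<^esub> y"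
    using assms by (simp add: a_minus_def M.minus_add M.a_ac)
  then show ?thesis using assms by (simp add: minus_self)
qed

lemma (in module) minus_minus_mem:
  assumes "submodule H R M" "x \<in> H" "x \<ominus>\<^bsub>M\<^esub> y \<in> H" "y \<in> carrier M" shows "y \<in> H"
  using submodule_minus[OF assms(1-3)] minus_minus_cancel[of x y] assms submodule_mem[of H x] by simp

section \<open>Cohomology of subquotients\<close>

text \<open>A free resolution of R/\<aa> in which the augmentation is replaced by an element e over
  the class of 1: \<open>e_gen\<close> says that e generates \<open>P 0\<close> modulo the image of
  \<open>d 0\<close>, and \<open>e_ann\<close> that its annihilator there is \<aa>. The cokernel of
  \<open>d 0\<close> is thus R/\<aa>, without cosets.\<close>

locale free_resolution =
  fixes R :: "('a, 'r) ring_scheme" and B :: "nat \<Rightarrow> 'x set"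
    and d :: "nat \<Rightarrow> ('x \<Rightarrow> 'a) \<Rightarrow> ('x \<Rightarrow> 'a)" and e :: "'x \<Rightarrow> 'a" and \<aa> :: "'a set"
  assumes cring_R: "cring R" and noetherian_R: "noetherian_ring R" and ideal_\<aa>: "ideal \<aa> R"
    and d_hom: "d n \<in> mod_hom R (free_module R (B (Suc n))) (free_module R (B n))"
    and exact: "d (Suc n) ` carrier (free_module R (B (Suc (Suc n))))
      = {x \<in> carrier (free_module R (B (Suc n))). d n x = \<zero>\<^bsub>free_module R (B n)\<^esub>}"
    and e_closed: "e \<in> carrier (free_module R (B 0))"
    and e_gen: "p \<in> carrier (free_module R (B 0)) \<Longrightarrow>
      \<exists>r\<in>carrier R. p \<ominus>\<^bsub>free_module R (B 0)\<^esub> r \<odot>\<^bsub>free_module R (B 0)\<^esub> e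
        \<in> d 0 ` carrier (free_module R (B 1))"
    and e_ann: "r \<in> carrier R \<Longrightarrow>
      r \<odot>\<^bsub>free_module R (B 0)\<^esub> e \<in> d 0 ` carrier (free_module R (B 1)) \<longleftrightarrow> r \<in> \<aa>"
begin

abbreviation P :: "nat \<Rightarrow> ('a, 'x \<Rightarrow> 'a) module" where "P n \<equiv> free_module R (B n)"

abbreviation Hom_P :: "('a, 'm, 'k) module_scheme \<Rightarrow> nat \<Rightarrow> ('a, ('x \<Rightarrow> 'a) \<Rightarrow> 'm) module"
  where "Hom_P M n \<equiv> Hom_module R (P n) M"

definition bounds :: "nat \<Rightarrow> ('x \<Rightarrow> 'a) set" where "bounds n = d n ` carrier (P (Suc n))"

text \<open>For submodules \<open>H \<subseteq> Z \<subseteq> M\<close>, the groups \<open>Ext(R/\<aa>, Z/H)\<close> are computed inside \<open>Hom(P, M)\<close>: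
  since each \<open>P n\<close> is free, homomorphisms to \<open>Z/H\<close> are represented by homomorphisms to \<open>Z\<close>.\<close>

definition into :: "('a, 'm, 'k) module_scheme \<Rightarrow> nat \<Rightarrow> 'm set \<Rightarrow> (('x \<Rightarrow> 'a) \<Rightarrow> 'm) set"
  where "into M n Z = {\<phi> \<in> carrier (Hom_P M n). \<forall>x\<in>carrier (P n). \<phi> x \<in> Z}"

abbreviation cod :: "nat \<Rightarrow> (('x \<Rightarrow> 'a) \<Rightarrow> 'm) \<Rightarrow> ('x \<Rightarrow> 'a) \<Rightarrow> 'm"
  where "cod n \<equiv> pre_comp (P (Suc n)) (d n)"

primrec bnd :: "('a, 'm, 'k) module_scheme \<Rightarrow> nat \<Rightarrow> 'm set \<Rightarrow> (('x \<Rightarrow> 'a) \<Rightarrow> 'm) set"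
  where "bnd M 0 Z = {\<zero>\<^bsub>Hom_P M 0\<^esub>}"
  | "bnd M (Suc n) Z = cod n ` into M n Z"

text \<open>Lifts to Z of the cocycles of Hom(P, Z/H): the coboundary need not vanish, it only has
  to become zero modulo H.\<close>

definition coc :: "('a, 'm, 'k) module_scheme \<Rightarrow> nat \<Rightarrow> 'm set \<Rightarrow> 'm set \<Rightarrow> (('x \<Rightarrow> 'a) \<Rightarrow> 'm) set"
  where "coc M n H Z = {\<phi> \<in> into M n Z. cod n \<phi> \<in> into M (Suc n) H}"

text \<open>The sum of \<open>into M n H\<close> and \<open>bnd M n Z\<close>, that is, all lifts of
  coboundaries of Hom(P, Z/H). The quotient of \<open>coc\<close> by \<open>cob\<close> is then Ext
  of Z/H, whichever lifts are used.\<close>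

definition cob :: "('a, 'm, 'k) module_scheme \<Rightarrow> nat \<Rightarrow> 'm set \<Rightarrow> 'm set \<Rightarrow> (('x \<Rightarrow> 'a) \<Rightarrow> 'm) set"
  where "cob M n H Z = {\<phi> \<in> carrier (Hom_P M n). \<exists>\<beta>\<in>bnd M n Z. \<phi> \<ominus>\<^bsub>Hom_P M n\<^esub> \<beta> \<in> into M n H}"

definition fgExt :: "('a, 'm, 'k) module_scheme \<Rightarrow> nat \<Rightarrow> 'm set \<Rightarrow> 'm set \<Rightarrow> bool"
  where "fgExt M n H Z \<longleftrightarrow> fg_over R (Hom_P M n) (cob M n H Z) (coc M n H Z)"

lemma module_P: "module R (P n)"
  by (rule cring.module_free_module[OF cring_R])

lemma d_closed: "x \<in> carrier (P (Suc n)) \<Longrightarrow> d n x \<in> carrier (P n)"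
  by (rule mod_homD(1)[OF d_hom])

lemma d_d: "x \<in> carrier (P (Suc (Suc n))) \<Longrightarrow> d n (d (Suc n) x) = \<zero>\<^bsub>P n\<^esub>"
  using exact[of n] by auto

lemma bounds_closed: "x \<in> bounds n \<Longrightarrow> x \<in> carrier (P n)"
  by (auto simp: bounds_def d_closed)

lemma bounds_Suc: "bounds (Suc n) = {x \<in> carrier (P (Suc n)). d n x = \<zero>\<^bsub>P n\<^esub>}"
  by (simp add: bounds_def exact)

lemma submodule_bounds: "submodule (bounds n) R (P n)"
proof -
  interpret P: module R "P n" by (rule module_P)
  interpret P': module R "P (Suc n)" by (rule module_P)
  have *: "bounds n = {y \<in> carrier (P n). \<exists>z\<in>carrier (P (Suc n)). y \<ominus>\<^bsub>P n\<^esub> d n z \<in> {\<zero>\<^bsub>P n\<^esub>}}"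
    by (auto simp: bounds_def d_closed P.minus_eq_zero)
  show ?thesis unfolding *
    by (rule submodule_image_plus[OF module_P module_P d_hom P'.carrier_is_submodule P.submodule_trivial])
qed

end

section \<open>Cochains with values in a subquotient, and their long exact sequence\<close>

locale resolution_module = free_resolution R B d e \<aa> + noetherian_module R M
  for R :: "('a, 'r) ring_scheme" and B :: "nat \<Rightarrow> 'x set"
    and d :: "nat \<Rightarrow> ('x \<Rightarrow> 'a) \<Rightarrow> ('x \<Rightarrow> 'a)" and e :: "'x \<Rightarrow> 'a" and \<aa> :: "'a set"
    and M :: "('a, 'm, 'k) module_scheme"
begin

lemma module_M: "module R M" ..

lemma noetherian_Hom: "noetherian_module R (Hom_P M n)"
  using module_Hom[OF module_P module_M] noetherian
  by (simp add: noetherian_module_def noetherian_module_axioms_def)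

lemma module_Hom_P: "module R (Hom_P M n)"
  by (rule module_Hom[OF module_P module_M])

lemma intoD: "\<phi> \<in> into M n Z \<Longrightarrow> \<phi> \<in> carrier (Hom_P M n)"
    "\<phi> \<in> into M n Z \<Longrightarrow> x \<in> carrier (P n) \<Longrightarrow> \<phi> x \<in> Z"
  by (auto simp: into_def)

lemma intoI: "\<phi> \<in> carrier (Hom_P M n) \<Longrightarrow> (\<And>x. x \<in> carrier (P n) \<Longrightarrow> \<phi> x \<in> Z) \<Longrightarrow> \<phi> \<in> into M n Z"
  by (auto simp: into_def)

lemma into_mono: "Z \<subseteq> Z' \<Longrightarrow> into M n Z \<subseteq> into M n Z'"
  by (auto simp: into_def)

lemma submodule_into:
  assumes Z: "submodule Z R M" shows "submodule (into M n Z) R (Hom_P M n)"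
proof -
  interpret X: module R "Hom_P M n" by (rule module_Hom_P)
  show ?thesis
    by (rule X.submoduleI') (auto simp: into_def Hom_apply submodule_closed[OF Z])
qed

lemma cod_hom: "cod n \<in> mod_hom R (Hom_P M n) (Hom_P M (Suc n))"
  by (rule pre_comp_hom[OF module_P module_P module_M d_hom])

lemma cod_apply: "x \<in> carrier (P (Suc n)) \<Longrightarrow> cod n \<phi> x = \<phi> (d n x)"
  by (simp add: pre_comp_def)

lemma Hom_zero:
  assumes "\<phi> \<in> carrier (Hom_P M n)" shows "\<phi> \<zero>\<^bsub>P n\<^esub> = \<zero>\<^bsub>M\<^esub>"
  by (rule mod_hom_zero[OF module_P module_M Hom_carrierD(1)[OF assms]])

lemma cod_cod: "\<phi> \<in> carrier (Hom_P M n) \<Longrightarrow> cod (Suc n) (cod n \<phi>) = \<zero>\<^bsub>Hom_P M (Suc (Suc n))\<^esub>"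
proof (rule Hom_eqI[of _ R "P (Suc (Suc n))" M])
  interpret X: module R "Hom_P M (Suc (Suc n))" by (rule module_Hom_P)
  show "\<zero>\<^bsub>Hom_P M (Suc (Suc n))\<^esub> \<in> carrier (Hom_P M (Suc (Suc n)))" by (rule X.zero_closed)
qed (use mod_homD(1)[OF cod_hom] in \<open>auto simp: cod_apply Hom_apply d_closed d_d Hom_zero\<close>)

lemma cod_into: "\<phi> \<in> into M n Z \<Longrightarrow> cod n \<phi> \<in> into M (Suc n) Z"
  using mod_homD(1)[OF cod_hom] by (auto simp: into_def cod_apply d_closed)

lemma into_zero: "submodule Z R M \<Longrightarrow> \<zero>\<^bsub>Hom_P M n\<^esub> \<in> into M n Z"
  using module.submodule_zero[OF module_Hom_P submodule_into] .

lemma submodule_bnd: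
  assumes Z: "submodule Z R M" shows "submodule (bnd M n Z) R (Hom_P M n)"
proof (cases n)
  case 0
  then show ?thesis using module.submodule_trivial[OF module_Hom_P] by simp
next
  case (Suc m)
  interpret X: module R "Hom_P M n" by (rule module_Hom_P)
  have mem: "\<phi> \<in> into M m Z \<Longrightarrow> cod m \<phi> \<in> carrier (Hom_P M n)" for \<phi>
    using mod_homD(1)[OF cod_hom] intoD(1) Suc by auto
  have *: "bnd M n Z = {\<phi> \<in> carrier (Hom_P M n). \<exists>\<psi>\<in>into M m Z. \<phi> \<ominus>\<^bsub>Hom_P M n\<^esub> cod m \<psi> \<in> {\<zero>\<^bsub>Hom_P M n\<^esub>}}"
    (is "_ = ?R")
  proof (intro equalityI subsetI)
    fix \<phi> assume "\<phi> \<in> bnd M n Z"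
    then obtain \<psi> where "\<psi> \<in> into M m Z" "\<phi> = cod m \<psi>" using Suc by auto
    then show "\<phi> \<in> ?R" using mem X.minus_self by auto
  next
    fix \<phi> assume "\<phi> \<in> ?R"
    then obtain \<psi> where "\<psi> \<in> into M m Z" "\<phi> = cod m \<psi>" using mem X.minus_eq_zero by auto
    then show "\<phi> \<in> bnd M n Z" using Suc by auto
  qed
  show ?thesis using cod_hom[of m] Suc unfolding *
    by (intro submodule_image_plus[OF module_Hom_P module_Hom_P _ submodule_into[OF Z] X.submodule_trivial]) simp
qed

lemma bnd_into: "submodule Z R M \<Longrightarrow> bnd M n Z \<subseteq> into M n Z"
  by (cases n) (auto simp: into_zero cod_into)

lemma bnd_mono: "Z \<subseteq> Z' \<Longrightarrow> bnd M n Z \<subseteq> bnd M n Z'"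
  using into_mono[of Z Z'] by (cases n) (auto simp: subset_iff)

lemma cod_bnd:
  assumes "submodule Z R M" "\<beta> \<in> bnd M n Z" shows "cod n \<beta> = \<zero>\<^bsub>Hom_P M (Suc n)\<^esub>"
  using assms by (cases n) (auto simp: cod_cod intoD mod_hom_zero[OF module_Hom_P module_Hom_P cod_hom])

lemma cob_0: "submodule H R M \<Longrightarrow> cob M 0 H Z = into M 0 H"
proof -
  assume H: "submodule H R M"
  interpret X: module R "Hom_P M 0" by (rule module_Hom_P)
  have "\<phi> \<ominus>\<^bsub>Hom_P M 0\<^esub> \<zero>\<^bsub>Hom_P M 0\<^esub> = \<phi>" if "\<phi> \<in> carrier (Hom_P M 0)" for \<phi>
    using that by (simp add: a_minus_def)
  then show ?thesis by (auto simp: cob_def intoD)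
qed

lemma submodule_coc:
  assumes "submodule H R M" "submodule Z R M"
  shows "submodule (coc M n H Z) R (Hom_P M n)"
  unfolding coc_def
  by (rule submodule_vimage[OF module_Hom_P module_Hom_P cod_hom submodule_into submodule_into]; fact)

lemma submodule_cob:
  assumes "submodule H R M" "submodule Z R M"
  shows "submodule (cob M n H Z) R (Hom_P M n)"
  unfolding cob_def
  by (rule submodule_image_plus[OF module_Hom_P module_Hom_P module.id_hom[OF module_Hom_P]
        submodule_bnd[OF assms(2)] submodule_into[OF assms(1)]])

lemma into_cob:
  assumes "submodule Z R M"
  shows "into M n H \<subseteq> cob M n H Z"
proof
  fix \<phi> assume \<phi>: "\<phi> \<in> into M n H"
  interpret X: module R "Hom_P M n" by (rule module_Hom_P)
  have "\<phi> \<ominus>\<^bsub>Hom_P M n\<^esub> \<zero>\<^bsub>Hom_P M n\<^esub> = \<phi>" using intoD(1)[OF \<phi>] by (simp add: a_minus_def)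
  then show "\<phi> \<in> cob M n H Z"
    using \<phi> intoD(1)[OF \<phi>] X.submodule_zero[OF submodule_bnd[OF assms]]
    by (auto simp: cob_def intro!: bexI[of _ "\<zero>\<^bsub>Hom_P M n\<^esub>"])
qed

lemma bnd_cob:
  assumes "submodule H R M" "submodule Z R M"
  shows "bnd M n Z \<subseteq> cob M n H Z"
proof
  fix \<beta> assume \<beta>: "\<beta> \<in> bnd M n Z"
  interpret X: module R "Hom_P M n" by (rule module_Hom_P)
  have "\<beta> \<in> carrier (Hom_P M n)" using X.submodule_mem[OF submodule_bnd[OF assms(2)] \<beta>] .
  then show "\<beta> \<in> cob M n H Z"
    using \<beta> into_zero[OF assms(1)] by (auto simp: cob_def X.minus_self intro!: bexI[of _ \<beta>])
qed

lemma cobE: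
  assumes "\<phi> \<in> cob M n H Z"
  obtains \<beta> where "\<phi> \<in> carrier (Hom_P M n)" "\<beta> \<in> bnd M n Z" "\<phi> \<ominus>\<^bsub>Hom_P M n\<^esub> \<beta> \<in> into M n H"
  using assms by (auto simp: cob_def)

lemma cob_mono: "Z \<subseteq> Z' \<Longrightarrow> H \<subseteq> H' \<Longrightarrow> cob M n H Z \<subseteq> cob M n H' Z'"
  using bnd_mono[of Z Z' n] into_mono[of H H' n] unfolding cob_def by blast

lemma coc_mono: "Z \<subseteq> Z' \<Longrightarrow> H \<subseteq> H' \<Longrightarrow> coc M n H Z \<subseteq> coc M n H' Z'"
  using into_mono[of Z Z' n] into_mono[of H H' "Suc n"] unfolding coc_def by blast

lemma into_coc: "H \<subseteq> Z \<Longrightarrow> into M n H \<subseteq> coc M n H Z"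
  using into_mono[of H Z n] cod_into[of _ n H] unfolding coc_def by blast

lemma bnd_coc: "submodule H R M \<Longrightarrow> submodule Z R M \<Longrightarrow> bnd M n Z \<subseteq> coc M n H Z"
  using bnd_into[of Z n] cod_bnd[of Z _ n] into_zero[of H] unfolding coc_def by auto

lemma cob_coc:
  assumes "submodule H R M" "submodule Z R M" "H \<subseteq> Z"
  shows "cob M n H Z \<subseteq> coc M n H Z"
proof
  fix \<phi> assume "\<phi> \<in> cob M n H Z"
  then obtain \<beta> where \<beta>: "\<phi> \<in> carrier (Hom_P M n)" "\<beta> \<in> bnd M n Z" "\<phi> \<ominus>\<^bsub>Hom_P M n\<^esub> \<beta> \<in> into M n H"
    by (rule cobE)
  show "\<phi> \<in> coc M n H Z"
    using module.submodule_minus_cancel[OF module_Hom_P submodule_coc[OF assms(1,2)] \<beta>(1)]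
      bnd_coc[OF assms(1,2)] into_coc[OF assms(3)] \<beta> by blast
qed

text \<open>Well-definedness of the connecting map: up to a coboundary from C, which
  \<open>cod n\<close> kills, the cochain already takes values in A.\<close>

lemma cod_cob:
  assumes "submodule A R M" "submodule C R M" "\<phi> \<in> cob M n A C" "submodule H R M"
  shows "cod n \<phi> \<in> cob M (Suc n) H A"
proof -
  obtain \<beta> where \<beta>: "\<phi> \<in> carrier (Hom_P M n)" "\<beta> \<in> bnd M n C" "\<phi> \<ominus>\<^bsub>Hom_P M n\<^esub> \<beta> \<in> into M n A"
    using assms(3) by (rule cobE)
  interpret X: module R "Hom_P M (Suc n)" by (rule module_Hom_P)
  have "\<beta> \<in> carrier (Hom_P M n)"
    using module.submodule_mem[OF module_Hom_P submodule_bnd[OF assms(2)] \<beta>(2)] .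
  then have "cod n (\<phi> \<ominus>\<^bsub>Hom_P M n\<^esub> \<beta>) = cod n \<phi> \<ominus>\<^bsub>Hom_P M (Suc n)\<^esub> \<zero>\<^bsub>Hom_P M (Suc n)\<^esub>"
    using \<beta> by (simp add: mod_hom_minus[OF module_Hom_P module_Hom_P cod_hom] cod_bnd[OF assms(2)])
  also have "\<dots> = cod n \<phi>"
    using mod_homD(1)[OF cod_hom \<beta>(1)] by (simp add: a_minus_def)
  finally have "cod n \<phi> \<in> bnd M (Suc n) A" using \<beta>(3) by simp (metis imageI)
  then show ?thesis using bnd_cob[OF assms(4) assms(1)] by blast
qed

text \<open>A class of A/H that dies in C/H comes from the connecting map: if z agrees modulo H with
  \<open>cod n \<psi>\<close>, where \<psi> has values in C, then \<open>cod n \<psi>\<close> has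
  values in A, so \<psi> is a cocycle for C/A. Hence the kernel is an image of Ext of C/A one degree
  lower.\<close>

lemma fg_over_cob_restrict:
  assumes H: "submodule H R M" and A: "submodule A R M" and C: "submodule C R M"
    and HA: "H \<subseteq> A" and AC: "A \<subseteq> C" and fg: "fgExt M n A C"
  shows "fg_over R (Hom_P M (Suc n)) (cob M (Suc n) H A)
    (coc M (Suc n) H A \<inter> cob M (Suc n) H C)"
proof (rule fg_over_image[OF module_Hom_P module_Hom_P cod_hom submodule_coc[OF A C] submodule_cob[OF H A]])
  interpret X: module R "Hom_P M (Suc n)" by (rule module_Hom_P)
  show "coc M (Suc n) H A \<inter> cob M (Suc n) H C \<subseteq> carrier (Hom_P M (Suc n))"
    by (auto simp: cob_def)
  show "cod n ` coc M n A C \<subseteq> coc M (Suc n) H A \<inter> cob M (Suc n) H C"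
  proof
    fix y assume "y \<in> cod n ` coc M n A C"
    then obtain \<phi> where \<phi>: "\<phi> \<in> into M n C" "cod n \<phi> \<in> into M (Suc n) A" "y = cod n \<phi>"
      by (auto simp: coc_def)
    then have "y \<in> bnd M (Suc n) C" by simp
    then have "y \<in> cob M (Suc n) H C" using bnd_cob[OF H C] by blast
    moreover have "y \<in> coc M (Suc n) H A"
      using \<phi> by (simp add: coc_def cod_cod[OF intoD(1)[OF \<phi>(1)]] into_zero[OF H])
    ultimately show "y \<in> coc M (Suc n) H A \<inter> cob M (Suc n) H C" by simp
  qed
  show "cod n ` (cob M n A C \<inter> coc M n A C) \<subseteq> cob M (Suc n) H A"
    using cod_cob[OF A C _ H] by blast
  fix z assume z: "z \<in> coc M (Suc n) H A \<inter> cob M (Suc n) H C"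
  then obtain \<psi> where \<psi>: "z \<in> carrier (Hom_P M (Suc n))" "\<psi> \<in> into M n C"
      "z \<ominus>\<^bsub>Hom_P M (Suc n)\<^esub> cod n \<psi> \<in> into M (Suc n) H"
    by (auto elim!: cobE)
  have "z \<in> into M (Suc n) A" using z by (simp add: coc_def)
  moreover have "z \<ominus>\<^bsub>Hom_P M (Suc n)\<^esub> cod n \<psi> \<in> into M (Suc n) A"
    using \<psi>(3) into_mono[OF HA] by blast
  moreover have "cod n \<psi> \<in> carrier (Hom_P M (Suc n))"
    using mod_homD(1)[OF cod_hom intoD(1)[OF \<psi>(2)]] .
  ultimately have "cod n \<psi> \<in> into M (Suc n) A"
    using X.minus_minus_mem[OF submodule_into[OF A]] by blast
  then have "\<psi> \<in> coc M n A C" using \<psi> by (simp add: coc_def)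
  then show "\<exists>\<psi>\<in>coc M n A C. z \<ominus>\<^bsub>Hom_P M (Suc n)\<^esub> cod n \<psi> \<in> cob M (Suc n) H A"
    using \<psi>(3) into_cob[OF A, of "Suc n" H] by blast
next
  show "fg_over R (Hom_P M n) (cob M n A C) (coc M n A C)" using fg by (simp add: fgExt_def)
  show "cob M n A C \<subseteq> coc M n A C" by (rule cob_coc[OF A C AC])
qed

text \<open>Parts of the long exact sequence of \<open>0 \<rightarrow> A/H \<rightarrow> C/H \<rightarrow> C/A \<rightarrow> 0\<close>;
  inside \<open>Hom(P, M)\<close> its maps are identities and the coboundary map.\<close>

lemma fgExt_left:
  assumes H: "submodule H R M" and A: "submodule A R M" and C: "submodule C R M"
    and HA: "H \<subseteq> A" and AC: "A \<subseteq> C" and fg: "fgExt M n A C" "fgExt M (Suc n) H C"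
  shows "fgExt M (Suc n) H A"
proof -
  let ?n = "Suc n"
  have HC: "H \<subseteq> C" using HA AC by simp
  have *: "{z \<in> coc M ?n H A. z \<in> cob M ?n H C} = coc M ?n H A \<inter> cob M ?n H C" by auto
  show ?thesis unfolding fgExt_def
  proof (rule fg_over_exact[OF module_Hom_P noetherian_Hom module.id_hom[OF module_Hom_P]
        submodule_coc[OF H A] submodule_cob[OF H A] submodule_coc[OF H C] submodule_cob[OF H C]])
    show "(\<lambda>\<phi>. \<phi>) ` coc M ?n H A \<subseteq> coc M ?n H C" using coc_mono[OF AC, of H H ?n] by auto
    show "fg_over R (Hom_P M ?n) (cob M ?n H C) (coc M ?n H C)" using fg by (simp add: fgExt_def)
    show "cob M ?n H C \<subseteq> coc M ?n H C" by (rule cob_coc[OF H C HC])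
    show "fg_over R (Hom_P M ?n) (cob M ?n H A) {z \<in> coc M ?n H A. z \<in> cob M ?n H C}"
      unfolding * by (rule fg_over_cob_restrict[OF H A C HA AC fg(1)])
  qed
qed

text \<open>In degree 0 no connecting map arrives, and the coboundaries for A/H and C/H are the same
  set by \<open>cob_0\<close>. So a submodule of a finitely generated module is all there
  is.\<close>

lemma fgExt_0_left:
  assumes H: "submodule H R M" and A: "submodule A R M" and C: "submodule C R M"
    and HA: "H \<subseteq> A" and AC: "A \<subseteq> C" and fg: "fgExt M 0 H C"
  shows "fgExt M 0 H A"
proof -
  interpret X: noetherian_module R "Hom_P M 0" by (rule noetherian_Hom)
  have "coc M 0 H A \<subseteq> coc M 0 H C" by (rule coc_mono[OF AC]) simp
  then show ?thesis
    using X.fg_over_submodule[OF submodule_cob[OF H C] _ _ submodule_coc[OF H A]]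
      X.submoduleE(1)[OF submodule_coc[OF H C]] fg
    unfolding fgExt_def cob_0[OF H] by blast
qed

text \<open>A cocycle for C/H that is a coboundary for C/A takes values in A after subtraction of a
  coboundary from C, so it comes from A/H.\<close>

lemma fgExt_middle:
  assumes H: "submodule H R M" and A: "submodule A R M" and C: "submodule C R M"
    and HA: "H \<subseteq> A" and AC: "A \<subseteq> C" and fg: "fgExt M n H A" "fgExt M n A C"
  shows "fgExt M n H C"
proof -
  have HC: "H \<subseteq> C" using HA AC by simp
  interpret X: module R "Hom_P M n" by (rule module_Hom_P)
  show ?thesis unfolding fgExt_def
  proof (rule fg_over_exact[OF module_Hom_P noetherian_Hom module.id_hom[OF module_Hom_P]
        submodule_coc[OF H C] submodule_cob[OF H C] submodule_coc[OF A C] submodule_cob[OF A C]])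
    show "(\<lambda>\<phi>. \<phi>) ` coc M n H C \<subseteq> coc M n A C" using coc_mono[OF _ HA, of C C n] by auto
    show "fg_over R (Hom_P M n) (cob M n A C) (coc M n A C)" using fg by (simp add: fgExt_def)
    show "cob M n A C \<subseteq> coc M n A C" by (rule cob_coc[OF A C AC])
    show "fg_over R (Hom_P M n) (cob M n H C) {z \<in> coc M n H C. z \<in> cob M n A C}"
    proof (rule fg_over_image[OF module_Hom_P module_Hom_P module.id_hom[OF module_Hom_P]
          submodule_coc[OF H A] submodule_cob[OF H C]])
      show "{z \<in> coc M n H C. z \<in> cob M n A C} \<subseteq> carrier (Hom_P M n)" by (auto simp: cob_def)
      show "(\<lambda>\<phi>. \<phi>) ` coc M n H A \<subseteq> {z \<in> coc M n H C. z \<in> cob M n A C}"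
        using coc_mono[OF AC, of H H n] into_cob[OF C, of n A] unfolding coc_def by blast
      show "(\<lambda>\<phi>. \<phi>) ` (cob M n H A \<inter> coc M n H A) \<subseteq> cob M n H C"
        using cob_mono[OF AC, of H H n] by auto
      show "fg_over R (Hom_P M n) (cob M n H A) (coc M n H A)" using fg by (simp add: fgExt_def)
      show "cob M n H A \<subseteq> coc M n H A" by (rule cob_coc[OF H A HA])
      fix z assume z: "z \<in> {z \<in> coc M n H C. z \<in> cob M n A C}"
      then obtain \<beta> where \<beta>: "z \<in> carrier (Hom_P M n)" "\<beta> \<in> bnd M n C" "z \<ominus>\<^bsub>Hom_P M n\<^esub> \<beta> \<in> into M n A"
        by (auto elim: cobE)
      have \<beta>c: "\<beta> \<in> carrier (Hom_P M n)" using X.submodule_mem[OF submodule_bnd[OF C] \<beta>(2)] .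
      have "z \<ominus>\<^bsub>Hom_P M n\<^esub> \<beta> \<in> coc M n H C"
        using z bnd_coc[OF H C] \<beta>(2) X.submodule_minus[OF submodule_coc[OF H C]] by blast
      then have "z \<ominus>\<^bsub>Hom_P M n\<^esub> \<beta> \<in> coc M n H A" using \<beta>(3) by (simp add: coc_def)
      moreover have "z \<ominus>\<^bsub>Hom_P M n\<^esub> (z \<ominus>\<^bsub>Hom_P M n\<^esub> \<beta>) = \<beta>"
        using \<beta>(1) \<beta>c by (rule X.minus_minus_cancel)
      ultimately show "\<exists>y\<in>coc M n H A. z \<ominus>\<^bsub>Hom_P M n\<^esub> y \<in> cob M n H C"
        using bnd_cob[OF H C] \<beta>(2) by (intro bexI[of _ "z \<ominus>\<^bsub>Hom_P M n\<^esub> \<beta>"]) auto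
    qed
  qed
qed

text \<open>The connecting map \<open>cod n\<close> has a finitely generated target. Where it yields
  a coboundary, an A-valued cochain \<psi> can be subtracted that leaves a cocycle for C/H.\<close>

lemma fgExt_right:
  assumes H: "submodule H R M" and A: "submodule A R M" and C: "submodule C R M"
    and HA: "H \<subseteq> A" and AC: "A \<subseteq> C" and fg: "fgExt M n H C" "fgExt M (Suc n) H A"
  shows "fgExt M n A C"
proof -
  have HC: "H \<subseteq> C" using HA AC by simp
  interpret X: module R "Hom_P M n" by (rule module_Hom_P)
  interpret X': module R "Hom_P M (Suc n)" by (rule module_Hom_P)
  show ?thesis unfolding fgExt_def
  proof (rule fg_over_exact[OF module_Hom_P noetherian_Hom cod_hom
        submodule_coc[OF A C] submodule_cob[OF A C] submodule_coc[OF H A] submodule_cob[OF H A]])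
    show "cod n ` coc M n A C \<subseteq> coc M (Suc n) H A"
      by (auto simp: coc_def cod_cod intoD(1) into_zero[OF H])
    show "fg_over R (Hom_P M (Suc n)) (cob M (Suc n) H A) (coc M (Suc n) H A)"
      using fg by (simp add: fgExt_def)
    show "cob M (Suc n) H A \<subseteq> coc M (Suc n) H A" by (rule cob_coc[OF H A HA])
    show "fg_over R (Hom_P M n) (cob M n A C) {z \<in> coc M n A C. cod n z \<in> cob M (Suc n) H A}"
    proof (rule fg_over_image[OF module_Hom_P module_Hom_P module.id_hom[OF module_Hom_P]
          submodule_coc[OF H C] submodule_cob[OF A C]])
      show "{z \<in> coc M n A C. cod n z \<in> cob M (Suc n) H A} \<subseteq> carrier (Hom_P M n)"
        by (auto simp: coc_def intoD(1))
      show "(\<lambda>\<phi>. \<phi>) ` coc M n H C \<subseteq> {z \<in> coc M n A C. cod n z \<in> cob M (Suc n) H A}"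
        using coc_mono[OF _ HA, of C C n] into_cob[OF A, of "Suc n" H] unfolding coc_def by blast
      show "(\<lambda>\<phi>. \<phi>) ` (cob M n H C \<inter> coc M n H C) \<subseteq> cob M n A C"
        using cob_mono[OF _ HA, of C C n] by auto
      show "fg_over R (Hom_P M n) (cob M n H C) (coc M n H C)" using fg by (simp add: fgExt_def)
      show "cob M n H C \<subseteq> coc M n H C" by (rule cob_coc[OF H C HC])
      fix z assume z: "z \<in> {z \<in> coc M n A C. cod n z \<in> cob M (Suc n) H A}"
      then obtain \<psi> where \<psi>: "\<psi> \<in> into M n A" "cod n z \<ominus>\<^bsub>Hom_P M (Suc n)\<^esub> cod n \<psi> \<in> into M (Suc n) H"
        by (auto elim!: cobE)
      have zC: "z \<in> into M n C" using z by (simp add: coc_def)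
      have "\<psi> \<in> into M n C" using \<psi>(1) into_mono[OF AC] by blast
      then have "z \<ominus>\<^bsub>Hom_P M n\<^esub> \<psi> \<in> into M n C"
        by (rule X.submodule_minus[OF submodule_into[OF C] zC])
      moreover have "cod n (z \<ominus>\<^bsub>Hom_P M n\<^esub> \<psi>) \<in> into M (Suc n) H"
        using \<psi>(2) mod_hom_minus[OF module_Hom_P module_Hom_P cod_hom intoD(1)[OF zC] intoD(1)[OF \<psi>(1)]]
        by simp
      ultimately have "z \<ominus>\<^bsub>Hom_P M n\<^esub> \<psi> \<in> coc M n H C" by (simp add: coc_def)
      moreover have "z \<ominus>\<^bsub>Hom_P M n\<^esub> (z \<ominus>\<^bsub>Hom_P M n\<^esub> \<psi>) = \<psi>"
        using intoD(1)[OF zC] intoD(1)[OF \<psi>(1)] by (rule X.minus_minus_cancel)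
      ultimately show "\<exists>y\<in>coc M n H C. z \<ominus>\<^bsub>Hom_P M n\<^esub> y \<in> cob M n A C"
        using into_cob[OF C, of n A] \<psi>(1) by (intro bexI[of _ "z \<ominus>\<^bsub>Hom_P M n\<^esub> \<psi>"]) auto
    qed
  qed
qed

end

lemma (in module) minus_minus_minus:
  assumes "a \<in> carrier M" "b \<in> carrier M" "c \<in> carrier M"
  shows "(a \<ominus>\<^bsub>M\<^esub> c) \<ominus>\<^bsub>M\<^esub> (b \<ominus>\<^bsub>M\<^esub> c) = a \<ominus>\<^bsub>M\<^esub> b"
proof -
  have "(a \<ominus>\<^bsub>M\<^esub> c) \<ominus>\<^bsub>M\<^esub> (b \<ominus>\<^bsub>M\<^esub> c) = (a \<ominus>\<^bsub>M\<^esub> c) \<oplus>\<^bsub>M\<^esub> (c \<ominus>\<^bsub>M\<^esub> b)"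
    using assms by (simp add: a_minus_def M.minus_add M.a_comm)
  then show ?thesis using minus_trans[of a c b] assms by simp
qed

lemma mod_hom_diff:
  assumes "module R X" "module R Y" "f \<in> mod_hom R X Y" "g \<in> mod_hom R X Y"
  shows "(\<lambda>x. f x \<ominus>\<^bsub>Y\<^esub> g x) \<in> mod_hom R X Y"
proof -
  interpret Y: module R Y by fact
  show ?thesis
    using mod_homD[OF assms(3)] mod_homD[OF assms(4)]
    by (auto simp: mod_hom_def Y.minus_add_distrib4 Y.smult_minus_distr)
qed

lemma free_module_hom_eq:
  assumes R: "cring R" and M: "module R M"
    and f: "f \<in> mod_hom R (free_module R B) M" and g: "g \<in> mod_hom R (free_module R B) M"
    and eq: "\<And>b. b \<in> B \<Longrightarrow> f (basis R b) = g (basis R b)" and x: "x \<in> carrier (free_module R B)"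
  shows "f x = g x"
proof -
  interpret R: cring R by fact
  interpret M: module R M by fact
  let ?F = "free_module R B"
  have F: "module R ?F" by (rule R.module_free_module)
  have sub: "submodule {x \<in> carrier ?F. f x \<ominus>\<^bsub>M\<^esub> g x \<in> {\<zero>\<^bsub>M\<^esub>}} R ?F"
    by (rule submodule_vimage[OF F M mod_hom_diff[OF F M f g] module.carrier_is_submodule[OF F] M.submodule_trivial])
  have "carrier ?F \<subseteq> {x \<in> carrier ?F. f x \<ominus>\<^bsub>M\<^esub> g x \<in> {\<zero>\<^bsub>M\<^esub>}}"
  proof (rule R.free_module_span[OF sub])
    show "basis R b \<in> {x \<in> carrier ?F. f x \<ominus>\<^bsub>M\<^esub> g x \<in> {\<zero>\<^bsub>M\<^esub>}}" if b: "b \<in> B" for b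
      using mod_homD(1)[OF g R.basis_closed[OF b]] R.basis_closed[OF b] eq[OF b]
      by (simp add: M.minus_self del: formal_sum.simps)
  qed
  then have "f x \<ominus>\<^bsub>M\<^esub> g x = \<zero>\<^bsub>M\<^esub>" using x by blast
  then show ?thesis using M.minus_eq_zero mod_homD(1)[OF f x] mod_homD(1)[OF g x] by blast
qed

lemma (in module) fg_generated_submodule:
  assumes "finite S" "S \<subseteq> carrier M"
  shows "\<exists>T. submodule T R M \<and> S \<subseteq> T \<and> fg_over R M {\<zero>\<^bsub>M\<^esub>} T"
  using assms
proof induction
  case empty
  then show ?case using submodule_trivial fg_over_subset_base[of "{\<zero>\<^bsub>M\<^esub>}" "{\<zero>\<^bsub>M\<^esub>}"] by blast
next
  case (insert s S)
  then obtain T where T: "submodule T R M" "S \<subseteq> T" "fg_over R M {\<zero>\<^bsub>M\<^esub>} T" by auto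
  have s: "s \<in> carrier M" using insert by auto
  obtain S' where S': "finite S'" "S' \<subseteq> T" "\<And>U. submodule U R M \<Longrightarrow> {\<zero>\<^bsub>M\<^esub>} \<subseteq> U \<Longrightarrow> S' \<subseteq> U \<Longrightarrow> T \<subseteq> U"
    by (rule fg_overE[OF T(3)]) (rule that, assumption+)
  have "fg_over R M {\<zero>\<^bsub>M\<^esub>} (adjoin R M T s)"
    unfolding fg_over_def
  proof (intro exI[of _ "insert s S'"] conjI allI impI; (elim conjE)?)
    show "finite (insert s S')" "insert s S' \<subseteq> adjoin R M T s"
      using S' mem_adjoin[OF T(1) s] subset_adjoin[OF T(1) s] by auto
    fix U assume U: "submodule U R M" "{\<zero>\<^bsub>M\<^esub>} \<subseteq> U" "insert s S' \<subseteq> U"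
    then show "adjoin R M T s \<subseteq> U" using S'(3)[OF U(1,2)] by (intro adjoin_least) auto
  qed
  then show ?case
    using submodule_adjoin[OF T(1) s] subset_adjoin[OF T(1) s] mem_adjoin[OF T(1) s] T(2)
    by (intro exI[of _ "adjoin R M T s"]) auto
qed

section \<open>Homotopies on the resolution and their consequences for Ext\<close>

context free_resolution
begin

text \<open>Multiplication by \<open>c\<close> on the resolution is homotopic to a chain map \<open>u\<close> into the subcomplex \<open>F\<close>.
  Only the part of the homotopy that evaluates cocycles is recorded.\<close>

definition homotopy_at ::
    "'a \<Rightarrow> nat \<Rightarrow> (('x \<Rightarrow> 'a) \<Rightarrow> ('x \<Rightarrow> 'a)) \<Rightarrow> (('x \<Rightarrow> 'a) \<Rightarrow> ('x \<Rightarrow> 'a)) \<Rightarrow> bool"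
  where "homotopy_at c n u h \<longleftrightarrow> (\<forall>x\<in>carrier (P n).
    (if n = 0 then c \<odot>\<^bsub>P n\<^esub> x \<ominus>\<^bsub>P n\<^esub> u x \<in> bounds n
     else (c \<odot>\<^bsub>P n\<^esub> x \<ominus>\<^bsub>P n\<^esub> u x) \<ominus>\<^bsub>P n\<^esub> h (d (n - 1) x) \<in> bounds n))"

text \<open>The comparison of chain maps, carried out inside F: \<open>F_exact\<close> says that
  boundaries lying in F lift within F, so each u can be kept there. At the start, c times a basis
  element only has to be congruent to an element of \<open>F 0\<close> modulo boundaries.\<close>

lemma homotopy_exists:
  assumes c: "c \<in> carrier R" and F: "\<And>n. submodule (F n) R (P n)"
    and F_exact: "\<And>n. F n \<inter> bounds n \<subseteq> d n ` F (Suc n)"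
    and base: "\<And>b. b \<in> B 0 \<Longrightarrow> \<exists>y\<in>F 0. c \<odot>\<^bsub>P 0\<^esub> basis R b \<ominus>\<^bsub>P 0\<^esub> y \<in> bounds 0"
  shows "\<exists>u \<in> mod_hom R (P n) (P n). (\<forall>x\<in>carrier (P n). u x \<in> F n) \<and>
    (\<exists>h. (n > 0 \<longrightarrow> h \<in> mod_hom R (P (n - 1)) (P n)) \<and> homotopy_at c n u h)"
proof -
  interpret R: cring R by (rule cring_R)
  interpret P: module R "P i" for i by (rule module_P)
  note basis_P = R.basis_closed
  \<comment> \<open>The invariant of the recursion. The homotopy identity is kept on boundaries
    alone: there the lower homotopy contributes nothing, and the next degree evaluates the identity
    only at \<open>d n x\<close>.\<close>
  define good where "good n u h \<longleftrightarrow> u \<in> mod_hom R (P n) (P n) \<and> h \<in> mod_hom R (P n) (P (Suc n)) \<and>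
    (\<forall>x\<in>carrier (P n). u x \<in> F n) \<and>
    (\<forall>x\<in>bounds n. u x \<in> bounds n \<and> c \<odot>\<^bsub>P n\<^esub> x \<ominus>\<^bsub>P n\<^esub> u x = d n (h x))" for n u h
  have c_hom: "(\<lambda>x. c \<odot>\<^bsub>P n\<^esub> x) \<in> mod_hom R (P n) (P n)" for n by (rule P.smult_hom[OF c])
  \<comment> \<open>Degree 0 has no lower homotopy; \<open>homotopy_at\<close> ignores its last
    argument there, so \<open>undefined\<close> is passed.\<close>
  have step0: "\<exists>u h. good 0 u h \<and> homotopy_at c 0 u undefined"
  proof -
    obtain u where u: "u \<in> mod_hom R (P 0) (P 0)" "\<forall>x\<in>carrier (P 0). u x \<in> F 0"
      "\<forall>b\<in>B 0. c \<odot>\<^bsub>P 0\<^esub> basis R b \<ominus>\<^bsub>P 0\<^esub> u (basis R b) \<in> bounds 0"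
      using P.free_module_choose[OF F[of 0], of "B 0" "\<lambda>b y. c \<odot>\<^bsub>P 0\<^esub> basis R b \<ominus>\<^bsub>P 0\<^esub> y \<in> bounds 0"] base
      by (auto simp del: formal_sum.simps)
    have "\<exists>h\<in>mod_hom R (P 0) (P 1). (\<forall>x\<in>carrier (P 0). h x \<in> carrier (P 1)) \<and>
        (\<forall>b\<in>B 0. c \<odot>\<^bsub>P 0\<^esub> basis R b \<ominus>\<^bsub>P 0\<^esub> u (basis R b) = d 0 (h (basis R b)))"
      using u(3) by (intro P.free_module_choose[OF P.carrier_is_submodule])
        (auto simp: bounds_def simp del: formal_sum.simps)
    then obtain h where h: "h \<in> mod_hom R (P 0) (P 1)"
      "\<forall>b\<in>B 0. c \<odot>\<^bsub>P 0\<^esub> basis R b \<ominus>\<^bsub>P 0\<^esub> u (basis R b) = d 0 (h (basis R b))" by auto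
    have dh: "(\<lambda>x. d 0 (h x)) \<in> mod_hom R (P 0) (P 0)"
      using mod_hom_compose[OF h(1)] d_hom[of 0] by simp
    have eq: "c \<odot>\<^bsub>P 0\<^esub> x \<ominus>\<^bsub>P 0\<^esub> u x = d 0 (h x)" if "x \<in> carrier (P 0)" for x
      using h(2) by (intro free_module_hom_eq[OF cring_R module_P mod_hom_diff[OF module_P module_P c_hom u(1)] dh _ that]) auto
    have inb: "c \<odot>\<^bsub>P 0\<^esub> x \<ominus>\<^bsub>P 0\<^esub> u x \<in> bounds 0" if "x \<in> carrier (P 0)" for x
      using eq[OF that] mod_homD(1)[OF h(1) that] by (auto simp: bounds_def)
    have "u x \<in> bounds 0" if x: "x \<in> bounds 0" for x
      using P.minus_minus_mem[OF submodule_bounds P.submodule_closed(2)[OF submodule_bounds c x] inb]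
        bounds_closed[OF x] mod_homD(1)[OF u(1)] by blast
    then have "good 0 u h" unfolding good_def
      using u h eq bounds_closed by auto
    then show ?thesis using inb by (auto simp: homotopy_at_def)
  qed
  have step: "\<exists>u' h'. good (Suc n) u' h' \<and> homotopy_at c (Suc n) u' h" if g: "good n u h" for n u h
  proof -
    have uh: "u \<in> mod_hom R (P n) (P n)" "h \<in> mod_hom R (P n) (P (Suc n))"
      "\<And>x. x \<in> carrier (P n) \<Longrightarrow> u x \<in> F n"
      "\<And>x. x \<in> bounds n \<Longrightarrow> u x \<in> bounds n \<and> c \<odot>\<^bsub>P n\<^esub> x \<ominus>\<^bsub>P n\<^esub> u x = d n (h x)"
      using g unfolding good_def by auto
    have db: "d n x \<in> bounds n" if "x \<in> carrier (P (Suc n))" for x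
      using that by (auto simp: bounds_def)
    have "\<exists>u'\<in>mod_hom R (P (Suc n)) (P (Suc n)). (\<forall>x\<in>carrier (P (Suc n)). u' x \<in> F (Suc n)) \<and>
        (\<forall>b\<in>B (Suc n). u (d n (basis R b)) = d n (u' (basis R b)))"
    proof (rule P.free_module_choose[OF F])
      fix b assume "b \<in> B (Suc n)"
      then have b: "basis R b \<in> carrier (P (Suc n))" by (rule basis_P)
      have "u (d n (basis R b)) \<in> F n \<inter> bounds n"
        using uh(3)[OF d_closed[OF b]] uh(4)[OF db[OF b]] by simp
      then show "\<exists>m\<in>F (Suc n). u (d n (basis R b)) = d n m" using F_exact[of n] by blast
    qed
    then obtain u' where u': "u' \<in> mod_hom R (P (Suc n)) (P (Suc n))"
      "\<And>x. x \<in> carrier (P (Suc n)) \<Longrightarrow> u' x \<in> F (Suc n)"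
      "\<And>b. b \<in> B (Suc n) \<Longrightarrow> u (d n (basis R b)) = d n (u' (basis R b))" by blast
    have du': "u (d n x) = d n (u' x)" if "x \<in> carrier (P (Suc n))" for x
      by (rule free_module_hom_eq[OF cring_R module_P mod_hom_compose[OF d_hom uh(1)]
            mod_hom_compose[OF u'(1) d_hom] u'(3) that])
    \<comment> \<open>The defect c - u' - h d. The invariant at \<open>d n x\<close> shows that its
      differential vanishes, so by exactness it is the differential of a map, the new homotopy
      h'.\<close>
    let ?k = "\<lambda>x. (c \<odot>\<^bsub>P (Suc n)\<^esub> x \<ominus>\<^bsub>P (Suc n)\<^esub> u' x) \<ominus>\<^bsub>P (Suc n)\<^esub> h (d n x)"
    have hd: "(\<lambda>x. h (d n x)) \<in> mod_hom R (P (Suc n)) (P (Suc n))"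
      by (rule mod_hom_compose[OF d_hom uh(2)])
    have cu: "(\<lambda>x. c \<odot>\<^bsub>P (Suc n)\<^esub> x \<ominus>\<^bsub>P (Suc n)\<^esub> u' x) \<in> mod_hom R (P (Suc n)) (P (Suc n))"
      by (rule mod_hom_diff[OF module_P module_P c_hom u'(1)])
    have k: "?k \<in> mod_hom R (P (Suc n)) (P (Suc n))"
      by (rule mod_hom_diff[OF module_P module_P cu hd])
    have kb: "?k x \<in> bounds (Suc n)" if x: "x \<in> carrier (P (Suc n))" for x
    proof -
      have dx: "d n x \<in> carrier (P n)" by (rule d_closed[OF x])
      have cl: "u' x \<in> carrier (P (Suc n))" "c \<odot>\<^bsub>P (Suc n)\<^esub> x \<in> carrier (P (Suc n))"
        "h (d n x) \<in> carrier (P (Suc n))"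
        using mod_homD(1)[OF u'(1) x] mod_homD(1)[OF c_hom x] mod_homD(1)[OF hd x] by auto
      have "d n (?k x) = (c \<odot>\<^bsub>P n\<^esub> d n x \<ominus>\<^bsub>P n\<^esub> u (d n x)) \<ominus>\<^bsub>P n\<^esub> d n (h (d n x))"
        using cl x c by (simp add: mod_hom_minus[OF module_P module_P d_hom] du' mod_homD(3)[OF d_hom])
      also have "\<dots> = \<zero>\<^bsub>P n\<^esub>"
        using uh(4)[OF db[OF x]] d_closed[OF cl(3)] by (simp add: P.minus_self)
      finally show ?thesis
        using mod_homD(1)[OF k x] by (simp add: bounds_Suc)
    qed
    have "\<exists>h'\<in>mod_hom R (P (Suc n)) (P (Suc (Suc n))).
        (\<forall>x\<in>carrier (P (Suc n)). h' x \<in> carrier (P (Suc (Suc n)))) \<and>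
        (\<forall>b\<in>B (Suc n). ?k (basis R b) = d (Suc n) (h' (basis R b)))"
    proof (rule P.free_module_choose[OF P.carrier_is_submodule])
      fix b assume "b \<in> B (Suc n)"
      then have "?k (basis R b) \<in> bounds (Suc n)" by (rule kb[OF basis_P])
      then show "\<exists>m\<in>carrier (P (Suc (Suc n))). ?k (basis R b) = d (Suc n) m"
        unfolding bounds_def by blast
    qed
    then obtain h' where h': "h' \<in> mod_hom R (P (Suc n)) (P (Suc (Suc n)))"
      "\<And>b. b \<in> B (Suc n) \<Longrightarrow> ?k (basis R b) = d (Suc n) (h' (basis R b))" by blast
    have dh': "?k x = d (Suc n) (h' x)" if "x \<in> carrier (P (Suc n))" for x
      by (rule free_module_hom_eq[OF cring_R module_P k mod_hom_compose[OF h'(1) d_hom] h'(2) that])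
    have "u' x \<in> bounds (Suc n) \<and> c \<odot>\<^bsub>P (Suc n)\<^esub> x \<ominus>\<^bsub>P (Suc n)\<^esub> u' x = d (Suc n) (h' x)"
      if x: "x \<in> bounds (Suc n)" for x
    proof -
      have xc: "x \<in> carrier (P (Suc n))" "d n x = \<zero>\<^bsub>P n\<^esub>" using x by (auto simp: bounds_Suc)
      have "?k x = c \<odot>\<^bsub>P (Suc n)\<^esub> x \<ominus>\<^bsub>P (Suc n)\<^esub> u' x"
        using xc mod_homD(1)[OF cu xc(1)]
        by (simp add: mod_hom_zero[OF module_P module_P uh(2)]) (simp add: a_minus_def)
      moreover from this have "u' x \<in> bounds (Suc n)"
        using P.minus_minus_mem[OF submodule_bounds P.submodule_closed(2)[OF submodule_bounds c x]]
          kb[OF xc(1)] mod_homD(1)[OF u'(1) xc(1)] by metis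
      ultimately show ?thesis using dh'[OF xc(1)] by simp
    qed
    then have "good (Suc n) u' h'" unfolding good_def using u' h' by auto
    then show ?thesis using kb by (auto simp: homotopy_at_def)
  qed
  have ex: "\<exists>u h. good n u h" for n
    by (induction n) (use step0 step in blast)+
  show ?thesis
  proof (cases n)
    case 0
    obtain u h where "good 0 u h" "homotopy_at c 0 u undefined" using step0 by blast
    then show ?thesis unfolding 0 good_def
      by (intro bexI[of _ u] conjI exI[of _ undefined]) auto
  next
    case (Suc m)
    obtain u h where g: "good m u h" using ex by blast
    then have "h \<in> mod_hom R (P m) (P (Suc m))" by (simp add: good_def)
    moreover obtain u' h' where g': "good (Suc m) u' h'" "homotopy_at c (Suc m) u' h"
      using step[OF g] by blast
    ultimately show ?thesis unfolding Suc
      using g'(1)[unfolded good_def] by (intro bexI[of _ u'] conjI exI[of _ h]) auto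
  qed
qed

text \<open>\<open>F n \<inter> bounds n\<close> is finitely generated because R is noetherian, and
  preimages of its generators span \<open>F (Suc n)\<close>. Beginning with a finitely generated
  \<open>F 0\<close> around e, this takes the place of a resolution by finitely generated free
  modules.\<close>

lemma finite_type_subcomplex:
  "\<exists>F. (\<forall>n. submodule (F n) R (P n) \<and> fg_over R (P n) {\<zero>\<^bsub>P n\<^esub>} (F n) \<and> F n \<inter> bounds n \<subseteq> d n ` F (Suc n))
    \<and> e \<in> F 0"
proof -
  interpret R: cring R by (rule cring_R)
  interpret P: noetherian_module R "P i" for i
    using module_P noetherian_R by (simp add: noetherian_module_def noetherian_module_axioms_def)
  let ?good = "\<lambda>n F. submodule F R (P n) \<and> fg_over R (P n) {\<zero>\<^bsub>P n\<^esub>} F \<and> (n = 0 \<longrightarrow> e \<in> F)"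
  have "\<exists>F. \<forall>n. ?good n (F n) \<and> F n \<inter> bounds n \<subseteq> d n ` F (Suc n)"
  proof (rule dependent_nat_choice)
    show "\<exists>F. ?good 0 F"
      using P.fg_generated_submodule[of "{e}" 0] e_closed by auto
    fix F n assume F: "?good n F"
    have sub: "submodule (F \<inter> bounds n) R (P n)"
      using P.submodule_inter[OF _ submodule_bounds] F by blast
    have "fg_over R (P n) {\<zero>\<^bsub>P n\<^esub>} (F \<inter> bounds n)"
      by (rule P.fg_over_submodule[OF P.submodule_trivial _ _ sub, of F])
        (use F P.submoduleE(1) in auto)
    then obtain S where S: "finite S" "S \<subseteq> F \<inter> bounds n"
        "\<And>T. submodule T R (P n) \<Longrightarrow> {\<zero>\<^bsub>P n\<^esub>} \<subseteq> T \<Longrightarrow> S \<subseteq> T \<Longrightarrow> F \<inter> bounds n \<subseteq> T"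
      by (rule fg_overE) (rule that, assumption+)
    obtain S' where S': "finite S'" "S' \<subseteq> carrier (P (Suc n))" "S = d n ` S'"
      using finite_subset_image[OF S(1), of "d n" "carrier (P (Suc n))"] S(2)
      unfolding bounds_def by auto
    obtain F' where F': "submodule F' R (P (Suc n))" "S' \<subseteq> F'" "fg_over R (P (Suc n)) {\<zero>\<^bsub>P (Suc n)\<^esub>} F'"
      using P.fg_generated_submodule[OF S'(1,2)] by blast
    let ?I = "{y \<in> carrier (P n). \<exists>z\<in>F'. y \<ominus>\<^bsub>P n\<^esub> d n z \<in> {\<zero>\<^bsub>P n\<^esub>}}"
    have F'c: "z \<in> F' \<Longrightarrow> d n z \<in> carrier (P n)" for z
      using d_closed P.submodule_mem[OF F'(1)] by blast
    have I: "?I = d n ` F'"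
    proof (intro equalityI subsetI)
      fix y assume "y \<in> ?I"
      then show "y \<in> d n ` F'" using F'c P.minus_eq_zero by blast
    next
      fix y assume "y \<in> d n ` F'"
      then show "y \<in> ?I" using F'c P.minus_self by blast
    qed
    have Isub: "submodule (d n ` F') R (P n)"
      unfolding I[symmetric]
      by (rule submodule_image_plus[OF module_P module_P d_hom F'(1) P.submodule_trivial])
    have "F \<inter> bounds n \<subseteq> d n ` F'"
    proof (rule S(3)[OF Isub])
      show "{\<zero>\<^bsub>P n\<^esub>} \<subseteq> d n ` F'" using P.submodule_zero[OF Isub] by blast
      show "S \<subseteq> d n ` F'" using S'(3) F'(2) by blast
    qed
    then show "\<exists>F'. ?good (Suc n) F' \<and> F \<inter> bounds n \<subseteq> d n ` F'" using F' by auto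
  qed
  then show ?thesis by auto
qed

end

context resolution_module
begin

lemma coc_bounds: "\<phi> \<in> coc M n H Z \<Longrightarrow> x \<in> bounds n \<Longrightarrow> \<phi> x \<in> H"
  by (auto simp: coc_def bounds_def into_def cod_apply)

lemma coc_0_I:
  assumes "\<phi> \<in> into M n Z" "\<And>x. x \<in> bounds n \<Longrightarrow> \<phi> x \<in> H"
  shows "\<phi> \<in> coc M n H Z"
  using assms mod_homD(1)[OF cod_hom intoD(1)[OF assms(1)]]
  by (auto simp: coc_def into_def bounds_def cod_apply)

text \<open>As c - u - h d has values in boundaries, which the cocycle \<phi> sends into H, the
  multiple c \<phi> equals \<phi> u + \<phi> h d modulo H. The first summand lies in H by
  assumption, the second is the coboundary of \<phi> h.\<close>

lemma smult_cob_of_homotopy: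
  assumes H: "submodule H R M" and Z: "submodule Z R M" and c: "c \<in> carrier R"
    and u: "u \<in> mod_hom R (P n) (P n)" and h: "n > 0 \<longrightarrow> h \<in> mod_hom R (P (n - 1)) (P n)"
    and hom: "homotopy_at c n u h"
    and \<phi>: "\<phi> \<in> coc M n H Z" and uH: "\<And>x. x \<in> carrier (P n) \<Longrightarrow> \<phi> (u x) \<in> H"
  shows "c \<odot>\<^bsub>Hom_P M n\<^esub> \<phi> \<in> cob M n H Z"
proof -
  interpret X: module R "Hom_P M n" by (rule module_Hom_P)
  interpret Pn: module R "P n" by (rule module_P)
  have \<phi>c: "\<phi> \<in> carrier (Hom_P M n)" "\<phi> \<in> into M n Z" using \<phi> by (auto simp: coc_def intoD)
  note \<phi>h = Hom_carrierD(1)[OF \<phi>c(1)]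
  have c\<phi>: "c \<odot>\<^bsub>Hom_P M n\<^esub> \<phi> \<in> carrier (Hom_P M n)" using c \<phi>c by simp
  note uc = mod_homD(1)[OF u]
  have eq: "\<phi> (c \<odot>\<^bsub>P n\<^esub> x \<ominus>\<^bsub>P n\<^esub> u x) = (c \<odot>\<^bsub>Hom_P M n\<^esub> \<phi>) x \<ominus>\<^bsub>M\<^esub> \<phi> (u x)" if "x \<in> carrier (P n)" for x
    using that c uc by (simp add: mod_hom_minus[OF module_P module_M \<phi>h] mod_homD(3)[OF \<phi>h] Hom_apply)
  show ?thesis
  proof (cases n)
    case 0
    have "c \<odot>\<^bsub>Hom_P M n\<^esub> \<phi> \<in> into M n H"
    proof (rule intoI[OF c\<phi>])
      fix x assume x: "x \<in> carrier (P n)"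
      then have "\<phi> (c \<odot>\<^bsub>P n\<^esub> x \<ominus>\<^bsub>P n\<^esub> u x) \<in> H"
        using hom 0 coc_bounds[OF \<phi>] by (auto simp: homotopy_at_def)
      then have "(c \<odot>\<^bsub>Hom_P M n\<^esub> \<phi>) x \<ominus>\<^bsub>M\<^esub> \<phi> (u x) \<in> H" using eq[OF x] by simp
      then show "(c \<odot>\<^bsub>Hom_P M n\<^esub> \<phi>) x \<in> H"
        using submodule_minus_cancel[OF H _ uH[OF x]] mod_homD(1)[OF Hom_carrierD(1)[OF c\<phi>] x] by blast
    qed
    then show ?thesis using into_cob[OF Z] by blast
  next
    case (Suc m)
    have hm: "h \<in> mod_hom R (P m) (P n)" using h Suc by simp
    \<comment> \<open>The cochain \<phi> h, one degree lower; its coboundary is the witness in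
      \<open>bnd M n Z\<close>.\<close>
    let ?\<psi> = "pre_comp (P m) h \<phi>"
    have \<psi>: "?\<psi> \<in> into M m Z"
      using mod_homD(1)[OF pre_comp_hom[OF module_P module_P module_M hm] \<phi>c(1)] \<phi>c(2) mod_homD(1)[OF hm]
      by (auto simp: into_def pre_comp_def)
    then have \<beta>: "cod m ?\<psi> \<in> bnd M n Z" using Suc by simp
    have \<beta>c: "cod m ?\<psi> \<in> carrier (Hom_P M n)" using X.submodule_mem[OF submodule_bnd[OF Z] \<beta>] .
    have "c \<odot>\<^bsub>Hom_P M n\<^esub> \<phi> \<ominus>\<^bsub>Hom_P M n\<^esub> cod m ?\<psi> \<in> into M n H"
    proof (rule intoI)
      show "c \<odot>\<^bsub>Hom_P M n\<^esub> \<phi> \<ominus>\<^bsub>Hom_P M n\<^esub> cod m ?\<psi> \<in> carrier (Hom_P M n)"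
        using c\<phi> \<beta>c by simp
      fix x assume x: "x \<in> carrier (P n)"
      then have dx: "d m x \<in> carrier (P m)" using d_closed Suc by simp
      then have hdx: "h (d m x) \<in> carrier (P n)" by (rule mod_homD(1)[OF hm])
      have \<psi>x: "(cod m ?\<psi>) x = \<phi> (h (d m x))" using x dx Suc by (simp add: pre_comp_def)
      have vals: "(c \<odot>\<^bsub>Hom_P M n\<^esub> \<phi>) x \<in> carrier M" "\<phi> (u x) \<in> carrier M" "\<phi> (h (d m x)) \<in> carrier M"
        using mod_homD(1)[OF Hom_carrierD(1)[OF c\<phi>] x] mod_homD(1)[OF \<phi>h uc[OF x]]
          mod_homD(1)[OF \<phi>h hdx] by auto
      have "\<phi> ((c \<odot>\<^bsub>P n\<^esub> x \<ominus>\<^bsub>P n\<^esub> u x) \<ominus>\<^bsub>P n\<^esub> h (d m x)) \<in> H"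
        using hom Suc coc_bounds[OF \<phi>] x by (auto simp: homotopy_at_def)
      also have "\<phi> ((c \<odot>\<^bsub>P n\<^esub> x \<ominus>\<^bsub>P n\<^esub> u x) \<ominus>\<^bsub>P n\<^esub> h (d m x))
          = ((c \<odot>\<^bsub>Hom_P M n\<^esub> \<phi>) x \<ominus>\<^bsub>M\<^esub> \<phi> (u x)) \<ominus>\<^bsub>M\<^esub> \<phi> (h (d m x))"
        using x c uc hdx by (simp add: mod_hom_minus[OF module_P module_M \<phi>h] eq[symmetric])
      also have "\<dots> = ((c \<odot>\<^bsub>Hom_P M n\<^esub> \<phi>) x \<ominus>\<^bsub>M\<^esub> \<phi> (h (d m x))) \<ominus>\<^bsub>M\<^esub> \<phi> (u x)"
        using vals by (simp add: a_minus_def M.a_ac)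
      finally have "(c \<odot>\<^bsub>Hom_P M n\<^esub> \<phi>) x \<ominus>\<^bsub>M\<^esub> \<phi> (h (d m x)) \<in> H"
        using submodule_minus_cancel[OF H _ uH[OF x]] vals by blast
      then show "(c \<odot>\<^bsub>Hom_P M n\<^esub> \<phi> \<ominus>\<^bsub>Hom_P M n\<^esub> cod m ?\<psi>) x \<in> H"
        using Hom_minus_apply[OF module_P module_M x c\<phi> \<beta>c] \<psi>x by simp
    qed
    then show ?thesis using \<beta> c\<phi> unfolding cob_def by blast
  qed
qed

text \<open>By the homotopy with c = 1, a cocycle is a coboundary as soon as its values at finitely
  many generators of \<open>F n\<close> lie in H. Evaluation at these generators thus bounds Ext by
  a finite power of Z/H.\<close>

theorem fgExt_of_fg_over:
  assumes H: "submodule H R M" and Z: "submodule Z R M" and HZ: "H \<subseteq> Z"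
    and fg: "fg_over R M H Z"
  shows "fgExt M n H Z"
proof -
  interpret R: cring R by (rule cring_R)
  interpret P0: module R "P 0" by (rule module_P)
  interpret Pn: module R "P n" by (rule module_P)
  interpret X: module R "Hom_P M n" by (rule module_Hom_P)
  obtain F where F: "\<And>n. submodule (F n) R (P n)" "\<And>n. fg_over R (P n) {\<zero>\<^bsub>P n\<^esub>} (F n)"
    "\<And>n. F n \<inter> bounds n \<subseteq> d n ` F (Suc n)" "e \<in> F 0"
    using finite_type_subcomplex by auto
  have base: "\<exists>y\<in>F 0. \<one>\<^bsub>R\<^esub> \<odot>\<^bsub>P 0\<^esub> basis R b \<ominus>\<^bsub>P 0\<^esub> y \<in> bounds 0" if "b \<in> B 0" for b
  proof -
    have b: "basis R b \<in> carrier (P 0)" by (rule R.basis_closed[OF that])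
    obtain r where "r \<in> carrier R" "basis R b \<ominus>\<^bsub>P 0\<^esub> r \<odot>\<^bsub>P 0\<^esub> e \<in> bounds 0"
      using e_gen[OF b] by (auto simp: bounds_def)
    then show ?thesis
      using P0.submodule_closed(2)[OF F(1) _ F(4)] P0.smult_one[OF b] by (intro bexI[of _ "r \<odot>\<^bsub>P 0\<^esub> e"]) auto
  qed
  obtain u h where u: "u \<in> mod_hom R (P n) (P n)" "\<And>x. x \<in> carrier (P n) \<Longrightarrow> u x \<in> F n"
    and h: "n > 0 \<longrightarrow> h \<in> mod_hom R (P (n - 1)) (P n)" "homotopy_at \<one>\<^bsub>R\<^esub> n u h"
    using homotopy_exists[OF R.one_closed F(1) F(3) base, of n] by blast
  obtain S where S: "finite S" "S \<subseteq> F n"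
    "\<And>T. submodule T R (P n) \<Longrightarrow> {\<zero>\<^bsub>P n\<^esub>} \<subseteq> T \<Longrightarrow> S \<subseteq> T \<Longrightarrow> F n \<subseteq> T"
    by (rule fg_overE[OF F(2)]) (rule that, assumption+)
  have SP: "b \<in> S \<Longrightarrow> b \<in> carrier (P n)" for b using S(2) Pn.submodule_mem[OF F(1)] by blast
  show ?thesis unfolding fgExt_def
  proof (rule fg_over_family[OF module_Hom_P noetherian_module_axioms submodule_coc[OF H Z]
        submodule_cob[OF H Z] Z H HZ fg S(1), of "\<lambda>b \<phi>. \<phi> b"])
    show "(\<lambda>\<phi>. \<phi> b) \<in> mod_hom R (Hom_P M n) M" if "b \<in> S" for b by (rule Hom_eval[OF SP[OF that]])
    show "\<phi> b \<in> Z" if "b \<in> S" "\<phi> \<in> coc M n H Z" for b \<phi>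
      using that SP by (auto simp: coc_def into_def)
    have "{\<phi> \<in> coc M n H Z. \<forall>b\<in>S. \<phi> b \<in> H} \<subseteq> cob M n H Z"
    proof
      fix \<phi> assume "\<phi> \<in> {\<phi> \<in> coc M n H Z. \<forall>b\<in>S. \<phi> b \<in> H}"
      then have \<phi>: "\<phi> \<in> coc M n H Z" "\<And>b. b \<in> S \<Longrightarrow> \<phi> b \<in> H" by auto
      then have \<phi>c: "\<phi> \<in> carrier (Hom_P M n)" by (auto simp: coc_def intoD)
      have sub: "submodule {x \<in> carrier (P n). \<phi> x \<in> H} R (P n)"
        by (rule submodule_vimage[OF module_P module_M Hom_carrierD(1)[OF \<phi>c] Pn.carrier_is_submodule H])
      have "F n \<subseteq> {x \<in> carrier (P n). \<phi> x \<in> H}"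
        by (rule S(3)[OF sub]) (use Pn.submodule_zero[OF sub] \<phi>(2) SP in auto)
      then have "\<one>\<^bsub>R\<^esub> \<odot>\<^bsub>Hom_P M n\<^esub> \<phi> \<in> cob M n H Z"
        using u by (intro smult_cob_of_homotopy[OF H Z R.one_closed u(1) h \<phi>(1)]) auto
      then show "\<phi> \<in> cob M n H Z" using X.smult_one[OF \<phi>c] by simp
    qed
    then show "fg_over R (Hom_P M n) (cob M n H Z) {\<phi> \<in> coc M n H Z. \<forall>b\<in>S. \<phi> b \<in> H}"
      by (rule X.fg_over_subset_base)
  qed
qed

text \<open>Multiplication by c sends \<open>P 0\<close> into boundaries, because \<open>P 0\<close>
  modulo boundaries is R/\<aa>. It is therefore homotopic to a map into the zero subcomplex.\<close>

theorem ideal_kills_Ext: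
  assumes H: "submodule H R M" and Z: "submodule Z R M"
    and c: "c \<in> \<aa>" and \<phi>: "\<phi> \<in> coc M n H Z"
  shows "c \<odot>\<^bsub>Hom_P M n\<^esub> \<phi> \<in> cob M n H Z"
proof -
  interpret R: cring R by (rule cring_R)
  interpret P: module R "P i" for i by (rule module_P)
  have cR: "c \<in> carrier R" using c ideal.Icarr[OF ideal_\<aa>] by blast
  have base: "\<exists>y\<in>{\<zero>\<^bsub>P 0\<^esub>}. c \<odot>\<^bsub>P 0\<^esub> basis R b \<ominus>\<^bsub>P 0\<^esub> y \<in> bounds 0" if "b \<in> B 0" for b
  proof -
    have b: "basis R b \<in> carrier (P 0)" by (rule R.basis_closed[OF that])
    obtain r where r: "r \<in> carrier R" "basis R b \<ominus>\<^bsub>P 0\<^esub> r \<odot>\<^bsub>P 0\<^esub> e \<in> bounds 0"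
      using e_gen[OF b] by (auto simp: bounds_def)
    have "c \<otimes>\<^bsub>R\<^esub> r \<in> \<aa>" using c r(1) ideal.I_r_closed[OF ideal_\<aa>] by blast
    then have "c \<odot>\<^bsub>P 0\<^esub> (r \<odot>\<^bsub>P 0\<^esub> e) \<in> bounds 0"
      using e_ann[of "c \<otimes>\<^bsub>R\<^esub> r"] r(1) cR by (simp add: P.smult_assoc1 e_closed bounds_def)
    moreover have "c \<odot>\<^bsub>P 0\<^esub> basis R b \<ominus>\<^bsub>P 0\<^esub> c \<odot>\<^bsub>P 0\<^esub> (r \<odot>\<^bsub>P 0\<^esub> e) \<in> bounds 0"
      using P.submodule_closed(2)[OF submodule_bounds cR r(2)] r(1) cR b e_closed
      by (simp add: P.smult_minus_distr del: formal_sum.simps)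
    ultimately have "c \<odot>\<^bsub>P 0\<^esub> basis R b \<in> bounds 0"
      using P.submodule_minus_cancel[OF submodule_bounds P.smult_closed[OF cR b]] by blast
    then show ?thesis
      using P.submodule_minus[OF submodule_bounds _ P.submodule_zero[OF submodule_bounds]] by blast
  qed
  have "\<exists>u \<in> mod_hom R (P n) (P n). (\<forall>x\<in>carrier (P n). u x \<in> {\<zero>\<^bsub>P n\<^esub>}) \<and>
    (\<exists>h. (n > 0 \<longrightarrow> h \<in> mod_hom R (P (n - 1)) (P n)) \<and> homotopy_at c n u h)"
  proof (rule homotopy_exists[OF cR P.submodule_trivial _ base])
    show "{\<zero>\<^bsub>P n\<^esub>} \<inter> bounds n \<subseteq> d n ` {\<zero>\<^bsub>P (Suc n)\<^esub>}" for n
      using mod_hom_zero[OF module_P module_P d_hom[of n]] by auto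
  qed
  then obtain u h where u: "u \<in> mod_hom R (P n) (P n)" "\<And>x. x \<in> carrier (P n) \<Longrightarrow> u x = \<zero>\<^bsub>P n\<^esub>"
    and h: "n > 0 \<longrightarrow> h \<in> mod_hom R (P (n - 1)) (P n)" "homotopy_at c n u h" by auto
  have "\<phi> \<in> carrier (Hom_P M n)" using \<phi> intoD(1) by (auto simp: coc_def)
  then have "\<phi> (u x) \<in> H" if "x \<in> carrier (P n)" for x
    using u(2)[OF that] Hom_zero submodule_zero[OF H] by simp
  then show ?thesis by (rule smult_cob_of_homotopy[OF H Z cR u(1) h \<phi>])
qed

text \<open>Evaluation at e: since \<open>P 0\<close> is Re modulo boundaries, a cocycle of degree 0
  is determined modulo H by its value at e, and by \<open>e_ann\<close> the possible values are the
  elements that \<aa> multiplies into H.\<close>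

theorem fgExt_0_iff:
  assumes H: "submodule H R M" and Z: "submodule Z R M" and HZ: "H \<subseteq> Z"
  shows "fgExt M 0 H Z \<longleftrightarrow> fg_over R M H {z \<in> Z. \<forall>r\<in>\<aa>. r \<odot>\<^bsub>M\<^esub> z \<in> H}" (is "_ \<longleftrightarrow> fg_over R M H ?K")
proof -
  interpret R: cring R by (rule cring_R)
  interpret \<aa>: ideal \<aa> R by (rule ideal_\<aa>)
  interpret P: module R "P 0" by (rule module_P)
  interpret X: module R "Hom_P M 0" by (rule module_Hom_P)
  have K: "submodule ?K R M" by (rule submodule_colon[OF Z H \<aa>.a_subset])
  have HK: "H \<subseteq> ?K" using HZ submodule_closed(2)[OF H] \<aa>.Icarr by auto
  note ev = Hom_eval[OF e_closed, of R M]
  have ev_K: "\<phi> e \<in> ?K" if \<phi>: "\<phi> \<in> coc M 0 H Z" for \<phi>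
  proof -
    have \<phi>i: "\<phi> \<in> into M 0 Z" using \<phi> by (auto simp: coc_def)
    have "r \<odot>\<^bsub>M\<^esub> \<phi> e \<in> H" if "r \<in> \<aa>" for r
    proof -
      have "r \<odot>\<^bsub>P 0\<^esub> e \<in> bounds 0" using e_ann[OF \<aa>.Icarr[OF that]] that by (simp add: bounds_def)
      then have "\<phi> (r \<odot>\<^bsub>P 0\<^esub> e) \<in> H" by (rule coc_bounds[OF \<phi>])
      then show ?thesis
        using mod_homD(3)[OF Hom_carrierD(1)[OF intoD(1)[OF \<phi>i]] \<aa>.Icarr[OF that] e_closed] by simp
    qed
    then show ?thesis using intoD(2)[OF \<phi>i e_closed] by blast
  qed
  show ?thesis
  proof
    assume fg: "fgExt M 0 H Z"
    show "fg_over R M H ?K"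
    proof (rule fg_over_image[OF module_Hom_P module_M ev submodule_coc[OF H Z] H])
      show "?K \<subseteq> carrier M" by (rule submoduleE(1)[OF K])
      show "(\<lambda>\<phi>. \<phi> e) ` coc M 0 H Z \<subseteq> ?K" using ev_K by blast
      show "(\<lambda>\<phi>. \<phi> e) ` (cob M 0 H Z \<inter> coc M 0 H Z) \<subseteq> H"
        using intoD(2)[OF _ e_closed] by (auto simp: cob_0[OF H])
      show "fg_over R (Hom_P M 0) (cob M 0 H Z) (coc M 0 H Z)" using fg by (simp add: fgExt_def)
      show "cob M 0 H Z \<subseteq> coc M 0 H Z" by (rule cob_coc[OF H Z HZ])
      fix z assume z: "z \<in> ?K"
      then have zM: "z \<in> carrier M" "z \<in> Z" using submodule_mem[OF Z] by auto
      \<comment> \<open>To reach z, each basis element congruent to s e is sent to s z. The scalar s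
        is unique only modulo \<aa>, which changes s z by an element of H.\<close>
      have "\<exists>g\<in>mod_hom R (P 0) M. (\<forall>x\<in>carrier (P 0). g x \<in> Z) \<and>
        (\<forall>b\<in>B 0. \<exists>s\<in>carrier R. basis R b \<ominus>\<^bsub>P 0\<^esub> s \<odot>\<^bsub>P 0\<^esub> e \<in> bounds 0 \<and> g (basis R b) = s \<odot>\<^bsub>M\<^esub> z)"
      proof (rule free_module_choose[OF Z])
        fix b assume "b \<in> B 0"
        then obtain s where "s \<in> carrier R" "basis R b \<ominus>\<^bsub>P 0\<^esub> s \<odot>\<^bsub>P 0\<^esub> e \<in> bounds 0"
          using e_gen[OF R.basis_closed[of b]] by (auto simp: bounds_def simp del: formal_sum.simps)
        then show "\<exists>m\<in>Z. \<exists>s\<in>carrier R. basis R b \<ominus>\<^bsub>P 0\<^esub> s \<odot>\<^bsub>P 0\<^esub> e \<in> bounds 0 \<and> m = s \<odot>\<^bsub>M\<^esub> z"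
          using submodule_closed(2)[OF Z _ zM(2)] by blast
      qed
      then obtain g where g: "g \<in> mod_hom R (P 0) M" "\<forall>x\<in>carrier (P 0). g x \<in> Z"
        "\<forall>b\<in>B 0. \<exists>s\<in>carrier R. basis R b \<ominus>\<^bsub>P 0\<^esub> s \<odot>\<^bsub>P 0\<^esub> e \<in> bounds 0 \<and> g (basis R b) = s \<odot>\<^bsub>M\<^esub> z"
        by blast
      note gc = mod_homD(1)[OF g(1)]
      \<comment> \<open>The relation chosen on the basis spreads to \<open>P 0\<close> because it
        cuts out a submodule. At a boundary it forces s into \<aa>, so g is a cocycle; at e it
        forces 1 - s into \<aa>, so g e agrees with z modulo H.\<close>
      let ?U = "{p \<in> carrier (P 0). \<exists>s\<in>carrier R. p \<ominus>\<^bsub>P 0\<^esub> s \<odot>\<^bsub>P 0\<^esub> e \<in> bounds 0 \<and> g p \<ominus>\<^bsub>M\<^esub> s \<odot>\<^bsub>M\<^esub> z \<in> H}"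
      note e = e_closed
      have U: "submodule ?U R (P 0)"
      proof (rule P.submoduleI'; clarsimp)
        show "\<exists>s\<in>carrier R. \<zero>\<^bsub>P 0\<^esub> \<ominus>\<^bsub>P 0\<^esub> s \<odot>\<^bsub>P 0\<^esub> e \<in> bounds 0 \<and> g \<zero>\<^bsub>P 0\<^esub> \<ominus>\<^bsub>M\<^esub> s \<odot>\<^bsub>M\<^esub> z \<in> H"
          using e zM P.submodule_zero[OF submodule_bounds] submodule_zero[OF H]
          by (intro bexI[of _ "\<zero>\<^bsub>R\<^esub>"]) (auto simp: mod_hom_zero[OF module_P module_M g(1)] P.minus_self minus_self)
      next
        fix p q s t assume *: "p \<in> carrier (P 0)" "q \<in> carrier (P 0)" "s \<in> carrier R" "t \<in> carrier R"
          "p \<ominus>\<^bsub>P 0\<^esub> s \<odot>\<^bsub>P 0\<^esub> e \<in> bounds 0" "q \<ominus>\<^bsub>P 0\<^esub> t \<odot>\<^bsub>P 0\<^esub> e \<in> bounds 0"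
          "g p \<ominus>\<^bsub>M\<^esub> s \<odot>\<^bsub>M\<^esub> z \<in> H" "g q \<ominus>\<^bsub>M\<^esub> t \<odot>\<^bsub>M\<^esub> z \<in> H"
        have "(p \<oplus>\<^bsub>P 0\<^esub> q) \<ominus>\<^bsub>P 0\<^esub> (s \<oplus>\<^bsub>R\<^esub> t) \<odot>\<^bsub>P 0\<^esub> e \<in> bounds 0"
          using P.submodule_closed(3)[OF submodule_bounds *(5,6)] * e
          by (simp add: P.smult_l_distr P.minus_add_distrib4)
        moreover have "g (p \<oplus>\<^bsub>P 0\<^esub> q) \<ominus>\<^bsub>M\<^esub> (s \<oplus>\<^bsub>R\<^esub> t) \<odot>\<^bsub>M\<^esub> z \<in> H"
          using submodule_closed(3)[OF H *(7,8)] * zM gc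
          by (simp add: mod_homD(2)[OF g(1)] smult_l_distr minus_add_distrib4)
        ultimately show "\<exists>s\<in>carrier R. (p \<oplus>\<^bsub>P 0\<^esub> q) \<ominus>\<^bsub>P 0\<^esub> s \<odot>\<^bsub>P 0\<^esub> e \<in> bounds 0 \<and>
            g (p \<oplus>\<^bsub>P 0\<^esub> q) \<ominus>\<^bsub>M\<^esub> s \<odot>\<^bsub>M\<^esub> z \<in> H" using * by (intro bexI[of _ "s \<oplus>\<^bsub>R\<^esub> t"]) auto
      next
        fix c p s assume *: "c \<in> carrier R" "p \<in> carrier (P 0)" "s \<in> carrier R"
          "p \<ominus>\<^bsub>P 0\<^esub> s \<odot>\<^bsub>P 0\<^esub> e \<in> bounds 0" "g p \<ominus>\<^bsub>M\<^esub> s \<odot>\<^bsub>M\<^esub> z \<in> H"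
        have "(c \<odot>\<^bsub>P 0\<^esub> p) \<ominus>\<^bsub>P 0\<^esub> (c \<otimes>\<^bsub>R\<^esub> s) \<odot>\<^bsub>P 0\<^esub> e \<in> bounds 0"
          using P.submodule_closed(2)[OF submodule_bounds *(1,4)] * e
          by (simp add: P.smult_assoc1 P.smult_minus_distr)
        moreover have "g (c \<odot>\<^bsub>P 0\<^esub> p) \<ominus>\<^bsub>M\<^esub> (c \<otimes>\<^bsub>R\<^esub> s) \<odot>\<^bsub>M\<^esub> z \<in> H"
          using submodule_closed(2)[OF H *(1,5)] * zM gc
          by (simp add: mod_homD(3)[OF g(1)] smult_assoc1 smult_minus_distr)
        ultimately show "\<exists>s\<in>carrier R. (c \<odot>\<^bsub>P 0\<^esub> p) \<ominus>\<^bsub>P 0\<^esub> s \<odot>\<^bsub>P 0\<^esub> e \<in> bounds 0 \<and>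
            g (c \<odot>\<^bsub>P 0\<^esub> p) \<ominus>\<^bsub>M\<^esub> s \<odot>\<^bsub>M\<^esub> z \<in> H" using * by (intro bexI[of _ "c \<otimes>\<^bsub>R\<^esub> s"]) auto
      qed
      have "carrier (P 0) \<subseteq> ?U"
      proof (rule R.free_module_span[OF U])
        fix b assume b: "b \<in> B 0"
        obtain s where s: "s \<in> carrier R" "basis R b \<ominus>\<^bsub>P 0\<^esub> s \<odot>\<^bsub>P 0\<^esub> e \<in> bounds 0" "g (basis R b) = s \<odot>\<^bsub>M\<^esub> z"
          using g(3) b by blast
        then have "g (basis R b) \<ominus>\<^bsub>M\<^esub> s \<odot>\<^bsub>M\<^esub> z \<in> H" using zM submodule_zero[OF H] by (simp add: minus_self)
        then show "basis R b \<in> ?U" using s R.basis_closed[OF b] by blast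
      qed
      then have U_all: "\<exists>s\<in>carrier R. p \<ominus>\<^bsub>P 0\<^esub> s \<odot>\<^bsub>P 0\<^esub> e \<in> bounds 0 \<and> g p \<ominus>\<^bsub>M\<^esub> s \<odot>\<^bsub>M\<^esub> z \<in> H"
        if "p \<in> carrier (P 0)" for p using that by blast
      have g_bounds: "g p \<in> H" if p: "p \<in> bounds 0" for p
      proof -
        have pc: "p \<in> carrier (P 0)" by (rule bounds_closed[OF p])
        obtain s where s: "s \<in> carrier R" "p \<ominus>\<^bsub>P 0\<^esub> s \<odot>\<^bsub>P 0\<^esub> e \<in> bounds 0" "g p \<ominus>\<^bsub>M\<^esub> s \<odot>\<^bsub>M\<^esub> z \<in> H"
          using U_all[OF pc] by blast
        have "s \<odot>\<^bsub>P 0\<^esub> e \<in> bounds 0"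
          using P.minus_minus_mem[OF submodule_bounds p s(2)] s(1) e by simp
        then have "s \<in> \<aa>" using e_ann[OF s(1)] by (simp add: bounds_def)
        then have "s \<odot>\<^bsub>M\<^esub> z \<in> H" using z by blast
        then show ?thesis using submodule_minus_cancel[OF H gc[OF pc] _ s(3)] by blast
      qed
      obtain s where s: "s \<in> carrier R" "e \<ominus>\<^bsub>P 0\<^esub> s \<odot>\<^bsub>P 0\<^esub> e \<in> bounds 0" "g e \<ominus>\<^bsub>M\<^esub> s \<odot>\<^bsub>M\<^esub> z \<in> H"
        using U_all[OF e] by blast
      have "(\<one>\<^bsub>R\<^esub> \<ominus>\<^bsub>R\<^esub> s) \<odot>\<^bsub>P 0\<^esub> e = e \<ominus>\<^bsub>P 0\<^esub> s \<odot>\<^bsub>P 0\<^esub> e"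
        using s(1) e by (simp add: a_minus_def P.smult_l_distr P.smult_l_minus)
      then have "\<one>\<^bsub>R\<^esub> \<ominus>\<^bsub>R\<^esub> s \<in> \<aa>" using e_ann[of "\<one>\<^bsub>R\<^esub> \<ominus>\<^bsub>R\<^esub> s"] s by (simp add: bounds_def)
      then have "(\<one>\<^bsub>R\<^esub> \<ominus>\<^bsub>R\<^esub> s) \<odot>\<^bsub>M\<^esub> z \<in> H" using z by blast
      moreover have "(\<one>\<^bsub>R\<^esub> \<ominus>\<^bsub>R\<^esub> s) \<odot>\<^bsub>M\<^esub> z = z \<ominus>\<^bsub>M\<^esub> s \<odot>\<^bsub>M\<^esub> z"
        using s(1) zM by (simp add: a_minus_def smult_l_distr smult_l_minus)
      ultimately have "(z \<ominus>\<^bsub>M\<^esub> s \<odot>\<^bsub>M\<^esub> z) \<ominus>\<^bsub>M\<^esub> (g e \<ominus>\<^bsub>M\<^esub> s \<odot>\<^bsub>M\<^esub> z) \<in> H"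
        using submodule_minus[OF H _ s(3)] by simp
      moreover have "(z \<ominus>\<^bsub>M\<^esub> s \<odot>\<^bsub>M\<^esub> z) \<ominus>\<^bsub>M\<^esub> (g e \<ominus>\<^bsub>M\<^esub> s \<odot>\<^bsub>M\<^esub> z) = z \<ominus>\<^bsub>M\<^esub> g e"
        using zM s(1) gc[OF e] by (intro minus_minus_minus) auto
      ultimately have zg: "z \<ominus>\<^bsub>M\<^esub> g e \<in> H" by simp
      let ?\<phi> = "restrict g (carrier (P 0))"
      have "?\<phi> \<in> coc M 0 H Z"
        using g g_bounds bounds_closed by (intro coc_0_I intoI Hom_carrierI[OF module_P g(1)]) auto
      moreover have "?\<phi> e = g e" using e by simp
      ultimately show "\<exists>\<phi>\<in>coc M 0 H Z. z \<ominus>\<^bsub>M\<^esub> \<phi> e \<in> H" using zg by metis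
    qed
  next
    assume fg: "fg_over R M H ?K"
    show "fgExt M 0 H Z" unfolding fgExt_def
    proof (rule fg_over_exact[OF module_Hom_P noetherian_module_axioms ev submodule_coc[OF H Z]
          submodule_cob[OF H Z] K H _ fg HK])
      show "(\<lambda>\<phi>. \<phi> e) ` coc M 0 H Z \<subseteq> ?K" using ev_K by blast
      have "{\<phi> \<in> coc M 0 H Z. \<phi> e \<in> H} \<subseteq> into M 0 H"
      proof
        fix \<phi> assume "\<phi> \<in> {\<phi> \<in> coc M 0 H Z. \<phi> e \<in> H}"
        then have \<phi>: "\<phi> \<in> coc M 0 H Z" "\<phi> e \<in> H" by auto
        then have \<phi>c: "\<phi> \<in> carrier (Hom_P M 0)" by (auto simp: coc_def intoD)
        note \<phi>h = Hom_carrierD(1)[OF \<phi>c]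
        show "\<phi> \<in> into M 0 H"
        proof (rule intoI[OF \<phi>c])
          fix p assume p: "p \<in> carrier (P 0)"
          obtain r where r: "r \<in> carrier R" "p \<ominus>\<^bsub>P 0\<^esub> r \<odot>\<^bsub>P 0\<^esub> e \<in> bounds 0"
            using e_gen[OF p] by (auto simp: bounds_def)
          have "\<phi> p \<ominus>\<^bsub>M\<^esub> r \<odot>\<^bsub>M\<^esub> \<phi> e \<in> H"
            using coc_bounds[OF \<phi>(1) r(2)] r(1) p e_closed
            by (simp add: mod_hom_minus[OF module_P module_M \<phi>h] mod_homD(3)[OF \<phi>h])
          then show "\<phi> p \<in> H"
            using submodule_minus_cancel[OF H mod_homD(1)[OF \<phi>h p] submodule_closed(2)[OF H r(1) \<phi>(2)]]
            by blast
        qed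
      qed
      then show "fg_over R (Hom_P M 0) (cob M 0 H Z) {\<phi> \<in> coc M 0 H Z. \<phi> e \<in> H}"
        unfolding cob_0[OF H] by (rule X.fg_over_subset_base)
    qed
  qed
qed

end

section \<open>Comparison of Ext over different ambient modules\<close>

context free_resolution
begin

lemma resolution_moduleI: "module R M \<Longrightarrow> resolution_module R B d e \<aa> M"
  by (intro resolution_module.intro free_resolution_axioms noetherian_module.intro
      noetherian_module_axioms.intro noetherian_R)

lemma cod_post_comp:
  assumes M: "module R M" and N: "module R N" and g: "g \<in> mod_hom R M N"
    and \<phi>: "\<phi> \<in> carrier (Hom_P M n)"
  shows "cod n (post_comp (P n) g \<phi>) = post_comp (P (Suc n)) g (cod n \<phi>)"
  by (auto simp: pre_comp_def post_comp_def d_closed)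

lemma post_comp_into:
  assumes M: "module R M" and N: "module R N" and g: "g \<in> mod_hom R M N"
    and \<phi>: "\<phi> \<in> into M n Z" and gZ: "g ` Z \<subseteq> Z'"
  shows "post_comp (P n) g \<phi> \<in> into N n Z'"
  using mod_homD(1)[OF post_comp_hom[OF module_P M N g]] \<phi> gZ
  by (auto simp: into_def post_comp_def)

lemma into_lift:
  assumes M: "module R M" and N: "module R N" and g: "g \<in> mod_hom R M N"
    and Z: "submodule Z R M" and H': "submodule H' R N"
    and onto: "\<And>z'. z' \<in> Z' \<Longrightarrow> \<exists>z\<in>Z. z' \<ominus>\<^bsub>N\<^esub> g z \<in> H'"
    and \<psi>: "\<psi> \<in> into N n Z'"
  shows "\<exists>\<phi>\<in>into M n Z. \<psi> \<ominus>\<^bsub>Hom_P N n\<^esub> post_comp (P n) g \<phi> \<in> into N n H'"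
proof -
  interpret M: resolution_module R B d e \<aa> M by (rule resolution_moduleI[OF M])
  interpret N: resolution_module R B d e \<aa> N by (rule resolution_moduleI[OF N])
  interpret X: module R "Hom_P N n" by (rule N.module_Hom_P)
  note \<psi>c = N.intoD(1)[OF \<psi>]
  have "\<exists>\<phi> \<in> mod_hom R (P n) M. \<forall>x\<in>carrier (P n). \<phi> x \<in> Z \<and> \<psi> x \<ominus>\<^bsub>N\<^esub> g (\<phi> x) \<in> H'"
    by (rule free_module_lift[OF M N g Z H' Hom_carrierD(1)[OF \<psi>c] N.intoD(2)[OF \<psi>] onto])
  then obtain \<phi> where \<phi>: "\<phi> \<in> mod_hom R (P n) M"
    "\<And>x. x \<in> carrier (P n) \<Longrightarrow> \<phi> x \<in> Z \<and> \<psi> x \<ominus>\<^bsub>N\<^esub> g (\<phi> x) \<in> H'" by blast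
  let ?\<phi> = "restrict \<phi> (carrier (P n))"
  have "?\<phi> \<in> into M n Z"
    using \<phi> by (intro M.intoI Hom_carrierI[OF module_P \<phi>(1)]) auto
  moreover from this have G: "post_comp (P n) g ?\<phi> \<in> carrier (Hom_P N n)"
    using mod_homD(1)[OF post_comp_hom[OF module_P M N g]] M.intoD(1) by blast
  have "\<psi> \<ominus>\<^bsub>Hom_P N n\<^esub> post_comp (P n) g ?\<phi> \<in> into N n H'"
  proof (rule N.intoI)
    show "\<psi> \<ominus>\<^bsub>Hom_P N n\<^esub> post_comp (P n) g ?\<phi> \<in> carrier (Hom_P N n)" using \<psi>c G by simp
    show "(\<psi> \<ominus>\<^bsub>Hom_P N n\<^esub> post_comp (P n) g ?\<phi>) x \<in> H'" if "x \<in> carrier (P n)" for x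
      using \<phi>(2)[OF that] that by (simp add: Hom_minus_apply[OF module_P N that \<psi>c G]) (simp add: post_comp_def)
  qed
  ultimately show ?thesis by blast
qed

text \<open>Cochains lift because \<open>P n\<close> is free, and post-composition with g commutes
  with \<open>cod\<close>, so coboundaries lift too. Degree 0 is separate, since only zero is a
  coboundary there.\<close>

lemma bnd_lift:
  assumes M: "module R M" and N: "module R N" and g: "g \<in> mod_hom R M N"
    and Z: "submodule Z R M" and H': "submodule H' R N"
    and onto: "\<And>z'. z' \<in> Z' \<Longrightarrow> \<exists>z\<in>Z. z' \<ominus>\<^bsub>N\<^esub> g z \<in> H'"
    and \<beta>': "\<beta>' \<in> bnd N n Z'"
  shows "\<exists>\<beta>\<in>bnd M n Z. \<beta>' \<ominus>\<^bsub>Hom_P N n\<^esub> post_comp (P n) g \<beta> \<in> into N n H'"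
proof -
  interpret M: resolution_module R B d e \<aa> M by (rule resolution_moduleI[OF M])
  interpret N: resolution_module R B d e \<aa> N by (rule resolution_moduleI[OF N])
  note G = post_comp_hom[OF module_P M N g]
  show ?thesis
  proof (cases n)
    case 0
    interpret X: module R "Hom_P N 0" by (rule N.module_Hom_P)
    show ?thesis
      using \<beta>' N.into_zero[OF H', of 0]
      unfolding 0 by (simp add: mod_hom_zero[OF M.module_Hom_P N.module_Hom_P G] X.minus_self)
  next
    case (Suc m)
    then obtain \<psi> where \<psi>: "\<psi> \<in> into N m Z'" "\<beta>' = cod m \<psi>" using \<beta>' by auto
    obtain \<phi> where \<phi>: "\<phi> \<in> into M m Z" "\<psi> \<ominus>\<^bsub>Hom_P N m\<^esub> post_comp (P m) g \<phi> \<in> into N m H'"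
      using into_lift[OF M N g Z H' onto \<psi>(1)] by blast
    have "cod m (\<psi> \<ominus>\<^bsub>Hom_P N m\<^esub> post_comp (P m) g \<phi>)
        = cod m \<psi> \<ominus>\<^bsub>Hom_P N n\<^esub> post_comp (P n) g (cod m \<phi>)"
      using mod_hom_minus[OF N.module_Hom_P N.module_Hom_P N.cod_hom N.intoD(1)[OF \<psi>(1)]
          mod_homD(1)[OF G M.intoD(1)[OF \<phi>(1)]]]
        cod_post_comp[OF M N g M.intoD(1)[OF \<phi>(1)]] Suc by simp
    then have "\<beta>' \<ominus>\<^bsub>Hom_P N n\<^esub> post_comp (P n) g (cod m \<phi>) \<in> into N n H'"
      using N.cod_into[OF \<phi>(2)] \<psi>(2) Suc by simp
    moreover have "cod m \<phi> \<in> bnd M n Z" using \<phi>(1) Suc by simp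
    ultimately show ?thesis by blast
  qed
qed

text \<open>The hypotheses say that g induces an isomorphism Z/H \<rightarrow> Z'/H'. The two
  element types may differ, which is what moves results between kernel, image and modules of
  cosets.\<close>

theorem fgExt_iso:
  assumes M: "module R M" and N: "module R N" and g: "g \<in> mod_hom R M N"
    and Z: "submodule Z R M" and H: "submodule H R M" and Z': "submodule Z' R N" and H': "submodule H' R N"
    and HZ: "H \<subseteq> Z" and HZ': "H' \<subseteq> Z'"
    and gZ: "g ` Z \<subseteq> Z'" and onto: "\<And>z'. z' \<in> Z' \<Longrightarrow> \<exists>z\<in>Z. z' \<ominus>\<^bsub>N\<^esub> g z \<in> H'"
    and ker: "\<And>z. z \<in> Z \<Longrightarrow> g z \<in> H' \<longleftrightarrow> z \<in> H"
  shows "fgExt M n H Z \<longleftrightarrow> fgExt N n H' Z'"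
proof -
  interpret M: resolution_module R B d e \<aa> M by (rule resolution_moduleI[OF M])
  interpret N: resolution_module R B d e \<aa> N by (rule resolution_moduleI[OF N])
  interpret X: module R "Hom_P M n" by (rule M.module_Hom_P)
  interpret Y: module R "Hom_P N n" by (rule N.module_Hom_P)
  let ?G = "post_comp (P n) g"
  note G = post_comp_hom[OF module_P M N g]
  have gH: "g ` H \<subseteq> H'" using ker HZ by blast
  have G_coc: "?G \<phi> \<in> coc N n H' Z'" if "\<phi> \<in> coc M n H Z" for \<phi>
  proof -
    have \<phi>: "\<phi> \<in> into M n Z" "cod n \<phi> \<in> into M (Suc n) H" using that by (auto simp: coc_def)
    show ?thesis
      using post_comp_into[OF M N g \<phi>(1) gZ] post_comp_into[OF M N g \<phi>(2) gH]
        cod_post_comp[OF M N g M.intoD(1)[OF \<phi>(1)]] by (simp add: coc_def)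
  qed
  have G_bnd: "?G \<beta> \<in> bnd N n Z'" if b: "\<beta> \<in> bnd M n Z" for \<beta>
  proof (cases n)
    case 0
    then show ?thesis using b
      by (simp add: mod_hom_zero[OF M.module_Hom_P N.module_Hom_P post_comp_hom[OF module_P M N g]])
  next
    case (Suc m)
    then obtain \<psi> where \<psi>: "\<psi> \<in> into M m Z" "\<beta> = cod m \<psi>" using b by auto
    then show ?thesis
      using post_comp_into[OF M N g \<psi>(1) gZ] cod_post_comp[OF M N g M.intoD(1)[OF \<psi>(1)]] Suc
      by simp (metis imageI)
  qed
  have G_cob: "?G \<phi> \<in> cob N n H' Z'" if p: "\<phi> \<in> cob M n H Z" for \<phi>
  proof -
    obtain \<beta> where \<beta>: "\<phi> \<in> carrier (Hom_P M n)" "\<beta> \<in> bnd M n Z" "\<phi> \<ominus>\<^bsub>Hom_P M n\<^esub> \<beta> \<in> into M n H"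
      using p by (rule M.cobE)
    have \<beta>c: "\<beta> \<in> carrier (Hom_P M n)" using X.submodule_mem[OF M.submodule_bnd[OF Z] \<beta>(2)] .
    have "?G \<phi> \<ominus>\<^bsub>Hom_P N n\<^esub> ?G \<beta> \<in> into N n H'"
      using post_comp_into[OF M N g \<beta>(3) gH]
      by (simp add: mod_hom_minus[OF M.module_Hom_P N.module_Hom_P G \<beta>(1) \<beta>c])
    then show ?thesis using G_bnd[OF \<beta>(2)] mod_homD(1)[OF G \<beta>(1)] unfolding cob_def by blast
  qed
  show ?thesis
  proof
    assume fg: "fgExt M n H Z"
    show "fgExt N n H' Z'" unfolding fgExt_def
    proof (rule fg_over_image[OF M.module_Hom_P N.module_Hom_P G M.submodule_coc[OF H Z] N.submodule_cob[OF H' Z']])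
      show "coc N n H' Z' \<subseteq> carrier (Hom_P N n)" by (rule Y.submoduleE(1)[OF N.submodule_coc[OF H' Z']])
      show "?G ` coc M n H Z \<subseteq> coc N n H' Z'" using G_coc by blast
      show "?G ` (cob M n H Z \<inter> coc M n H Z) \<subseteq> cob N n H' Z'" using G_cob by blast
      show "fg_over R (Hom_P M n) (cob M n H Z) (coc M n H Z)" using fg by (simp add: fgExt_def)
      show "cob M n H Z \<subseteq> coc M n H Z" by (rule M.cob_coc[OF H Z HZ])
      fix \<psi> assume \<psi>: "\<psi> \<in> coc N n H' Z'"
      then have \<psi>i: "\<psi> \<in> into N n Z'" by (simp add: coc_def)
      obtain \<phi> where \<phi>: "\<phi> \<in> into M n Z" "\<psi> \<ominus>\<^bsub>Hom_P N n\<^esub> ?G \<phi> \<in> into N n H'"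
        using into_lift[OF M N g Z H' onto \<psi>i] by blast
      have "\<psi> \<ominus>\<^bsub>Hom_P N n\<^esub> ?G \<phi> \<in> coc N n H' Z'" using \<phi>(2) N.into_coc[OF HZ'] by blast
      then have G\<phi>: "?G \<phi> \<in> coc N n H' Z'"
        using Y.minus_minus_mem[OF N.submodule_coc[OF H' Z'] \<psi>] mod_homD(1)[OF G M.intoD(1)[OF \<phi>(1)]] by blast
      have "cod n \<phi> \<in> into M (Suc n) H"
      proof (rule M.intoI)
        show "cod n \<phi> \<in> carrier (Hom_P M (Suc n))" using mod_homD(1)[OF M.cod_hom M.intoD(1)[OF \<phi>(1)]] .
        fix x assume x: "x \<in> carrier (P (Suc n))"
        have "(cod n (?G \<phi>)) x \<in> H'" using G\<phi> N.intoD(2) x by (auto simp: coc_def)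
        then have "g (\<phi> (d n x)) \<in> H'" using x d_closed[OF x] by (simp add: pre_comp_def post_comp_def)
        then show "cod n \<phi> x \<in> H"
          using ker M.intoD(2)[OF \<phi>(1) d_closed[OF x]] by (simp add: M.cod_apply[OF x])
      qed
      then have "\<phi> \<in> coc M n H Z" using \<phi>(1) by (simp add: coc_def)
      then show "\<exists>\<phi>\<in>coc M n H Z. \<psi> \<ominus>\<^bsub>Hom_P N n\<^esub> ?G \<phi> \<in> cob N n H' Z'"
        using \<phi>(2) N.into_cob[OF Z', of n H'] by blast
    qed
  next
    assume fg: "fgExt N n H' Z'"
    show "fgExt M n H Z" unfolding fgExt_def
    proof (rule fg_over_exact[OF M.module_Hom_P N.noetherian_Hom G M.submodule_coc[OF H Z]
          M.submodule_cob[OF H Z] N.submodule_coc[OF H' Z'] N.submodule_cob[OF H' Z']])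
      show "?G ` coc M n H Z \<subseteq> coc N n H' Z'" using G_coc by blast
      show "fg_over R (Hom_P N n) (cob N n H' Z') (coc N n H' Z')" using fg by (simp add: fgExt_def)
      show "cob N n H' Z' \<subseteq> coc N n H' Z'" by (rule N.cob_coc[OF H' Z' HZ'])
      have "{\<phi> \<in> coc M n H Z. ?G \<phi> \<in> cob N n H' Z'} \<subseteq> cob M n H Z"
      proof
        fix \<phi> assume "\<phi> \<in> {\<phi> \<in> coc M n H Z. ?G \<phi> \<in> cob N n H' Z'}"
        then have \<phi>: "\<phi> \<in> into M n Z" "?G \<phi> \<in> cob N n H' Z'" by (auto simp: coc_def)
        note \<phi>c = M.intoD(1)[OF \<phi>(1)]
        obtain \<beta>' where \<beta>': "?G \<phi> \<in> carrier (Hom_P N n)" "\<beta>' \<in> bnd N n Z'"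
          "?G \<phi> \<ominus>\<^bsub>Hom_P N n\<^esub> \<beta>' \<in> into N n H'" using \<phi>(2) by (rule N.cobE)
        obtain \<beta> where \<beta>: "\<beta> \<in> bnd M n Z" "\<beta>' \<ominus>\<^bsub>Hom_P N n\<^esub> ?G \<beta> \<in> into N n H'"
          using bnd_lift[OF M N g Z H' onto \<beta>'(2)] by blast
        have \<beta>i: "\<beta> \<in> into M n Z" using M.bnd_into[OF Z] \<beta>(1) by blast
        note \<beta>c = M.intoD(1)[OF \<beta>i]
        have \<beta>'c: "\<beta>' \<in> carrier (Hom_P N n)" using Y.submodule_mem[OF N.submodule_bnd[OF Z'] \<beta>'(2)] .
        have "?G \<phi> \<ominus>\<^bsub>Hom_P N n\<^esub> ?G \<beta> \<in> into N n H'"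
          using Y.submodule_closed(3)[OF N.submodule_into[OF H'] \<beta>'(3) \<beta>(2)]
            Y.minus_trans[OF \<beta>'(1) \<beta>'c mod_homD(1)[OF G \<beta>c]] by simp
        then have *: "?G (\<phi> \<ominus>\<^bsub>Hom_P M n\<^esub> \<beta>) \<in> into N n H'"
          by (simp add: mod_hom_minus[OF M.module_Hom_P N.module_Hom_P G \<phi>c \<beta>c])
        have diff: "\<phi> \<ominus>\<^bsub>Hom_P M n\<^esub> \<beta> \<in> into M n Z"
          by (rule X.submodule_minus[OF M.submodule_into[OF Z] \<phi>(1) \<beta>i])
        have "\<phi> \<ominus>\<^bsub>Hom_P M n\<^esub> \<beta> \<in> into M n H"
        proof (rule M.intoI[OF M.intoD(1)[OF diff]])
          fix x assume x: "x \<in> carrier (P n)"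
          have "g ((\<phi> \<ominus>\<^bsub>Hom_P M n\<^esub> \<beta>) x) \<in> H'"
            using N.intoD(2)[OF * x] x by (simp add: post_comp_def)
          then show "(\<phi> \<ominus>\<^bsub>Hom_P M n\<^esub> \<beta>) x \<in> H" using ker[OF M.intoD(2)[OF diff x]] by simp
        qed
        then show "\<phi> \<in> cob M n H Z" using \<phi>c \<beta>(1) unfolding cob_def by blast
      qed
      then show "fg_over R (Hom_P M n) (cob M n H Z) {\<phi> \<in> coc M n H Z. ?G \<phi> \<in> cob N n H' Z'}"
        by (rule X.fg_over_subset_base)
    qed
  qed
qed

end

context resolution_module
begin

text \<open>The submodule xZ + H, in the shape provided by
  \<open>submodule_image_plus\<close>.\<close>

definition scaled :: "'a \<Rightarrow> 'm set \<Rightarrow> 'm set \<Rightarrow> 'm set"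
  where "scaled x H Z = {y \<in> carrier M. \<exists>z\<in>Z. y \<ominus>\<^bsub>M\<^esub> x \<odot>\<^bsub>M\<^esub> z \<in> H}"

lemma submodule_scaled:
  "x \<in> carrier R \<Longrightarrow> submodule H R M \<Longrightarrow> submodule Z R M \<Longrightarrow> submodule (scaled x H Z) R M"
  unfolding scaled_def by (rule submodule_image_plus[OF module_M module_M smult_hom])

lemma scaled_subset:
  assumes "x \<in> carrier R" "submodule H R M" "submodule Z R M" "H \<subseteq> Z"
  shows "H \<subseteq> scaled x H Z" "scaled x H Z \<subseteq> Z"
proof
  fix h assume h: "h \<in> H"
  then have "h \<ominus>\<^bsub>M\<^esub> x \<odot>\<^bsub>M\<^esub> \<zero>\<^bsub>M\<^esub> \<in> H"
    using assms(1) submodule_minus[OF assms(2) h submodule_zero[OF assms(2)]] by simp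
  then show "h \<in> scaled x H Z"
    using submodule_mem[OF assms(2) h] submodule_zero[OF assms(3)] by (auto simp: scaled_def)
next
  show "scaled x H Z \<subseteq> Z"
    using submodule_minus_cancel[OF assms(3)] submodule_closed(2)[OF assms(3,1)] assms(4)
    unfolding scaled_def by blast
qed

lemma smult_mem_scaled:
  assumes "x \<in> carrier R" "submodule H R M" "submodule Z R M" "z \<in> Z"
  shows "x \<odot>\<^bsub>M\<^esub> z \<in> scaled x H Z"
  using assms submodule_mem[OF assms(3,4)] submodule_zero[OF assms(2)]
  by (auto simp: scaled_def minus_self intro!: bexI[of _ z])

lemma smult_Hom_eq:
  assumes "x \<in> carrier R" "\<phi> \<in> carrier (Hom_P M n)"
  shows "post_comp (P n) (\<lambda>m. x \<odot>\<^bsub>M\<^esub> m) \<phi> = x \<odot>\<^bsub>Hom_P M n\<^esub> \<phi>"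
  by (auto simp: post_comp_def Hom_module_def)

text \<open>Multiplication by \<open>x\<close> factors through \<open>xZ + H\<close> and vanishes on Ext.\<close>

theorem fgExt_of_torsion_and_quotient:
  assumes H: "submodule H R M" and Z: "submodule Z R M" and HZ: "H \<subseteq> Z" and x: "x \<in> \<aa>"
    and T: "fgExt M n H {z \<in> Z. x \<odot>\<^bsub>M\<^esub> z \<in> H}"
    and Q: "n > 0 \<Longrightarrow> fgExt M (n - 1) (scaled x H Z) Z"
  shows "fgExt M n H Z"
proof -
  interpret X: module R "Hom_P M n" by (rule module_Hom_P)
  interpret X': module R "Hom_P M (Suc n)" by (rule module_Hom_P)
  have xR: "x \<in> carrier R" using x ideal.Icarr[OF ideal_\<aa>] by blast
  let ?Q = "scaled x H Z" and ?T = "{z \<in> Z. x \<odot>\<^bsub>M\<^esub> z \<in> H}"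
  note Qs = submodule_scaled[OF xR H Z] and HQ = scaled_subset[OF xR H Z HZ]
  have Ts: "submodule ?T R M" by (rule submodule_vimage[OF module_M module_M smult_hom[OF xR] Z H])
  have HT: "H \<subseteq> ?T" using HZ submodule_closed(2)[OF H xR] by blast
  have TZ: "?T \<subseteq> Z" by blast
  \<comment> \<open>The kernel of the map from Ext of (xZ + H)/H to Ext of Z/H. It is finitely
    generated because the connecting map reaches it from degree n - 1 of Z/(xZ + H); in degree 0 it
    is zero.\<close>
  let ?D = "coc M n H ?Q \<inter> cob M n H Z"
  have D: "submodule ?D R (Hom_P M n)"
    by (rule X.submodule_inter[OF submodule_coc[OF H Qs] submodule_cob[OF H Z]])
  have fgD: "fg_over R (Hom_P M n) (cob M n H ?Q) ?D"
  proof (cases n)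
    case 0
    then have "?D \<subseteq> cob M n H ?Q" using cob_0[OF H] by auto
    then show ?thesis by (rule X.fg_over_subset_base)
  next
    case (Suc m)
    then show ?thesis using fg_over_cob_restrict[OF H Qs Z HQ, of m] Q by simp
  qed
  have smult_apply: "(x \<odot>\<^bsub>Hom_P M k\<^esub> \<phi>) p = x \<odot>\<^bsub>M\<^esub> \<phi> p" if "p \<in> carrier (P k)" for k \<phi> p
    using that by (simp add: Hom_apply)
  \<comment> \<open>The exact step is applied to multiplication by x, read as a map into Ext of (xZ
    + H)/H. Its values lie in \<open>?D\<close> since x acts as zero on Ext of Z/H, and its kernel
    comes from the part of Z that x sends into H.\<close>
  show ?thesis unfolding fgExt_def
  proof (rule fg_over_exact[OF module_Hom_P noetherian_Hom X.smult_hom[OF xR] submodule_coc[OF H Z]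
        submodule_cob[OF H Z] D submodule_cob[OF H Qs] _ fgD])
    show "(\<lambda>\<phi>. x \<odot>\<^bsub>Hom_P M n\<^esub> \<phi>) ` coc M n H Z \<subseteq> ?D"
    proof
      fix \<theta> assume "\<theta> \<in> (\<lambda>\<phi>. x \<odot>\<^bsub>Hom_P M n\<^esub> \<phi>) ` coc M n H Z"
      then obtain \<phi> where \<phi>: "\<phi> \<in> coc M n H Z" "\<theta> = x \<odot>\<^bsub>Hom_P M n\<^esub> \<phi>" by blast
      have \<phi>i: "\<phi> \<in> into M n Z" "cod n \<phi> \<in> into M (Suc n) H" using \<phi>(1) by (auto simp: coc_def)
      have "\<theta> \<in> into M n ?Q"
        using \<phi>(2) intoD[OF \<phi>i(1)] xR smult_mem_scaled[OF xR H Z]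
        by (intro intoI) (auto simp: smult_apply)
      moreover have "cod n \<theta> \<in> into M (Suc n) H"
        using \<phi>(2) mod_homD(3)[OF cod_hom xR intoD(1)[OF \<phi>i(1)]]
          X'.submodule_closed(2)[OF submodule_into[OF H] xR \<phi>i(2)] by simp
      ultimately show "\<theta> \<in> ?D" using ideal_kills_Ext[OF H Z x \<phi>(1)] \<phi>(2) by (simp add: coc_def)
    qed
    show "cob M n H ?Q \<subseteq> ?D"
      using cob_coc[OF H Qs HQ(1)] cob_mono[OF HQ(2), of H H n] by blast
    show "fg_over R (Hom_P M n) (cob M n H Z) {\<phi> \<in> coc M n H Z. x \<odot>\<^bsub>Hom_P M n\<^esub> \<phi> \<in> cob M n H ?Q}"
    proof (rule fg_over_image[OF module_Hom_P module_Hom_P X.id_hom submodule_coc[OF H Ts] submodule_cob[OF H Z]])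
      show "{\<phi> \<in> coc M n H Z. x \<odot>\<^bsub>Hom_P M n\<^esub> \<phi> \<in> cob M n H ?Q} \<subseteq> carrier (Hom_P M n)"
        using X.submoduleE(1)[OF submodule_coc[OF H Z]] by blast
      show "(\<lambda>\<phi>. \<phi>) ` coc M n H ?T \<subseteq> {\<phi> \<in> coc M n H Z. x \<odot>\<^bsub>Hom_P M n\<^esub> \<phi> \<in> cob M n H ?Q}"
      proof
        fix \<phi> assume "\<phi> \<in> (\<lambda>\<phi>. \<phi>) ` coc M n H ?T"
        then have \<phi>: "\<phi> \<in> coc M n H ?T" "\<phi> \<in> into M n ?T" by (auto simp: coc_def)
        have "x \<odot>\<^bsub>Hom_P M n\<^esub> \<phi> \<in> into M n H"
          using intoD[OF \<phi>(2)] xR by (intro intoI) (auto simp: smult_apply)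
        then show "\<phi> \<in> {\<phi> \<in> coc M n H Z. x \<odot>\<^bsub>Hom_P M n\<^esub> \<phi> \<in> cob M n H ?Q}"
          using \<phi>(1) coc_mono[OF TZ, of H H n] into_cob[OF Qs, of n H] by blast
      qed
      show "(\<lambda>\<phi>. \<phi>) ` (cob M n H ?T \<inter> coc M n H ?T) \<subseteq> cob M n H Z"
        using cob_mono[OF TZ, of H H n] by auto
      show "fg_over R (Hom_P M n) (cob M n H ?T) (coc M n H ?T)" using T by (simp add: fgExt_def)
      show "cob M n H ?T \<subseteq> coc M n H ?T" by (rule cob_coc[OF H Ts HT])
      fix \<phi> assume "\<phi> \<in> {\<phi> \<in> coc M n H Z. x \<odot>\<^bsub>Hom_P M n\<^esub> \<phi> \<in> cob M n H ?Q}"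
      then have \<phi>: "\<phi> \<in> coc M n H Z" "x \<odot>\<^bsub>Hom_P M n\<^esub> \<phi> \<in> cob M n H ?Q" by auto
      have \<phi>i: "\<phi> \<in> into M n Z" using \<phi>(1) by (simp add: coc_def)
      note \<phi>c = intoD(1)[OF \<phi>i]
      obtain \<beta>' where \<beta>': "x \<odot>\<^bsub>Hom_P M n\<^esub> \<phi> \<in> carrier (Hom_P M n)" "\<beta>' \<in> bnd M n ?Q"
        "x \<odot>\<^bsub>Hom_P M n\<^esub> \<phi> \<ominus>\<^bsub>Hom_P M n\<^esub> \<beta>' \<in> into M n H" using \<phi>(2) by (rule cobE)
      \<comment> \<open>A coboundary from xZ + H is x times a coboundary \<beta> from Z, modulo H.
        Then x sends \<phi> - \<beta> into H, so \<phi> - \<beta> has values in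
        \<open>?T\<close>.\<close>
      have "\<exists>\<beta>\<in>bnd M n Z. \<beta>' \<ominus>\<^bsub>Hom_P M n\<^esub> post_comp (P n) (\<lambda>m. x \<odot>\<^bsub>M\<^esub> m) \<beta> \<in> into M n H"
        by (rule bnd_lift[OF module_M module_M smult_hom[OF xR] Z H _ \<beta>'(2)]) (auto simp: scaled_def)
      then obtain \<beta> where \<beta>: "\<beta> \<in> bnd M n Z"
        "\<beta>' \<ominus>\<^bsub>Hom_P M n\<^esub> post_comp (P n) (\<lambda>m. x \<odot>\<^bsub>M\<^esub> m) \<beta> \<in> into M n H" by blast
      have \<beta>i: "\<beta> \<in> into M n Z" using bnd_into[OF Z] \<beta>(1) by blast
      note \<beta>c = intoD(1)[OF \<beta>i]
      have \<beta>'c: "\<beta>' \<in> carrier (Hom_P M n)" using X.submodule_mem[OF submodule_bnd[OF Qs] \<beta>'(2)] .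
      have "x \<odot>\<^bsub>Hom_P M n\<^esub> \<phi> \<ominus>\<^bsub>Hom_P M n\<^esub> x \<odot>\<^bsub>Hom_P M n\<^esub> \<beta> \<in> into M n H"
        using X.submodule_closed(3)[OF submodule_into[OF H] \<beta>'(3) \<beta>(2)[unfolded smult_Hom_eq[OF xR \<beta>c]]]
          X.minus_trans[OF \<beta>'(1) \<beta>'c X.smult_closed[OF xR \<beta>c]] by simp
      then have *: "x \<odot>\<^bsub>Hom_P M n\<^esub> (\<phi> \<ominus>\<^bsub>Hom_P M n\<^esub> \<beta>) \<in> into M n H"
        by (simp add: X.smult_minus_distr[OF xR \<phi>c \<beta>c])
      have diff: "\<phi> \<ominus>\<^bsub>Hom_P M n\<^esub> \<beta> \<in> coc M n H Z"
        using X.submodule_minus[OF submodule_coc[OF H Z] \<phi>(1)] bnd_coc[OF H Z] \<beta>(1) by blast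
      then have diffi: "\<phi> \<ominus>\<^bsub>Hom_P M n\<^esub> \<beta> \<in> into M n Z" "cod n (\<phi> \<ominus>\<^bsub>Hom_P M n\<^esub> \<beta>) \<in> into M (Suc n) H"
        by (auto simp: coc_def)
      have "\<phi> \<ominus>\<^bsub>Hom_P M n\<^esub> \<beta> \<in> into M n ?T"
      proof (rule intoI[OF intoD(1)[OF diffi(1)]])
        fix p assume p: "p \<in> carrier (P n)"
        show "(\<phi> \<ominus>\<^bsub>Hom_P M n\<^esub> \<beta>) p \<in> ?T"
          using intoD(2)[OF diffi(1) p] intoD(2)[OF * p] by (simp add: smult_apply[OF p])
      qed
      then have "\<phi> \<ominus>\<^bsub>Hom_P M n\<^esub> \<beta> \<in> coc M n H ?T" using diffi(2) by (simp add: coc_def)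
      moreover have "\<phi> \<ominus>\<^bsub>Hom_P M n\<^esub> (\<phi> \<ominus>\<^bsub>Hom_P M n\<^esub> \<beta>) = \<beta>" by (rule X.minus_minus_cancel[OF \<phi>c \<beta>c])
      ultimately show "\<exists>z\<in>coc M n H ?T. \<phi> \<ominus>\<^bsub>Hom_P M n\<^esub> z \<in> cob M n H Z"
        using bnd_cob[OF H Z] \<beta>(1) by (intro bexI[of _ "\<phi> \<ominus>\<^bsub>Hom_P M n\<^esub> \<beta>"]) auto
    qed
  qed
qed

end

section \<open>Ideals of noetherian rings\<close>

lemma (in cring) cring_idealI:
  assumes "I \<subseteq> carrier R" "\<zero> \<in> I" "\<And>a b. \<lbrakk>a \<in> I; b \<in> I\<rbrakk> \<Longrightarrow> a \<oplus> b \<in> I"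
    and smult: "\<And>a x. \<lbrakk>a \<in> I; x \<in> carrier R\<rbrakk> \<Longrightarrow> x \<otimes> a \<in> I"
  shows "ideal I R"
proof (rule idealI[OF ring_axioms])
  show "subgroup I (add_monoid R)"
  proof (rule add.subgroupI)
    show "I \<noteq> {}" using assms(2) by blast
    fix a assume a: "a \<in> I"
    then have "(\<ominus> \<one>) \<otimes> a \<in> I" "a \<in> carrier R" using smult assms(1) by auto
    then show "\<ominus> a \<in> I" by (simp add: l_minus)
  qed (use assms in auto)
  show "\<And>a x. \<lbrakk>a \<in> I; x \<in> carrier R\<rbrakk> \<Longrightarrow> a \<otimes> x \<in> I"
    using smult assms(1) m_comm by (metis subsetD)
qed (rule smult)

lemma (in cring) colon_ideal:
  assumes J: "ideal J R" and S: "S \<subseteq> carrier R"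
  shows "ideal {t \<in> carrier R. \<forall>s\<in>S. t \<otimes> s \<in> J} R"
proof -
  interpret J: ideal J R by fact
  show ?thesis
  proof (rule cring_idealI)
    fix a x assume a: "a \<in> {t \<in> carrier R. \<forall>s\<in>S. t \<otimes> s \<in> J}" and x: "x \<in> carrier R"
    have "x \<otimes> a \<otimes> s = x \<otimes> (a \<otimes> s)" if "s \<in> S" for s using a x that S by (auto simp: m_assoc)
    then show "x \<otimes> a \<in> {t \<in> carrier R. \<forall>s\<in>S. t \<otimes> s \<in> J}" using a x J.I_l_closed by auto
  next
    fix a b assume "a \<in> {t \<in> carrier R. \<forall>s\<in>S. t \<otimes> s \<in> J}" "b \<in> {t \<in> carrier R. \<forall>s\<in>S. t \<otimes> s \<in> J}"
    then show "a \<oplus> b \<in> {t \<in> carrier R. \<forall>s\<in>S. t \<otimes> s \<in> J}"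
      using S by (auto simp: l_distr subset_iff)
  qed (use S in \<open>auto simp: subset_iff\<close>)
qed

lemma primeidealD:
  assumes "primeideal P R"
  shows "ideal P R" "P \<subseteq> carrier R"
proof -
  interpret primeideal P R by fact
  show "ideal P R" "P \<subseteq> carrier R" by (rule is_ideal, rule a_subset)
qed

locale noetherian_cring = cring R + noetherian_ring R for R (structure)
begin

lemma ideal_ascending_stable:
  assumes J: "\<And>k::nat. ideal (J k) R" and mono: "\<And>k. J k \<subseteq> J (Suc k)"
  shows "\<exists>k. J (Suc k) = J k"
proof -
  have le: "J i \<subseteq> J j" if "i \<le> j" for i j using lift_Suc_mono_le[of J, OF mono that] .
  have "subset.chain {I. ideal I R} (range J)"
    unfolding pred_on.chain_def
  proof (intro conjI ballI)
    show "range J \<subseteq> {I. ideal I R}" using J by blast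
    fix X Y assume "X \<in> range J" "Y \<in> range J"
    then obtain i j where "X = J i" "Y = J j" by blast
    then show "(\<subset>)\<^sup>=\<^sup>= X Y \<or> (\<subset>)\<^sup>=\<^sup>= Y X"
      using le[of i j] le[of j i] nat_le_linear[of i j] by auto
  qed
  then have "\<Union>(range J) \<in> range J" by (intro ideal_chain_is_trivial) auto
  then obtain k where "\<Union>(range J) = J k" by blast
  then have "J (Suc k) \<subseteq> J k" by blast
  then show ?thesis using mono by blast
qed

lemma ideal_noetherian_induct [consumes 1, case_names less]:
  assumes "ideal I R"
    and step: "\<And>I. ideal I R \<Longrightarrow> (\<And>J. ideal J R \<Longrightarrow> I \<subset> J \<Longrightarrow> Q J) \<Longrightarrow> Q I"
  shows "Q I"
proof -
  have "wf {(J, I). ideal I R \<and> ideal J R \<and> I \<subset> J}"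
    unfolding wf_iff_no_infinite_down_chain
  proof
    assume "\<exists>f. \<forall>i. (f (Suc i), f i) \<in> {(J, I). ideal I R \<and> ideal J R \<and> I \<subset> J}"
    then obtain f where f: "\<And>i::nat. ideal (f i) R" "\<And>i. f i \<subset> f (Suc i)" by blast
    then obtain k where "f (Suc k) = f k" using ideal_ascending_stable[of f] by blast
    then show False using f(2)[of k] by simp
  qed
  then show ?thesis using assms(1)
  proof (induction I)
    case (less I)
    then show ?case using step[of I] by blast
  qed
qed

text \<open>If I is not prime, some colon ideal of I is strictly larger and still contains no power
  of x: with a b in I and a, b outside, it is (I : a), unless a power of x multiplies a into I, in
  which case the colon by that power serves. Noetherian induction ends at a prime.\<close>

lemma prime_avoiding_powers:
  assumes "ideal I R" and x: "x \<in> carrier R" and "\<And>k::nat. x [^] k \<notin> I"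
  shows "\<exists>P. primeideal P R \<and> I \<subseteq> P \<and> x \<notin> P"
  using assms(1,3)
proof (induction rule: ideal_noetherian_induct)
  case (less I)
  interpret I: ideal I R by fact
  show ?case
  proof (cases "primeideal I R")
    case True
    then show ?thesis using less.prems[of 1] x by auto
  next
    case False
    then obtain a b where ab: "a \<in> carrier R" "b \<in> carrier R" "a \<otimes> b \<in> I" "a \<notin> I" "b \<notin> I"
      using I.primeidealCE[OF is_cring False] less.prems[of 0] by (metis nat_pow_0 one_closed)
    have bigger: "\<exists>P. primeideal P R \<and> I \<subseteq> P \<and> x \<notin> P"
      if s: "s \<in> carrier R" "\<forall>k::nat. x [^] k \<otimes> s \<notin> I" and t: "t \<in> carrier R" "t \<otimes> s \<in> I" "t \<notin> I" for s t
    proof -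
      let ?J = "{t \<in> carrier R. \<forall>s\<in>{s}. t \<otimes> s \<in> I}"
      have "ideal ?J R" by (rule colon_ideal[OF I.is_ideal]) (use s in simp)
      moreover have "I \<subseteq> ?J" using I.I_r_closed s(1) I.a_subset by auto
      then have "I \<subset> ?J" using t by blast
      moreover have "x [^] k \<notin> ?J" for k :: nat using s(2) by blast
      ultimately have "\<exists>P. primeideal P R \<and> ?J \<subseteq> P \<and> x \<notin> P" by (rule less.IH)
      then show ?thesis using \<open>I \<subseteq> ?J\<close> by blast
    qed
    show ?thesis
    proof (cases "\<forall>k::nat. x [^] k \<otimes> a \<notin> I")
      case True
      then show ?thesis using bigger[of a b] ab by (simp add: m_comm)
    next
      case False
      then obtain k :: nat where k: "x [^] k \<otimes> a \<in> I" by blast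
      have "x [^] j \<otimes> x [^] k \<notin> I" for j :: nat
        using less.prems[of "j + k"] x by (simp add: nat_pow_mult)
      then show ?thesis using bigger[of "x [^] k" a] ab k x by (simp add: m_comm)
    qed
  qed
qed

lemma prime_above_proper_ideal:
  assumes "ideal I R" "I \<noteq> carrier R"
  shows "\<exists>P. primeideal P R \<and> I \<subseteq> P"
proof -
  have "\<one> [^] (k::nat) \<notin> I" for k
    using ideal.one_imp_carrier[OF assms(1)] assms(2) by auto
  then show ?thesis using prime_avoiding_powers[OF assms(1) one_closed] by blast
qed

text \<open>If \<open>J\<close> is not prime, say \<open>rs \<in> J\<close> with \<open>r, s \<notin> J\<close>, then \<open>(J : r)\<close> and \<open>(J : (J : r))\<close> are larger,
  still saturated, and their product lies in \<open>J\<close>.\<close>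

lemma primes_over_saturated_ideal:
  assumes "ideal J R" and \<aa>: "ideal \<aa> R"
    and "\<And>r. r \<in> carrier R \<Longrightarrow> (\<And>x. x \<in> \<aa> \<Longrightarrow> x \<otimes> r \<in> J) \<Longrightarrow> r \<in> J"
  shows "\<exists>F. finite F \<and> (\<forall>Q\<in>F. primeideal Q R \<and> J \<subseteq> Q \<and> \<not> \<aa> \<subseteq> Q) \<and>
    (\<forall>P. primeideal P R \<and> J \<subseteq> P \<longrightarrow> (\<exists>Q\<in>F. Q \<subseteq> P))"
  using assms(1,3)
proof (induction rule: ideal_noetherian_induct)
  case (less J)
  interpret J: ideal J R by fact
  interpret \<aa>: ideal \<aa> R by fact
  show ?case
  proof (cases "J = carrier R")
    case True
    have none: "\<not> (primeideal P R \<and> J \<subseteq> P)" for P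
    proof
      assume P: "primeideal P R \<and> J \<subseteq> P"
      then have "P \<subseteq> carrier R" using primeidealD(2) by blast
      then show False using P True primeideal.I_notcarr[of P R] by auto
    qed
    show ?thesis
    proof (intro exI[of _ "{}"] conjI)
      show "\<forall>P. primeideal P R \<and> J \<subseteq> P \<longrightarrow> (\<exists>Q\<in>{}. Q \<subseteq> P)" using none by simp
    qed simp_all
  next
    case False
    show ?thesis
    proof (cases "primeideal J R")
      case True
      have "\<not> \<aa> \<subseteq> J"
      proof
        assume *: "\<aa> \<subseteq> J"
        \<comment> \<open>Saturation applied to r = 1.\<close>
        have "\<one> \<in> J" by (rule less.prems) (use * in \<open>auto simp: \<aa>.Icarr\<close>)
        then show False using J.one_imp_carrier False by blast
      qed
      with True have "primeideal J R \<and> J \<subseteq> J \<and> \<not> \<aa> \<subseteq> J" by blast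
      then show ?thesis by (intro exI[of _ "{J}"] conjI) blast+
    next
      case False': False
      obtain r s where rs: "r \<in> carrier R" "s \<in> carrier R" "r \<otimes> s \<in> J" "r \<notin> J" "s \<notin> J"
        using J.primeidealCD[OF is_cring False'] False by blast
      have colon: "ideal {t \<in> carrier R. \<forall>s\<in>S. t \<otimes> s \<in> J} R \<and> J \<subseteq> {t \<in> carrier R. \<forall>s\<in>S. t \<otimes> s \<in> J} \<and>
        (\<forall>r\<in>carrier R. (\<forall>x\<in>\<aa>. x \<otimes> r \<in> {t \<in> carrier R. \<forall>s\<in>S. t \<otimes> s \<in> J})
          \<longrightarrow> r \<in> {t \<in> carrier R. \<forall>s\<in>S. t \<otimes> s \<in> J})" if S: "S \<subseteq> carrier R" for S
      proof (intro conjI ballI impI)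
        show "ideal {t \<in> carrier R. \<forall>s\<in>S. t \<otimes> s \<in> J} R" by (rule colon_ideal[OF J.is_ideal S])
        show "J \<subseteq> {t \<in> carrier R. \<forall>s\<in>S. t \<otimes> s \<in> J}" using J.I_r_closed S J.a_subset by blast
        fix r assume r: "r \<in> carrier R" "\<forall>x\<in>\<aa>. x \<otimes> r \<in> {t \<in> carrier R. \<forall>s\<in>S. t \<otimes> s \<in> J}"
        have "r \<otimes> s \<in> J" if s: "s \<in> S" for s
        proof (rule less.prems)
          show "r \<otimes> s \<in> carrier R" using r s S by auto
          show "x \<otimes> (r \<otimes> s) \<in> J" if "x \<in> \<aa>" for x
          proof -
            have "x \<otimes> r \<otimes> s \<in> J" using r(2) that s by blast
            then show ?thesis using m_assoc[of x r s] \<aa>.Icarr[OF that] r(1) s S by auto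
          qed
        qed
        then show "r \<in> {t \<in> carrier R. \<forall>s\<in>S. t \<otimes> s \<in> J}" using r by blast
      qed
      define J1 where "J1 = {t \<in> carrier R. \<forall>s\<in>{r}. t \<otimes> s \<in> J}"
      define J2 where "J2 = {t \<in> carrier R. \<forall>s\<in>J1. t \<otimes> s \<in> J}"
      have J1c: "J1 \<subseteq> carrier R" by (auto simp: J1_def)
      have c1: "ideal J1 R" "J \<subseteq> J1" "\<And>r. r \<in> carrier R \<Longrightarrow> (\<And>x. x \<in> \<aa> \<Longrightarrow> x \<otimes> r \<in> J1) \<Longrightarrow> r \<in> J1"
        using colon[of "{r}", folded J1_def] rs(1) by blast+
      have c2: "ideal J2 R" "J \<subseteq> J2" "\<And>r. r \<in> carrier R \<Longrightarrow> (\<And>x. x \<in> \<aa> \<Longrightarrow> x \<otimes> r \<in> J2) \<Longrightarrow> r \<in> J2"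
        using colon[OF J1c, folded J2_def] by blast+
      have "s \<in> J1" using rs m_comm[of s r] by (auto simp: J1_def)
      then have "J \<subset> J1" using c1(2) rs(5) by blast
      from less.IH[OF c1(1) this c1(3)] obtain F1 where F1: "finite F1" "\<forall>Q\<in>F1. primeideal Q R \<and> J1 \<subseteq> Q \<and> \<not> \<aa> \<subseteq> Q"
        "\<forall>P. primeideal P R \<and> J1 \<subseteq> P \<longrightarrow> (\<exists>Q\<in>F1. Q \<subseteq> P)"
        by blast
      have "r \<in> J2" using rs m_comm[of _ r] by (auto simp: J2_def J1_def)
      then have "J \<subset> J2" using c2(2) rs(4) by blast
      from less.IH[OF c2(1) this c2(3)] obtain F2 where F2: "finite F2" "\<forall>Q\<in>F2. primeideal Q R \<and> J2 \<subseteq> Q \<and> \<not> \<aa> \<subseteq> Q"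
        "\<forall>P. primeideal P R \<and> J2 \<subseteq> P \<longrightarrow> (\<exists>Q\<in>F2. Q \<subseteq> P)"
        by blast
      have "\<exists>Q\<in>F1 \<union> F2. Q \<subseteq> P" if P: "primeideal P R" "J \<subseteq> P" for P
      proof (cases "J1 \<subseteq> P")
        case True
        then show ?thesis using F1(3) P by blast
      next
        case False
        then obtain t where t: "t \<in> J1" "t \<notin> P" by blast
        have "J2 \<subseteq> P"
        proof
          fix y assume y: "y \<in> J2"
          then have "y \<otimes> t \<in> P" "y \<in> carrier R" "t \<in> carrier R" using t P J1c by (auto simp: J2_def)
          then show "y \<in> P" using primeideal.I_prime[OF P(1)] t(2) by blast
        qed
        then show ?thesis using F2(3) P by blast
      qed
      moreover have "primeideal Q R \<and> J \<subseteq> Q \<and> \<not> \<aa> \<subseteq> Q" if Q: "Q \<in> F1 \<union> F2" for Q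
      proof (cases "Q \<in> F1")
        case True
        then have "primeideal Q R \<and> J1 \<subseteq> Q \<and> \<not> \<aa> \<subseteq> Q" using F1(2) by simp
        then show ?thesis using order_trans[OF c1(2)] by simp
      next
        case False
        then have "primeideal Q R \<and> J2 \<subseteq> Q \<and> \<not> \<aa> \<subseteq> Q" using F2(2) Q by simp
        then show ?thesis using order_trans[OF c2(2)] by simp
      qed
      ultimately show ?thesis using F1(1) F2(1) by (intro exI[of _ "F1 \<union> F2"]) simp
    qed
  qed
qed

end

text \<open>Induction on the number of primes. A prime contained in another one may be dropped;
  otherwise, if x avoids all primes but P, it is repaired by adding an element of \<aa> that lies
  outside P and in all the others.\<close>

lemma (in cring) prime_avoidance:
  assumes \<aa>: "ideal \<aa> R" and "finite F" and F: "\<And>Q. Q \<in> F \<Longrightarrow> primeideal Q R \<and> \<not> \<aa> \<subseteq> Q"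
  shows "\<exists>x\<in>\<aa>. \<forall>Q\<in>F. x \<notin> Q"
  using assms(2,3)
proof (induction "card F" arbitrary: F rule: less_induct)
  case less
  interpret \<aa>: ideal \<aa> R by fact
  show ?case
  proof (cases "F = {}")
    case True
    then show ?thesis using \<aa>.zero_closed by blast
  next
    case False
    show ?thesis
    proof (cases "\<exists>P\<in>F. \<exists>Q\<in>F. Q \<noteq> P \<and> Q \<subseteq> P")
      case True
      then obtain P Q where PQ: "P \<in> F" "Q \<in> F" "Q \<noteq> P" "Q \<subseteq> P" by blast
      have "card (F - {Q}) < card F" using PQ(2) less.prems(1) by (rule card_Diff1_less[rotated])
      then obtain x where "x \<in> \<aa>" "\<forall>Q\<in>F - {Q}. x \<notin> Q" using less by (metis Diff_iff finite_Diff)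
      then show ?thesis using PQ by blast
    next
      case antichain: False
      obtain P where P: "P \<in> F" using False by blast
      interpret P: primeideal P R using less.prems P by blast
      have "card (F - {P}) < card F" using P less.prems(1) by (rule card_Diff1_less[rotated])
      then obtain x where x: "x \<in> \<aa>" "\<forall>Q\<in>F - {P}. x \<notin> Q" using less by (metis Diff_iff finite_Diff)
      show ?thesis
      proof (cases "x \<in> P")
        case False
        then show ?thesis using x by blast
      next
        case True
        \<comment> \<open>An element of \<aa> outside P is multiplied by an element of each Q in G
          outside P; since P is prime, the product stays outside.\<close>
        have "\<exists>y\<in>\<aa>. y \<notin> P \<and> (\<forall>Q\<in>G. y \<in> Q)" if "finite G" "G \<subseteq> F - {P}" for G
          using that
        proof induction
          case empty
          then show ?case using less.prems(2)[OF P] by blast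
        next
          case (insert Q G)
          then obtain y where y: "y \<in> \<aa>" "y \<notin> P" "\<forall>Q\<in>G. y \<in> Q" by auto
          have Q: "Q \<in> F" "Q \<noteq> P" using insert.prems by auto
          then have "\<not> Q \<subseteq> P" using antichain P by blast
          then obtain q where q: "q \<in> Q" "q \<notin> P" by blast
          have qc: "q \<in> carrier R" "y \<in> carrier R"
            using q(1) primeidealD(2)[of Q R] less.prems(2)[OF Q(1)] y(1) \<aa>.Icarr by auto
          have "q \<otimes> y \<in> \<aa>" using \<aa>.I_l_closed y(1) qc by blast
          moreover have "q \<otimes> y \<notin> P" using P.I_prime qc y(2) q(2) by blast
          moreover have "q \<otimes> y \<in> Q'" if "Q' \<in> insert Q G" for Q'
          proof -
            have Q': "ideal Q' R" using that insert.prems less.prems(2)[of Q'] primeidealD(1) by blast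
            show ?thesis
              using that ideal.I_l_closed[OF Q'] ideal.I_r_closed[OF Q'] qc q(1) y(3) by blast
          qed
          ultimately show ?case by blast
        qed
        from this[of "F - {P}"] obtain y where y: "y \<in> \<aa>" "y \<notin> P" "\<forall>Q\<in>F - {P}. y \<in> Q"
          using less.prems(1) by auto
        have c: "x \<in> carrier R" "y \<in> carrier R" using x y \<aa>.Icarr by auto
        have "x \<oplus> y \<notin> Q" if Q: "Q \<in> F" for Q
        proof -
          interpret Q: primeideal Q R using less.prems Q by blast
          show ?thesis
          proof
            assume s: "x \<oplus> y \<in> Q"
            show False
            proof (cases "Q = P")
              case True
              then have "(x \<oplus> y) \<ominus> x \<in> Q" using s \<open>x \<in> P\<close> Q.a_closed Q.a_inv_closed by (simp add: a_minus_def)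
              moreover have "(x \<oplus> y) \<ominus> x = y" using c a_lcomm[of x y "\<ominus> x"] by (simp add: a_minus_def a_assoc r_neg)
              ultimately show False using True y(2) by simp
            next
              case False
              then have "(x \<oplus> y) \<ominus> y \<in> Q" using s y(3) Q Q.a_closed Q.a_inv_closed by (simp add: a_minus_def)
              moreover have "(x \<oplus> y) \<ominus> y = x" using c by (simp add: a_minus_def a_assoc r_neg)
              ultimately show False using False x(2) Q by auto
            qed
          qed
        qed
        moreover have "x \<oplus> y \<in> \<aa>" using x y \<aa>.a_closed by blast
        ultimately show ?thesis by blast
      qed
    qed
  qed
qed

text \<open>The condition dim R/(S) < n, read off from primes of R itself. The chain has n strict
  steps and n + 1 primes, so dimension at most n is the condition for n + 1, and n = 0 says that no
  prime contains S. S is an arbitrary set, which allows an element to be inserted without forming an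
  ideal.\<close>

definition no_prime_chain :: "('a, 'r) ring_scheme \<Rightarrow> nat \<Rightarrow> 'a set \<Rightarrow> bool"
  where "no_prime_chain R n S \<longleftrightarrow>
    (\<nexists>P. (\<forall>i\<le>n. primeideal (P i) R \<and> S \<subseteq> P i) \<and> (\<forall>i<n. P i \<subset> P (Suc i)))"

lemma no_prime_chain_mono: "no_prime_chain R n S \<Longrightarrow> S \<subseteq> S' \<Longrightarrow> no_prime_chain R n S'"
  unfolding no_prime_chain_def by (meson order_trans)

context noetherian_cring
begin

lemma no_prime_chain_0:
  assumes "no_prime_chain R 0 S" "ideal I R" "S \<subseteq> I"
  shows "I = carrier R"
proof (rule ccontr)
  assume "I \<noteq> carrier R"
  then obtain P where "primeideal P R" "I \<subseteq> P" using prime_above_proper_ideal assms(2) by blast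
  then show False
    using assms(1,3) unfolding no_prime_chain_def by (auto dest!: spec[of _ "\<lambda>_. P"])
qed

text \<open>A prime P above S is maximal here, so R/P is a field and r is invertible in it. The
  auxiliary \<open>?K\<close> is P + Rr.\<close>

lemma no_prime_chain_1_inverse:
  assumes chain: "no_prime_chain R 1 S" and P: "primeideal P R" "S \<subseteq> P"
    and r: "r \<in> carrier R" "r \<notin> P"
  shows "\<exists>a\<in>carrier R. \<one> \<ominus> a \<otimes> r \<in> P"
proof -
  interpret P: primeideal P R by fact
  let ?K = "{t \<in> carrier R. \<exists>a\<in>carrier R. t \<ominus> a \<otimes> r \<in> P}"
  have K: "ideal ?K R"
  proof (rule cring_idealI)
    show "\<zero> \<in> ?K" using r P.zero_closed by (auto intro!: bexI[of _ \<zero>] simp: a_minus_def)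
    fix s t assume "s \<in> ?K" "t \<in> ?K"
    then obtain a b where ab: "s \<in> carrier R" "t \<in> carrier R" "a \<in> carrier R" "b \<in> carrier R"
      "s \<ominus> a \<otimes> r \<in> P" "t \<ominus> b \<otimes> r \<in> P" by blast
    have "(s \<oplus> t) \<ominus> (a \<oplus> b) \<otimes> r = (s \<ominus> a \<otimes> r) \<oplus> (t \<ominus> b \<otimes> r)"
      using ab r by (simp add: a_minus_def l_distr minus_add a_ac)
    then have "(s \<oplus> t) \<ominus> (a \<oplus> b) \<otimes> r \<in> P" using P.a_closed ab by simp
    then show "s \<oplus> t \<in> ?K" using ab by blast
  next
    fix s x assume x: "x \<in> carrier R" and "s \<in> ?K"
    then obtain a where a: "s \<in> carrier R" "a \<in> carrier R" "s \<ominus> a \<otimes> r \<in> P" by blast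
    have "x \<otimes> s \<ominus> (x \<otimes> a) \<otimes> r = x \<otimes> (s \<ominus> a \<otimes> r)"
      using a r x by (simp add: a_minus_def r_distr r_minus m_assoc)
    then have "x \<otimes> s \<ominus> (x \<otimes> a) \<otimes> r \<in> P" using P.I_l_closed a x by simp
    then show "x \<otimes> s \<in> ?K" using a x by blast
  qed blast
  have PK: "P \<subseteq> ?K"
  proof
    fix p assume p: "p \<in> P"
    then have "p \<ominus> \<zero> \<otimes> r = p" using r P.Icarr by (simp add: a_minus_def)
    then show "p \<in> ?K" using p P.Icarr by (auto intro!: bexI[of _ \<zero>])
  qed
  have "r \<ominus> \<one> \<otimes> r = \<zero>" using r by (simp add: a_minus_def r_neg)
  then have "r \<ominus> \<one> \<otimes> r \<in> P" using P.zero_closed by simp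
  then have rK: "r \<in> ?K" using r by blast
  have "?K = carrier R"
  proof (rule ccontr)
    assume "?K \<noteq> carrier R"
    then obtain Q where Q: "primeideal Q R" "?K \<subseteq> Q" using prime_above_proper_ideal K by blast
    then have "P \<subset> Q" using PK rK r by blast
    moreover define C where "C = (\<lambda>i::nat. if i = 0 then P else Q)"
    ultimately have "(\<forall>i\<le>1. primeideal (C i) R \<and> S \<subseteq> C i) \<and> (\<forall>i<1. C i \<subset> C (Suc i))"
      using P Q by auto
    then show False using chain unfolding no_prime_chain_def by blast
  qed
  then show ?thesis by blast
qed

text \<open>Below a chain of primes over J and x lies one of the finitely many primes attached to J.
  If x avoids all of these, the inclusion is strict and the chain over J becomes one step
  longer.\<close>

lemma exists_parameter:
  assumes J: "ideal J R" and \<aa>: "ideal \<aa> R"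
    and sat: "\<And>r. r \<in> carrier R \<Longrightarrow> (\<And>x. x \<in> \<aa> \<Longrightarrow> x \<otimes> r \<in> J) \<Longrightarrow> r \<in> J"
    and chain: "no_prime_chain R (Suc n) J"
  shows "\<exists>x\<in>\<aa>. no_prime_chain R n (insert x J)"
proof -
  obtain F where F: "finite F" "\<forall>Q\<in>F. primeideal Q R \<and> J \<subseteq> Q \<and> \<not> \<aa> \<subseteq> Q"
    "\<forall>P. primeideal P R \<and> J \<subseteq> P \<longrightarrow> (\<exists>Q\<in>F. Q \<subseteq> P)"
    using primes_over_saturated_ideal[OF J \<aa> sat] by auto
  obtain x where x: "x \<in> \<aa>" "\<forall>Q\<in>F. x \<notin> Q"
    using prime_avoidance[OF \<aa> F(1)] F(2) by blast
  have "no_prime_chain R n (insert x J)"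
    unfolding no_prime_chain_def
  proof
    assume "\<exists>P. (\<forall>i\<le>n. primeideal (P i) R \<and> insert x J \<subseteq> P i) \<and> (\<forall>i<n. P i \<subset> P (Suc i))"
    then obtain P where P: "\<forall>i\<le>n. primeideal (P i) R \<and> insert x J \<subseteq> P i" "\<forall>i<n. P i \<subset> P (Suc i)"
      by blast
    obtain Q where Q: "Q \<in> F" "Q \<subseteq> P 0" using F(3) P(1) by blast
    then have QP: "Q \<subset> P 0" using x(2) P(1) by blast
    let ?P = "\<lambda>i. case i of 0 \<Rightarrow> Q | Suc j \<Rightarrow> P j"
    have "\<forall>i\<le>Suc n. primeideal (?P i) R \<and> J \<subseteq> ?P i"
      using P(1) F(2) Q(1) by (auto split: nat.split)
    moreover have "\<forall>i<Suc n. ?P i \<subset> ?P (Suc i)"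
      using P(2) QP by (auto split: nat.split)
    ultimately show False using chain unfolding no_prime_chain_def by blast
  qed
  then show ?thesis using x(1) by blast
qed

end

section \<open>Torsion modules of small dimension\<close>

context resolution_module
begin

lemma noetherian_cring_R: "noetherian_cring R"
  by (intro noetherian_cring.intro cring_R noetherian_R)

text \<open>The annihilator of Z/H.\<close>

definition col :: "'m set \<Rightarrow> 'm set \<Rightarrow> 'a set"
  where "col H Z = {r \<in> carrier R. \<forall>z\<in>Z. r \<odot>\<^bsub>M\<^esub> z \<in> H}"

text \<open>Torsion is tested on one element of \<aa> at a time, the form that the support condition
  yields. As \<aa> is finitely generated, this is the same as every element of Z/H being killed by a
  power of \<aa>.\<close>

definition tors :: "'m set \<Rightarrow> 'm set \<Rightarrow> bool"
  where "tors H Z \<longleftrightarrow> (\<forall>z\<in>Z. \<forall>x\<in>\<aa>. \<exists>k::nat. (x [^]\<^bsub>R\<^esub> k) \<odot>\<^bsub>M\<^esub> z \<in> H)"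

lemma ideal_col:
  assumes H: "submodule H R M" and Z: "Z \<subseteq> carrier M"
  shows "ideal (col H Z) R"
proof (rule cring.cring_idealI[OF cring_R])
  fix a b assume "a \<in> col H Z" "b \<in> col H Z"
  then show "a \<oplus>\<^bsub>R\<^esub> b \<in> col H Z"
    using submodule_closed(3)[OF H] Z by (auto simp: col_def smult_l_distr subset_iff)
next
  fix a x assume "a \<in> col H Z" "x \<in> carrier R"
  then show "x \<otimes>\<^bsub>R\<^esub> a \<in> col H Z"
    using submodule_closed(2)[OF H] Z by (auto simp: col_def smult_assoc1 subset_iff)
qed (use submodule_zero[OF H] Z in \<open>auto simp: col_def subset_iff\<close>)

lemma col_mono: "H \<subseteq> H' \<Longrightarrow> Z' \<subseteq> Z \<Longrightarrow> col H Z \<subseteq> col H' Z'"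
  unfolding col_def by blast

lemma \<aa>_carrier: "x \<in> \<aa> \<Longrightarrow> x \<in> carrier R"
  using ideal.Icarr[OF ideal_\<aa>] .

lemma tors_mono: "tors H Z \<Longrightarrow> H \<subseteq> H' \<Longrightarrow> Z' \<subseteq> Z \<Longrightarrow> tors H' Z'"
  unfolding tors_def by blast

text \<open>\<open>Z'/H\<close> is the part of \<open>Z/H\<close> killed by the \<open>\<aa>\<close>-saturation \<open>J\<close> of its annihilator. As \<open>J\<close> is obtained
  by finitely many steps \<open>I \<mapsto> (I : \<aa>)\<close> and \<open>(0 : \<aa>)\<close> is finitely generated, so is \<open>Z/Z'\<close>; no
  minimal prime of \<open>J\<close> contains \<open>\<aa>\<close>, so some \<open>x \<in> \<aa>\<close> avoids them all.\<close>

lemma exists_saturating_submodule: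
  assumes H: "submodule H R M" and Z: "submodule Z R M" and HZ: "H \<subseteq> Z" and E0: "fgExt M 0 H Z"
    and chain: "no_prime_chain R (Suc n) (col H Z)"
  shows "\<exists>Z' x. submodule Z' R M \<and> H \<subseteq> Z' \<and> Z' \<subseteq> Z \<and> fg_over R M Z' Z \<and> x \<in> \<aa> \<and>
    no_prime_chain R n (insert x (col H Z'))"
proof -
  interpret NC: noetherian_cring R by (rule noetherian_cring_R)
  have ZM: "Z \<subseteq> carrier M" by (rule submoduleE(1)[OF Z])
  have \<aa>R: "\<aa> \<subseteq> carrier R" using \<aa>_carrier by blast
  \<comment> \<open>\<open>J k\<close> is the colon of the annihilator of Z/H by the k-th power of
    \<aa>; at an index where the sequence is stationary it is saturated.\<close>
  define J where "J = rec_nat (col H Z) (\<lambda>_ I. {t \<in> carrier R. \<forall>s\<in>\<aa>. t \<otimes>\<^bsub>R\<^esub> s \<in> I})"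
  have J0: "J 0 = col H Z" and JS: "J (Suc k) = {t \<in> carrier R. \<forall>s\<in>\<aa>. t \<otimes>\<^bsub>R\<^esub> s \<in> J k}" for k
    by (auto simp: J_def)
  have J_ideal: "ideal (J k) R" for k
    by (induction k) (auto simp: J0 JS ideal_col[OF H ZM] R.colon_ideal[OF _ \<aa>R])
  have J_sub: "J k \<subseteq> carrier R" for k using ideal.Icarr[OF J_ideal] by blast
  have J_mono: "J k \<subseteq> J (Suc k)" for k
  proof
    fix t assume t: "t \<in> J k"
    then show "t \<in> J (Suc k)" using ideal.I_r_closed[OF J_ideal t] J_sub \<aa>R by (auto simp: JS)
  qed
  have J0_le: "col H Z \<subseteq> J k" for k
    using lift_Suc_mono_le[of J 0 k, OF J_mono] by (simp add: J0)
  define W where "W k = {z \<in> Z. \<forall>r\<in>J k. r \<odot>\<^bsub>M\<^esub> z \<in> H}" for k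
  have W: "submodule (W k) R M" for k unfolding W_def by (rule submodule_colon[OF Z H J_sub])
  have HW: "H \<subseteq> W k" for k using HZ submodule_closed(2)[OF H] J_sub unfolding W_def by blast
  let ?K = "{z \<in> Z. \<forall>r\<in>\<aa>. r \<odot>\<^bsub>M\<^esub> z \<in> H}"
  have K: "submodule ?K R M" by (rule submodule_colon[OF Z H \<aa>R])
  have HK: "H \<subseteq> ?K" using HZ submodule_closed(2)[OF H] \<aa>R by blast
  have fgK: "fg_over R M H ?K" using E0 fgExt_0_iff[OF H Z HZ] by simp
  \<comment> \<open>For j in \<open>J (Suc k)\<close> the products j r with r in \<aa> lie in
    \<open>J k\<close>, so j maps \<open>W k\<close> into \<open>?K\<close>. Finitely many such j
    generate \<open>J (Suc k)\<close> and cut \<open>W (Suc k)\<close> out of \<open>W k\<close>;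
    their common target \<open>?K\<close>/H is finitely generated by \<open>E0\<close>.\<close>
  have step: "fg_over R M (W (Suc k)) (W k)" for k
  proof -
    obtain S where S: "finite S" "S \<subseteq> J (Suc k)" "\<And>I. ideal I R \<Longrightarrow> S \<subseteq> I \<Longrightarrow> J (Suc k) \<subseteq> I"
      by (rule noetherian_ideal_fg[OF cring_R noetherian_R J_ideal]) (rule that, assumption+)
    show ?thesis
    proof (rule fg_over_family[OF module_M noetherian_module_axioms W W K H HK fgK S(1), of "\<lambda>j z. j \<odot>\<^bsub>M\<^esub> z"])
      show "(\<odot>\<^bsub>M\<^esub>) j \<in> mod_hom R M M" if "j \<in> S" for j
        using smult_hom[of j] S(2) J_sub that by blast
      show "j \<odot>\<^bsub>M\<^esub> z \<in> ?K" if j: "j \<in> S" and z: "z \<in> W k" for j z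
      proof -
        have zZ: "z \<in> Z" "z \<in> carrier M" and jR: "j \<in> carrier R"
          using z ZM j S(2) J_sub unfolding W_def by blast+
        have "r \<odot>\<^bsub>M\<^esub> (j \<odot>\<^bsub>M\<^esub> z) \<in> H" if r: "r \<in> \<aa>" for r
        proof -
          have "j \<otimes>\<^bsub>R\<^esub> r \<in> J k" using j S(2) r by (auto simp: JS)
          then have "(j \<otimes>\<^bsub>R\<^esub> r) \<odot>\<^bsub>M\<^esub> z \<in> H" using z unfolding W_def by blast
          then show ?thesis
            using smult_assoc1[OF jR \<aa>_carrier[OF r] zZ(2)] smult_smult_commute[OF \<aa>_carrier[OF r] jR zZ(2)]
            by simp
        qed
        then show ?thesis using submodule_closed(2)[OF Z jR zZ(1)] by blast
      qed
      have "{z \<in> W k. \<forall>j\<in>S. j \<odot>\<^bsub>M\<^esub> z \<in> H} \<subseteq> W (Suc k)"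
      proof
        fix z assume z: "z \<in> {z \<in> W k. \<forall>j\<in>S. j \<odot>\<^bsub>M\<^esub> z \<in> H}"
        then have zZ: "z \<in> Z" "z \<in> carrier M" using ZM unfolding W_def by blast+
        have "ideal (col H {z}) R" by (rule ideal_col[OF H]) (use zZ in simp)
        moreover have "S \<subseteq> col H {z}" using z S(2) J_sub unfolding col_def by blast
        ultimately have "J (Suc k) \<subseteq> col H {z}" by (rule S(3))
        then show "z \<in> W (Suc k)" using zZ unfolding W_def col_def by blast
      qed
      then show "fg_over R M (W (Suc k)) {z \<in> W k. \<forall>j\<in>S. j \<odot>\<^bsub>M\<^esub> z \<in> H}"
        by (rule fg_over_subset_base)
    qed
  qed
  have fgW: "fg_over R M (W k) Z" for k
  proof (induction k)
    case 0
    have "Z \<subseteq> W 0" by (auto simp: W_def J0 col_def)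
    then show ?case by (rule fg_over_subset_base)
  next
    case (Suc k)
    show ?case by (rule fg_over_trans[OF Suc step]) (auto simp: W_def)
  qed
  obtain k where k: "J (Suc k) = J k"
    using NC.ideal_ascending_stable[of J, OF J_ideal J_mono] by blast
  have "r \<in> J k" if r: "r \<in> carrier R" "\<And>x. x \<in> \<aa> \<Longrightarrow> x \<otimes>\<^bsub>R\<^esub> r \<in> J k" for r
  proof -
    have "r \<in> J (Suc k)" using r \<aa>_carrier by (auto simp: JS R.m_comm[of r])
    then show ?thesis using k by simp
  qed
  then obtain x where x: "x \<in> \<aa>" "no_prime_chain R n (insert x (J k))"
    using NC.exists_parameter[OF J_ideal ideal_\<aa> _ no_prime_chain_mono[OF chain J0_le]] by blast
  have "J k \<subseteq> col H (W k)" using J_sub unfolding W_def col_def by blast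
  then have "no_prime_chain R n (insert x (col H (W k)))"
    by (intro no_prime_chain_mono[OF x(2)]) blast
  moreover have "W k \<subseteq> Z" unfolding W_def by blast
  ultimately show ?thesis using W[of k] HW[of k] fgW[of k] x(1) by blast
qed

text \<open>Modulo H this submodule is killed by x in addition to the old annihilator, so a
  dimension bound for the enlarged set applies to it. \<open>insert_col_scaled\<close> does the same
  for Z/(xZ + H).\<close>

lemma insert_col_torsion:
  "x \<in> carrier R \<Longrightarrow> insert x (col H Z) \<subseteq> col H {z \<in> Z. x \<odot>\<^bsub>M\<^esub> z \<in> H}"
  unfolding col_def by blast

lemma insert_col_scaled:
  assumes "x \<in> carrier R" "submodule H R M" "submodule Z R M" "H \<subseteq> Z"
  shows "insert x (col H Z) \<subseteq> col (scaled x H Z) Z"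
  using smult_mem_scaled[OF assms(1-3)] scaled_subset(1)[OF assms] assms(1)
  unfolding col_def by blast

lemma submodule_torsion:
  assumes "x \<in> carrier R" "submodule H R M" "submodule Z R M"
  shows "submodule {z \<in> Z. x \<odot>\<^bsub>M\<^esub> z \<in> H} R M"
  by (rule submodule_vimage[OF module_M module_M smult_hom[OF assms(1)] assms(3,2)])

text \<open>For the parameter x no prime lies over the annihilator of (0 : x), so x acts injectively
  on Z'/H. Torsion then forces Z' = H, and Z/Z' is finitely generated.\<close>

lemma fg_over_of_dim_0:
  assumes H: "submodule H R M" and Z: "submodule Z R M" and HZ: "H \<subseteq> Z" and E0: "fgExt M 0 H Z"
    and chain: "no_prime_chain R 1 (col H Z)" and tors: "tors H Z"
  shows "fg_over R M H Z"
proof -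
  interpret NC: noetherian_cring R by (rule noetherian_cring_R)
  have "\<exists>Z' x. submodule Z' R M \<and> H \<subseteq> Z' \<and> Z' \<subseteq> Z \<and> fg_over R M Z' Z \<and> x \<in> \<aa> \<and>
    no_prime_chain R 0 (insert x (col H Z'))"
    by (rule exists_saturating_submodule[OF H Z HZ E0]) (use chain in simp)
  then obtain Z' x where *: "submodule Z' R M" "H \<subseteq> Z'" "Z' \<subseteq> Z" "fg_over R M Z' Z" "x \<in> \<aa>"
    "no_prime_chain R 0 (insert x (col H Z'))" by blast
  have xR: "x \<in> carrier R" by (rule \<aa>_carrier[OF *(5)])
  let ?T = "{z \<in> Z'. x \<odot>\<^bsub>M\<^esub> z \<in> H}"
  have T: "?T \<subseteq> carrier M" using submodule_mem[OF *(1)] by blast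
  have "col H ?T = carrier R"
    by (rule NC.no_prime_chain_0[OF *(6) ideal_col[OF H T] insert_col_torsion[OF xR]])
  then have "\<one>\<^bsub>R\<^esub> \<in> col H ?T" by simp
  then have TH: "?T \<subseteq> H" using T by (auto simp: col_def subset_iff)
  have "z \<in> H" if "z \<in> Z'" "(x [^]\<^bsub>R\<^esub> (k::nat)) \<odot>\<^bsub>M\<^esub> z \<in> H" for z k
    using that
  proof (induction k arbitrary: z)
    case 0
    then show ?case using submodule_mem[OF *(1)] by simp
  next
    case (Suc k)
    have zM: "z \<in> carrier M" using submodule_mem[OF *(1) Suc.prems(1)] .
    have "(x [^]\<^bsub>R\<^esub> k) \<odot>\<^bsub>M\<^esub> (x \<odot>\<^bsub>M\<^esub> z) \<in> H"
      using Suc.prems(2) xR zM by (simp add: smult_assoc1)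
    then have "x \<odot>\<^bsub>M\<^esub> z \<in> H"
      by (rule Suc.IH[OF submodule_closed(2)[OF *(1) xR Suc.prems(1)]])
    then show ?case using TH Suc.prems(1) by blast
  qed
  then have "Z' \<subseteq> H" using tors *(3,5) unfolding tors_def by blast
  then show ?thesis by (rule fg_over_mono_base[OF *(4)])
qed

text \<open>The quotient Z/Z' is finitely generated, hence so are all its Ext groups, and the long
  exact sequence sees no difference between Z and Z'. The word cofinite in the name refers to this
  quotient.\<close>

lemma fgExt_cofinite_sub:
  assumes H: "submodule H R M" and Z': "submodule Z' R M" and Z: "submodule Z R M"
    and HZ: "H \<subseteq> Z'" "Z' \<subseteq> Z" and fg: "fg_over R M Z' Z"
  shows "fgExt M n H Z \<longleftrightarrow> fgExt M n H Z'"
proof -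
  have E: "fgExt M k Z' Z" for k by (rule fgExt_of_fg_over[OF Z' Z HZ(2) fg])
  show ?thesis
  proof
    assume "fgExt M n H Z"
    then show "fgExt M n H Z'"
      using fgExt_0_left[OF H Z' Z HZ] fgExt_left[OF H Z' Z HZ E] by (cases n) auto
  next
    assume "fgExt M n H Z'"
    then show "fgExt M n H Z" by (rule fgExt_middle[OF H Z' Z HZ _ E])
  qed
qed

text \<open>Induction on the annihilator I of s modulo S, in place of a composition series. If I is
  prime, it is maximal by \<open>chain\<close>, so (Rs + S)/S is simple. If u v lies in I with u, v
  outside, the step is split through S + Rus, and both halves have larger annihilators.\<close>

lemma descending_stable_adjoin:
  assumes H: "submodule H R M" and T: "submodule T R M"
    and chain: "no_prime_chain R 1 (col H T)"
    and D: "\<And>k::nat. submodule (D k) R M" and D_dec: "\<And>k. D (Suc k) \<subseteq> D k"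
    and S: "submodule S R M" "H \<subseteq> S" and s: "s \<in> T"
    and stable: "\<exists>k0. \<forall>k\<ge>k0. D k \<inter> S \<subseteq> D (Suc k)"
  shows "\<exists>k0. \<forall>k\<ge>k0. D k \<inter> adjoin R M S s \<subseteq> D (Suc k)"
proof -
  interpret NC: noetherian_cring R by (rule noetherian_cring_R)
  have TM: "t \<in> T \<Longrightarrow> t \<in> carrier M" for t using submodule_mem[OF T] .
  have ideal_S: "ideal (col S {s}) R" if "submodule S R M" "s \<in> T" for S s
    by (rule ideal_col[OF that(1)]) (use TM that in auto)
  \<comment> \<open>S and s change during the induction, so both are quantified inside the statement
    about I.\<close>
  have "\<forall>S s. submodule S R M \<and> H \<subseteq> S \<and> s \<in> T \<and> I = col S {s} \<and> (\<exists>k0. \<forall>k\<ge>k0. D k \<inter> S \<subseteq> D (Suc k))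
      \<longrightarrow> (\<exists>k0. \<forall>k\<ge>k0. D k \<inter> adjoin R M S s \<subseteq> D (Suc k))" if "ideal I R" for I
    using that
  proof (induction rule: NC.ideal_noetherian_induct)
    case (less I)
    interpret I: ideal I R by fact
    show ?case
    proof (intro allI impI, elim conjE)
      fix S s assume S: "submodule S R M" "H \<subseteq> S" and s: "s \<in> T" and I: "I = col S {s}"
        and stable: "\<exists>k0. \<forall>k\<ge>k0. D k \<inter> S \<subseteq> D (Suc k)"
      have sM: "s \<in> carrier M" using TM s .
      have SM: "t \<in> S \<Longrightarrow> t \<in> carrier M" for t using submodule_mem[OF S(1)] .
      have I_iff: "r \<in> I \<longleftrightarrow> r \<in> carrier R \<and> r \<odot>\<^bsub>M\<^esub> s \<in> S" for r unfolding I col_def by simp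
      obtain k0 where k0: "\<And>k. k \<ge> k0 \<Longrightarrow> D k \<inter> S \<subseteq> D (Suc k)" using stable by blast
      note adj = submodule_adjoin[OF S(1)]
      show "\<exists>k0. \<forall>k\<ge>k0. D k \<inter> adjoin R M S s \<subseteq> D (Suc k)"
      proof (cases "carrier R = I")
        case True
        then have "\<one>\<^bsub>R\<^esub> \<odot>\<^bsub>M\<^esub> s \<in> S" using I_iff by blast
        then have "s \<in> S" using sM by simp
        then have "adjoin R M S s \<subseteq> S" by (intro adjoin_least[OF S(1)]) auto
        then show ?thesis using k0 by (intro exI[of _ k0]) blast
      next
        case proper: False
        show ?thesis
        proof (cases "primeideal I R")
          case True
          have colI: "col H T \<subseteq> I" unfolding I by (rule col_mono[OF S(2)]) (use s in simp)
          show ?thesis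
          \<comment> \<open>By simplicity of (Rs + S)/S either some \<open>D k1\<close> meets Rs + S
            inside S, and stability on S decides, or each later D contains an element w that
            generates Rs + S modulo S.\<close>
          proof (cases "\<exists>k1\<ge>k0. D k1 \<inter> adjoin R M S s \<subseteq> S")
            case True
            then obtain k1 where k1: "k1 \<ge> k0" "D k1 \<inter> adjoin R M S s \<subseteq> S" by blast
            have "D k \<inter> adjoin R M S s \<subseteq> D (Suc k)" if "k \<ge> k1" for k
            proof -
              have "D k \<subseteq> D k1" using lift_Suc_antimono_le[of D, OF D_dec that] .
              then show ?thesis using k1 k0[of k] that by fastforce
            qed
            then show ?thesis by blast
          next
            case False
            have "D k \<inter> adjoin R M S s \<subseteq> D (Suc k)" if k: "k \<ge> k0" for k
            proof
              fix y assume y: "y \<in> D k \<inter> adjoin R M S s"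
              have "Suc k \<ge> k0" using k by simp
              then obtain w where w: "w \<in> D (Suc k)" "w \<in> adjoin R M S s" "w \<notin> S"
                using False by blast
              obtain r t where rt: "w = r \<odot>\<^bsub>M\<^esub> s \<oplus>\<^bsub>M\<^esub> t" "r \<in> carrier R" "t \<in> S"
                using w(2) unfolding adjoin_def by blast
              have "r \<notin> I" using w(3) rt submodule_closed(3)[OF S(1)] I_iff by blast
              then obtain a where a: "a \<in> carrier R" "\<one>\<^bsub>R\<^esub> \<ominus>\<^bsub>R\<^esub> a \<otimes>\<^bsub>R\<^esub> r \<in> I"
                using NC.no_prime_chain_1_inverse[OF chain \<open>primeideal I R\<close> colI rt(2)] by blast
              obtain r' t' where rt': "y = r' \<odot>\<^bsub>M\<^esub> s \<oplus>\<^bsub>M\<^esub> t'" "r' \<in> carrier R" "t' \<in> S"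
                using y unfolding adjoin_def by blast
              \<comment> \<open>As a inverts r modulo I, the multiple r' a w has the same
                coefficient at s as y up to I, so y - r' a w lies in S, where stability is
                known.\<close>
              let ?c = "r' \<otimes>\<^bsub>R\<^esub> a"
              have c: "?c \<in> carrier R" using rt' a by simp
              have "(\<one>\<^bsub>R\<^esub> \<ominus>\<^bsub>R\<^esub> a \<otimes>\<^bsub>R\<^esub> r) \<odot>\<^bsub>M\<^esub> s = s \<ominus>\<^bsub>M\<^esub> (a \<otimes>\<^bsub>R\<^esub> r) \<odot>\<^bsub>M\<^esub> s"
                using a rt(2) sM by (simp add: a_minus_def smult_l_distr smult_l_minus)
              then have "s \<ominus>\<^bsub>M\<^esub> (a \<otimes>\<^bsub>R\<^esub> r) \<odot>\<^bsub>M\<^esub> s \<in> S" using a(2) I_iff by simp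
              then have "r' \<odot>\<^bsub>M\<^esub> (s \<ominus>\<^bsub>M\<^esub> (a \<otimes>\<^bsub>R\<^esub> r) \<odot>\<^bsub>M\<^esub> s) \<in> S"
                using submodule_closed(2)[OF S(1) rt'(2)] by blast
              moreover have "r' \<odot>\<^bsub>M\<^esub> (s \<ominus>\<^bsub>M\<^esub> (a \<otimes>\<^bsub>R\<^esub> r) \<odot>\<^bsub>M\<^esub> s) = r' \<odot>\<^bsub>M\<^esub> s \<ominus>\<^bsub>M\<^esub> ?c \<odot>\<^bsub>M\<^esub> (r \<odot>\<^bsub>M\<^esub> s)"
                using a rt(2) rt'(2) sM by (simp add: smult_minus_distr smult_assoc1)
              moreover have "t' \<ominus>\<^bsub>M\<^esub> ?c \<odot>\<^bsub>M\<^esub> t \<in> S"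
                using submodule_minus[OF S(1) rt'(3) submodule_closed(2)[OF S(1) c rt(3)]] .
              ultimately have "(r' \<odot>\<^bsub>M\<^esub> s \<ominus>\<^bsub>M\<^esub> ?c \<odot>\<^bsub>M\<^esub> (r \<odot>\<^bsub>M\<^esub> s)) \<oplus>\<^bsub>M\<^esub> (t' \<ominus>\<^bsub>M\<^esub> ?c \<odot>\<^bsub>M\<^esub> t) \<in> S"
                using submodule_closed(3)[OF S(1)] by simp
              moreover have "y \<ominus>\<^bsub>M\<^esub> ?c \<odot>\<^bsub>M\<^esub> w = (r' \<odot>\<^bsub>M\<^esub> s \<ominus>\<^bsub>M\<^esub> ?c \<odot>\<^bsub>M\<^esub> (r \<odot>\<^bsub>M\<^esub> s)) \<oplus>\<^bsub>M\<^esub> (t' \<ominus>\<^bsub>M\<^esub> ?c \<odot>\<^bsub>M\<^esub> t)"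
                unfolding rt(1) rt'(1) using rt(2,3) rt'(2,3) c sM SM
                by (simp add: smult_r_distr minus_add_distrib4)
              ultimately have yS: "y \<ominus>\<^bsub>M\<^esub> ?c \<odot>\<^bsub>M\<^esub> w \<in> S" by simp
              have cw: "?c \<odot>\<^bsub>M\<^esub> w \<in> D (Suc k)" by (rule submodule_closed(2)[OF D c w(1)])
              then have "y \<ominus>\<^bsub>M\<^esub> ?c \<odot>\<^bsub>M\<^esub> w \<in> D k"
                using y D_dec[of k] submodule_minus[OF D[of k]] by blast
              then have "y \<ominus>\<^bsub>M\<^esub> ?c \<odot>\<^bsub>M\<^esub> w \<in> D (Suc k)" using yS k0[OF k] by blast
              then show "y \<in> D (Suc k)"
                using submodule_minus_cancel[OF D _ cw] submodule_mem[OF D] y by blast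
            qed
            then show ?thesis by blast
          qed
        next
          case False
          obtain u v where uv: "u \<in> carrier R" "v \<in> carrier R" "u \<otimes>\<^bsub>R\<^esub> v \<in> I" "u \<notin> I" "v \<notin> I"
            using I.primeidealCD[OF cring_R False] proper by blast
          let ?us = "u \<odot>\<^bsub>M\<^esub> s"
          have us: "?us \<in> T" "?us \<in> carrier M" using submodule_closed(2)[OF T uv(1) s] uv(1) sM by auto
          let ?S1 = "adjoin R M S ?us"
          have S1: "submodule ?S1 R M" by (rule adj[OF us(2)])
          have SS1: "S \<subseteq> ?S1" by (rule subset_adjoin[OF S(1) us(2)])
          have "I \<subseteq> col S {?us}"
          proof
            fix r assume "r \<in> I"
            then have r: "r \<in> carrier R" "r \<odot>\<^bsub>M\<^esub> s \<in> S" using I_iff by auto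
            then show "r \<in> col S {?us}"
              using submodule_closed(2)[OF S(1) uv(1) r(2)] smult_smult_commute[OF uv(1) r(1) sM]
              by (simp add: col_def)
          qed
          moreover have "v \<in> col S {?us}"
            using uv(1,2,3) I_iff sM smult_smult_commute[of v u s] by (simp add: col_def smult_assoc1)
          ultimately have "I \<subset> col S {?us}" using uv(5) by blast
          then have st1: "\<exists>k0. \<forall>k\<ge>k0. D k \<inter> ?S1 \<subseteq> D (Suc k)"
            using less.IH[OF ideal_S[OF S(1) us(1)]] S us(1) stable by blast
          have "I \<subseteq> col ?S1 {s}" unfolding I by (rule col_mono[OF SS1]) simp
          moreover have "u \<in> col ?S1 {s}"
            using uv(1) mem_adjoin[OF S(1) us(2)] by (simp add: col_def)
          ultimately have "I \<subset> col ?S1 {s}" using uv(4) by blast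
          then have "\<exists>k0. \<forall>k\<ge>k0. D k \<inter> adjoin R M ?S1 s \<subseteq> D (Suc k)"
            using less.IH[OF ideal_S[OF S1 s]] S1 SS1 S(2) s st1 by blast
          moreover have "adjoin R M S s \<subseteq> adjoin R M ?S1 s"
            using SS1 unfolding adjoin_def by blast
          ultimately show ?thesis by blast
        qed
      qed
    qed
  qed
  then show ?thesis using ideal_S[OF S(1) s] S s stable by blast
qed

text \<open>A finitely generated module whose annihilator has dimension at most 0 is artinian.
  Intersections with T are compared because the \<open>D k\<close> need not lie in T.\<close>

lemma descending_stable:
  assumes H: "submodule H R M" and T: "submodule T R M" and fg: "fg_over R M H T"
    and chain: "no_prime_chain R 1 (col H T)"
    and D: "\<And>k::nat. submodule (D k) R M" "\<And>k. H \<subseteq> D k" "\<And>k. D (Suc k) \<subseteq> D k"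
  shows "\<exists>k0. \<forall>k\<ge>k0. D k \<inter> T \<subseteq> D (Suc k)"
proof -
  have "\<exists>S. submodule S R M \<and> T \<subseteq> S \<and> (H \<subseteq> S \<and> (\<exists>k0. \<forall>k\<ge>k0. D k \<inter> S \<subseteq> D (Suc k)))"
  proof (rule fg_over_induct[OF fg H submoduleE(1)[OF T]])
    show "H \<subseteq> H \<and> (\<exists>k0. \<forall>k\<ge>k0. D k \<inter> H \<subseteq> D (Suc k))" using D(2) by blast
    fix S s assume S: "submodule S R M" "H \<subseteq> S" and s: "s \<in> T"
      and Q: "H \<subseteq> S \<and> (\<exists>k0. \<forall>k\<ge>k0. D k \<inter> S \<subseteq> D (Suc k))"
    have "\<exists>k0. \<forall>k\<ge>k0. D k \<inter> adjoin R M S s \<subseteq> D (Suc k)"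
      using descending_stable_adjoin[of H T D S s] H T chain D(1,3) S s Q by blast
    moreover have "H \<subseteq> adjoin R M S s"
      using S subset_adjoin[OF S(1) submodule_mem[OF T s]] by blast
    ultimately show "H \<subseteq> adjoin R M S s \<and> (\<exists>k0. \<forall>k\<ge>k0. D k \<inter> adjoin R M S s \<subseteq> D (Suc k))" by blast
  qed
  then show ?thesis by blast
qed

end

context resolution_module
begin

text \<open>\<open>T = (0 : x)\<close> has finite length, hence \<open>T \<inter> x\<^sup>kZ'\<close> is constant for \<open>k \<ge> k\<^sub>0\<close>. Modulo \<open>xZ'\<close> every
  element can then be moved into \<open>(0 : x\<^sup>k)\<close> with \<open>k = k\<^sub>0\<close>, so that \<open>Z'/xZ'\<close> is finitely generated.\<close>

lemma fgExt_of_dim_1: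
  assumes H: "submodule H R M" and Z: "submodule Z R M" and HZ: "H \<subseteq> Z" and E0: "fgExt M 0 H Z"
    and chain: "no_prime_chain R 2 (col H Z)" and tors: "tors H Z"
  shows "fgExt M n H Z"
proof -
  have "\<exists>Z' x. submodule Z' R M \<and> H \<subseteq> Z' \<and> Z' \<subseteq> Z \<and> fg_over R M Z' Z \<and> x \<in> \<aa> \<and>
    no_prime_chain R 1 (insert x (col H Z'))"
    by (rule exists_saturating_submodule[OF H Z HZ E0]) (use chain in \<open>simp add: numeral_2_eq_2\<close>)
  then obtain Z' x where *: "submodule Z' R M" "H \<subseteq> Z'" "Z' \<subseteq> Z" "fg_over R M Z' Z" "x \<in> \<aa>"
    "no_prime_chain R 1 (insert x (col H Z'))" by blast
  note Z' = *(1) and HZ' = *(2)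
  have xR: "x \<in> carrier R" by (rule \<aa>_carrier[OF *(5)])
  have Z'M: "z \<in> Z' \<Longrightarrow> z \<in> carrier M" for z using submodule_mem[OF Z'] .
  have tors': "tors H Z'" by (rule tors_mono[OF tors _ *(3)]) simp
  let ?T = "{z \<in> Z'. x \<odot>\<^bsub>M\<^esub> z \<in> H}" and ?Q = "scaled x H Z'"
  note T = submodule_torsion[OF xR H Z'] and Q = submodule_scaled[OF xR H Z']
  note HQ = scaled_subset[OF xR H Z' HZ']
  have HT: "H \<subseteq> ?T" using HZ' submodule_closed(2)[OF H xR] by blast
  have chainT: "no_prime_chain R 1 (col H ?T)"
    by (rule no_prime_chain_mono[OF *(6) insert_col_torsion[OF xR]])
  have "fgExt M 0 H ?T"
    by (rule fgExt_0_left[OF H T Z HT _ E0]) (use *(3) in blast)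
  moreover have "tors H ?T" by (rule tors_mono[OF tors']) auto
  ultimately have fgT: "fg_over R M H ?T" by (intro fg_over_of_dim_0[OF H T HT _ chainT])
  define xp where "xp k = x [^]\<^bsub>R\<^esub> k" for k :: nat
  have xpR: "xp k \<in> carrier R" for k using xR by (simp add: xp_def)
  have xp_0: "xp 0 \<odot>\<^bsub>M\<^esub> z = z" if "z \<in> carrier M" for z using that by (simp add: xp_def)
  have xp_Suc: "xp (Suc k) \<odot>\<^bsub>M\<^esub> z = x \<odot>\<^bsub>M\<^esub> (xp k \<odot>\<^bsub>M\<^esub> z)" "xp (Suc k) \<odot>\<^bsub>M\<^esub> z = xp k \<odot>\<^bsub>M\<^esub> (x \<odot>\<^bsub>M\<^esub> z)"
    if "z \<in> carrier M" for k z
    using that xR xpR smult_smult_commute[OF xR xpR that, of k] by (simp_all add: xp_def smult_assoc1)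
  let ?Tk = "\<lambda>k. {z \<in> Z'. xp k \<odot>\<^bsub>M\<^esub> z \<in> H}"
  \<comment> \<open>Multiplication by \<open>x^k\<close> maps (0 : \<open>x^(k+1)\<close>) to the
    finitely generated (0 : x), with kernel (0 : \<open>x^k\<close>).\<close>
  have fgTk: "fg_over R M H (?Tk k)" for k
  proof (induction k)
    case 0
    have "?Tk 0 \<subseteq> H" using xp_0 Z'M by auto
    then show ?case by (rule fg_over_subset_base)
  next
    case (Suc k)
    show ?case
    proof (rule fg_over_exact[OF module_M noetherian_module_axioms smult_hom[OF xpR]
          submodule_torsion[OF xpR H Z'] H T H _ fgT HT])
      show "(\<odot>\<^bsub>M\<^esub>) (xp k) ` ?Tk (Suc k) \<subseteq> ?T"
        using xp_Suc(1) Z'M submodule_closed(2)[OF Z' xpR] by auto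
      have "{z \<in> ?Tk (Suc k). xp k \<odot>\<^bsub>M\<^esub> z \<in> H} = ?Tk k"
        using xp_Suc(1) Z'M submodule_closed(2)[OF H xR] by auto
      then show "fg_over R M H {z \<in> ?Tk (Suc k). xp k \<odot>\<^bsub>M\<^esub> z \<in> H}" using Suc by simp
    qed
  qed
  define D where "D k = scaled (xp k) H Z'" for k
  have "\<exists>k0. \<forall>k\<ge>k0. D k \<inter> ?T \<subseteq> D (Suc k)"
  proof (rule descending_stable[OF H T fgT chainT])
    fix k
    show "submodule (D k) R M" unfolding D_def by (rule submodule_scaled[OF xpR H Z'])
    show "H \<subseteq> D k" unfolding D_def by (rule scaled_subset(1)[OF xpR H Z' HZ'])
    show "D (Suc k) \<subseteq> D k"
    proof
      fix y assume "y \<in> D (Suc k)"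
      then obtain z where z: "y \<in> carrier M" "z \<in> Z'" "y \<ominus>\<^bsub>M\<^esub> xp (Suc k) \<odot>\<^bsub>M\<^esub> z \<in> H"
        unfolding D_def scaled_def by blast
      then have "y \<ominus>\<^bsub>M\<^esub> xp k \<odot>\<^bsub>M\<^esub> (x \<odot>\<^bsub>M\<^esub> z) \<in> H" using xp_Suc(2) Z'M by simp
      then show "y \<in> D k"
        unfolding D_def scaled_def using z(1) submodule_closed(2)[OF Z' xR z(2)] by blast
    qed
  qed
  then obtain k0 where k0: "\<And>k. k \<ge> k0 \<Longrightarrow> D k \<inter> ?T \<subseteq> D (Suc k)" by blast
  \<comment> \<open>Let k = k0 + j and let \<open>x^(k+1)\<close> kill z modulo H. Then
    \<open>x^k z\<close> lies in both T and \<open>D k\<close>, so stability gives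
    \<open>x^k z = x^(k+1) z'\<close> modulo H. Replacing z by z - x z' lowers the exponent and
    keeps the class modulo xZ'.\<close>
  have split: "\<exists>w\<in>?Tk k0. z \<ominus>\<^bsub>M\<^esub> w \<in> ?Q" if "z \<in> Z'" "xp (k0 + j) \<odot>\<^bsub>M\<^esub> z \<in> H" for j z
    using that
  proof (induction j arbitrary: z)
    case 0
    then show ?case
      using submodule_zero[OF Q] Z'M by (intro bexI[of _ z]) (auto simp: minus_self)
  next
    case (Suc j)
    let ?k = "k0 + j"
    have z: "z \<in> Z'" "z \<in> carrier M" using Suc.prems Z'M by auto
    have t: "xp ?k \<odot>\<^bsub>M\<^esub> z \<in> ?T"
      using Suc.prems xp_Suc(1)[OF z(2)] submodule_closed(2)[OF Z' xpR z(1)] by auto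
    have "xp ?k \<odot>\<^bsub>M\<^esub> z \<in> D ?k"
      unfolding D_def by (rule smult_mem_scaled[OF xpR H Z' z(1)])
    then have "xp ?k \<odot>\<^bsub>M\<^esub> z \<in> D (Suc ?k)" using t k0[of ?k] by auto
    then obtain z' where z': "z' \<in> Z'" "xp ?k \<odot>\<^bsub>M\<^esub> z \<ominus>\<^bsub>M\<^esub> xp (Suc ?k) \<odot>\<^bsub>M\<^esub> z' \<in> H"
      unfolding D_def scaled_def by blast
    have z'M: "z' \<in> carrier M" "x \<odot>\<^bsub>M\<^esub> z' \<in> carrier M" using Z'M[OF z'(1)] xR by auto
    have z2: "z \<ominus>\<^bsub>M\<^esub> x \<odot>\<^bsub>M\<^esub> z' \<in> Z'"
      using submodule_minus[OF Z' z(1) submodule_closed(2)[OF Z' xR z'(1)]] .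
    have "xp ?k \<odot>\<^bsub>M\<^esub> (z \<ominus>\<^bsub>M\<^esub> x \<odot>\<^bsub>M\<^esub> z') \<in> H"
      using z'(2) xp_Suc(2)[OF z'M(1)] by (simp add: smult_minus_distr[OF xpR z(2) z'M(2)])
    then obtain w where w: "w \<in> ?Tk k0" "(z \<ominus>\<^bsub>M\<^esub> x \<odot>\<^bsub>M\<^esub> z') \<ominus>\<^bsub>M\<^esub> w \<in> ?Q" using Suc.IH[OF z2] by blast
    have wM: "w \<in> carrier M" using w(1) Z'M by blast
    have "(z \<ominus>\<^bsub>M\<^esub> x \<odot>\<^bsub>M\<^esub> z') \<ominus>\<^bsub>M\<^esub> w \<oplus>\<^bsub>M\<^esub> x \<odot>\<^bsub>M\<^esub> z' \<in> ?Q"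
      by (rule submodule_closed(3)[OF Q w(2) smult_mem_scaled[OF xR H Z' z'(1)]])
    moreover have "(z \<ominus>\<^bsub>M\<^esub> x \<odot>\<^bsub>M\<^esub> z') \<ominus>\<^bsub>M\<^esub> w \<oplus>\<^bsub>M\<^esub> x \<odot>\<^bsub>M\<^esub> z' = (z \<ominus>\<^bsub>M\<^esub> w) \<ominus>\<^bsub>M\<^esub> x \<odot>\<^bsub>M\<^esub> z' \<oplus>\<^bsub>M\<^esub> x \<odot>\<^bsub>M\<^esub> z'"
      using z(2) z'M(2) wM by (simp add: a_minus_def M.a_ac)
    moreover have "\<dots> = z \<ominus>\<^bsub>M\<^esub> w" using z(2) z'M(2) wM by (intro minus_add_cancel) auto
    ultimately have "z \<ominus>\<^bsub>M\<^esub> w \<in> ?Q" by simp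
    then show ?case using w(1) by blast
  qed
  \<comment> \<open>Torsion supplies an exponent for each z, so by \<open>split\<close> the finitely
    generated (0 : \<open>x^k0\<close>) maps onto Z'/(xZ' + H).\<close>
  have fgQ: "fg_over R M ?Q Z'"
  proof (rule fg_over_image[OF module_M module_M id_hom submodule_torsion[OF xpR H Z'] Q _ _ _ _ fgTk])
    show "Z' \<subseteq> carrier M" using Z'M by blast
    show "(\<lambda>m. m) ` ?Tk k0 \<subseteq> Z'" "(\<lambda>m. m) ` (H \<inter> ?Tk k0) \<subseteq> ?Q" using HQ(1) by auto
    show "H \<subseteq> ?Tk k0" using HZ' submodule_closed(2)[OF H xpR] by blast
    fix z assume z: "z \<in> Z'"
    then obtain m where m: "xp m \<odot>\<^bsub>M\<^esub> z \<in> H"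
      using tors' *(5) unfolding tors_def xp_def by blast
    have "xp (k0 + m) \<odot>\<^bsub>M\<^esub> z = xp k0 \<odot>\<^bsub>M\<^esub> (xp m \<odot>\<^bsub>M\<^esub> z)"
      using xpR Z'M[OF z] xR unfolding xp_def by (simp add: R.nat_pow_mult[symmetric] smult_assoc1)
    then have "xp (k0 + m) \<odot>\<^bsub>M\<^esub> z \<in> H" using submodule_closed(2)[OF H xpR m] by simp
    then show "\<exists>w\<in>?Tk k0. z \<ominus>\<^bsub>M\<^esub> w \<in> ?Q" by (rule split[OF z])
  qed
  have "fgExt M n H Z'"
    by (rule fgExt_of_torsion_and_quotient[OF H Z' HZ' *(5) fgExt_of_fg_over[OF H T HT fgT]
          fgExt_of_fg_over[OF Q Z' HQ(2) fgQ]])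
  then show ?thesis using fgExt_cofinite_sub[OF H Z' Z HZ' *(3,4)] by simp
qed

text \<open>Multiplication by x identifies Z/(0 : x) with xZ, everything modulo H. Ext of xZ thereby
  becomes accessible from the sequence of (0 : x) in Z.\<close>

lemma fgExt_scaled:
  assumes x: "x \<in> carrier R" and H: "submodule H R M" and Z: "submodule Z R M" and HZ: "H \<subseteq> Z"
  shows "fgExt M n {z \<in> Z. x \<odot>\<^bsub>M\<^esub> z \<in> H} Z \<longleftrightarrow> fgExt M n H (scaled x H Z)"
proof (rule fgExt_iso[OF module_M module_M smult_hom[OF x] Z submodule_torsion[OF x H Z]
      submodule_scaled[OF x H Z] H])
  show "H \<subseteq> scaled x H Z" by (rule scaled_subset(1)[OF x H Z HZ])
  show "(\<odot>\<^bsub>M\<^esub>) x ` Z \<subseteq> scaled x H Z" using smult_mem_scaled[OF x H Z] by blast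
qed (auto simp: scaled_def)

text \<open>Degree 0 passes to (0 : x), whose dimension is smaller, so (0 : x) is finite in all
  degrees. Degree 1 of Z then gives degree 1 of Z/(0 : x), that is of xZ, and hence degree 0 of
  Z/xZ, which is what dimension 1 asks for.\<close>

lemma fgExt_of_dim_2:
  assumes H: "submodule H R M" and Z: "submodule Z R M" and HZ: "H \<subseteq> Z"
    and E: "fgExt M 0 H Z" "fgExt M 1 H Z"
    and chain: "no_prime_chain R 3 (col H Z)" and tors: "tors H Z"
  shows "fgExt M n H Z"
proof -
  have "\<exists>Z' x. submodule Z' R M \<and> H \<subseteq> Z' \<and> Z' \<subseteq> Z \<and> fg_over R M Z' Z \<and> x \<in> \<aa> \<and>
    no_prime_chain R 2 (insert x (col H Z'))"
    by (rule exists_saturating_submodule[OF H Z HZ E(1)]) (use chain in \<open>simp add: eval_nat_numeral\<close>)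
  then obtain Z' x where *: "submodule Z' R M" "H \<subseteq> Z'" "Z' \<subseteq> Z" "fg_over R M Z' Z" "x \<in> \<aa>"
    "no_prime_chain R 2 (insert x (col H Z'))" by blast
  note Z' = *(1) and HZ' = *(2)
  note sub = fgExt_cofinite_sub[OF H Z' Z HZ' *(3,4)]
  have E': "fgExt M 0 H Z'" "fgExt M (Suc 0) H Z'" using E sub by simp_all
  have xR: "x \<in> carrier R" by (rule \<aa>_carrier[OF *(5)])
  have tors': "tors H Z'" by (rule tors_mono[OF tors _ *(3)]) simp
  let ?T = "{z \<in> Z'. x \<odot>\<^bsub>M\<^esub> z \<in> H}" and ?Q = "scaled x H Z'"
  note T = submodule_torsion[OF xR H Z'] and Q = submodule_scaled[OF xR H Z']
  note HQ = scaled_subset[OF xR H Z' HZ']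
  have HT: "H \<subseteq> ?T" using HZ' submodule_closed(2)[OF H xR] by blast
  have TZ: "?T \<subseteq> Z'" by blast
  have ET: "fgExt M k H ?T" for k
    by (rule fgExt_of_dim_1[OF H T HT fgExt_0_left[OF H T Z' HT TZ E'(1)]
          no_prime_chain_mono[OF *(6) insert_col_torsion[OF xR]] tors_mono[OF tors' _ TZ]]) simp
  have "fgExt M k ?T Z'" if "fgExt M k H Z'" for k
    by (rule fgExt_right[OF H T Z' HT TZ that ET])
  then have "fgExt M 1 H ?Q" using fgExt_scaled[OF xR H Z' HZ'] E' by simp
  then have "fgExt M 0 ?Q Z'" by (intro fgExt_right[OF H Q Z' HQ E'(1)]) simp
  then have EQ: "fgExt M k ?Q Z'" for k
    by (rule fgExt_of_dim_1[OF Q Z' HQ(2) _ no_prime_chain_mono[OF *(6) insert_col_scaled[OF xR H Z' HZ']]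
          tors_mono[OF tors' HQ(1) order_refl]])
  have "fgExt M n H Z'"
    by (rule fgExt_of_torsion_and_quotient[OF H Z' HZ' *(5) ET EQ])
  then show ?thesis using sub by simp
qed

text \<open>\<open>Ext\<^sup>1\<close> of \<open>T = (0 : x)\<close> is reached through \<open>Ext\<^sup>0\<close> of \<open>Z'/T \<cong> xZ'\<close>, which embeds into \<open>Ext\<^sup>0\<close> of \<open>Z'\<close>;
  in higher dimension \<open>Ext\<^sup>2\<close> of \<open>T\<close> could not be reached in this way.\<close>

lemma fgExt_of_dim_3:
  assumes H: "submodule H R M" and Z: "submodule Z R M" and HZ: "H \<subseteq> Z"
    and E: "fgExt M 0 H Z" "fgExt M 1 H Z" "fgExt M 2 H Z"
    and chain: "no_prime_chain R 4 (col H Z)" and tors: "tors H Z"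
  shows "fgExt M n H Z"
proof -
  have "\<exists>Z' x. submodule Z' R M \<and> H \<subseteq> Z' \<and> Z' \<subseteq> Z \<and> fg_over R M Z' Z \<and> x \<in> \<aa> \<and>
    no_prime_chain R 3 (insert x (col H Z'))"
    by (rule exists_saturating_submodule[OF H Z HZ E(1)]) (use chain in \<open>simp add: eval_nat_numeral\<close>)
  then obtain Z' x where *: "submodule Z' R M" "H \<subseteq> Z'" "Z' \<subseteq> Z" "fg_over R M Z' Z" "x \<in> \<aa>"
    "no_prime_chain R 3 (insert x (col H Z'))" by blast
  note Z' = *(1) and HZ' = *(2)
  note sub = fgExt_cofinite_sub[OF H Z' Z HZ' *(3,4)]
  have E': "fgExt M 0 H Z'" "fgExt M (Suc 0) H Z'" "fgExt M (Suc (Suc 0)) H Z'"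
    using E sub by (simp_all add: numeral_2_eq_2)
  have xR: "x \<in> carrier R" by (rule \<aa>_carrier[OF *(5)])
  have tors': "tors H Z'" by (rule tors_mono[OF tors _ *(3)]) simp
  let ?T = "{z \<in> Z'. x \<odot>\<^bsub>M\<^esub> z \<in> H}" and ?Q = "scaled x H Z'"
  note T = submodule_torsion[OF xR H Z'] and Q = submodule_scaled[OF xR H Z']
  note HQ = scaled_subset[OF xR H Z' HZ']
  have HT: "H \<subseteq> ?T" using HZ' submodule_closed(2)[OF H xR] by blast
  have TZ: "?T \<subseteq> Z'" by blast
  have "fgExt M 0 ?T Z'"
    using fgExt_0_left[OF H Q Z' HQ E'(1)] fgExt_scaled[OF xR H Z' HZ'] by simp
  then have "fgExt M 1 H ?T"
    using fgExt_left[OF H T Z' HT TZ _ E'(2)] by simp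
  then have ET: "fgExt M k H ?T" for k
    by (rule fgExt_of_dim_2[OF H T HT fgExt_0_left[OF H T Z' HT TZ E'(1)] _
          no_prime_chain_mono[OF *(6) insert_col_torsion[OF xR]] tors_mono[OF tors' order_refl TZ]])
  have "fgExt M k ?T Z'" if "fgExt M k H Z'" for k
    by (rule fgExt_right[OF H T Z' HT TZ that ET])
  then have EQ': "fgExt M (Suc 0) H ?Q" "fgExt M (Suc (Suc 0)) H ?Q"
    using fgExt_scaled[OF xR H Z' HZ'] E' by simp_all
  \<comment> \<open>Degrees 0 and 1 of Z'/xZ' are obtained from degrees 1 and 2 of xZ', and these
    from degrees 1 and 2 of Z'. This is the use of the assumption in degree 2.\<close>
  have EQ0: "fgExt M 0 ?Q Z'" "fgExt M 1 ?Q Z'"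
    using fgExt_right[OF H Q Z' HQ E'(1) EQ'(1)] fgExt_right[OF H Q Z' HQ E'(2) EQ'(2)] by simp_all
  have EQ: "fgExt M k ?Q Z'" for k
    by (rule fgExt_of_dim_2[OF Q Z' HQ(2) EQ0 no_prime_chain_mono[OF *(6) insert_col_scaled[OF xR H Z' HZ']]
          tors_mono[OF tors' HQ(1) order_refl]])
  have "fgExt M n H Z'"
    by (rule fgExt_of_torsion_and_quotient[OF H Z' HZ' *(5) ET EQ])
  then show ?thesis using sub by simp
qed

end

section \<open>Quotient modules and the standard resolution\<close>

context module
begin

lemma abelian_subgroup_submodule:
  assumes "submodule H R M" shows "abelian_subgroup H M"
  using submodule.axioms(1)[OF assms] M.abelian_group_axioms
  by (intro abelian_subgroupI3 additive_subgroup.intro)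

lemma coset_eq_iff:
  assumes H: "submodule H R M" and "x \<in> carrier M" "y \<in> carrier M"
  shows "H +>\<^bsub>M\<^esub> x = H +>\<^bsub>M\<^esub> y \<longleftrightarrow> x \<ominus>\<^bsub>M\<^esub> y \<in> H"
proof -
  interpret A: abelian_subgroup H M by (rule abelian_subgroup_submodule[OF H])
  show ?thesis
    using A.a_rcos_module[OF assms(3,2)] A.a_repr_independence'[of x y] A.a_repr_independenceD[of x y] assms
    unfolding a_minus_def by metis
qed

lemma coset_zero:
  assumes H: "submodule H R M" and x: "x \<in> carrier M"
  shows "H +>\<^bsub>M\<^esub> x = H \<longleftrightarrow> x \<in> H"
proof -
  interpret A: abelian_subgroup H M by (rule abelian_subgroup_submodule[OF H])
  show ?thesis using A.a_rcos_const[of x] A.a_rcos_self[OF x] by metis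
qed

lemma carrier_quotient_module: "carrier (quotient_module M H) = (\<lambda>x. H +>\<^bsub>M\<^esub> x) ` carrier M"
  by (auto simp: quotient_module_def A_RCOSETS_def')

lemma add_quotient_module:
  assumes H: "submodule H R M" and "x \<in> carrier M" "y \<in> carrier M"
  shows "(H +>\<^bsub>M\<^esub> x) \<oplus>\<^bsub>quotient_module M H\<^esub> (H +>\<^bsub>M\<^esub> y) = H +>\<^bsub>M\<^esub> (x \<oplus>\<^bsub>M\<^esub> y)"
  using abelian_subgroup.a_rcos_sum[OF abelian_subgroup_submodule[OF H]] assms
  by (simp add: quotient_module_def)

lemma smult_quotient_module:
  assumes H: "submodule H R M" and r: "r \<in> carrier R" and x: "x \<in> carrier M"
  shows "r \<odot>\<^bsub>quotient_module M H\<^esub> (H +>\<^bsub>M\<^esub> x) = H +>\<^bsub>M\<^esub> (r \<odot>\<^bsub>M\<^esub> x)"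
proof -
  interpret A: abelian_subgroup H M by (rule abelian_subgroup_submodule[OF H])
  have "H +>\<^bsub>M\<^esub> (r \<odot>\<^bsub>M\<^esub> y) = H +>\<^bsub>M\<^esub> (r \<odot>\<^bsub>M\<^esub> x)" if y: "y \<in> H +>\<^bsub>M\<^esub> x" for y
  proof -
    have yM: "y \<in> carrier M" by (rule A.a_elemrcos_carrier[OF x y])
    have "y \<ominus>\<^bsub>M\<^esub> x \<in> H" using A.a_rcos_module[OF x yM] y by (simp add: a_minus_def)
    then have "r \<odot>\<^bsub>M\<^esub> y \<ominus>\<^bsub>M\<^esub> r \<odot>\<^bsub>M\<^esub> x \<in> H"
      using submodule_closed(2)[OF H r] smult_minus_distr[OF r yM x] by metis
    then show ?thesis using coset_eq_iff[OF H] r x yM by simp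
  qed
  moreover have "x \<in> H +>\<^bsub>M\<^esub> x" by (rule A.a_rcos_self[OF x])
  ultimately have "(\<Union>y\<in>H +>\<^bsub>M\<^esub> x. H +>\<^bsub>M\<^esub> (r \<odot>\<^bsub>M\<^esub> y)) = H +>\<^bsub>M\<^esub> (r \<odot>\<^bsub>M\<^esub> x)"
    by (intro SUP_eq_const) blast+
  then show ?thesis by (simp add: quotient_module_def)
qed

lemma zero_quotient_module:
  assumes H: "submodule H R M"
  shows "\<zero>\<^bsub>quotient_module M H\<^esub> = H +>\<^bsub>M\<^esub> \<zero>\<^bsub>M\<^esub>"
  using coset_zero[OF H M.zero_closed] submodule_zero[OF H] by (simp add: quotient_module_def)

lemma module_quotient_module:
  assumes H: "submodule H R M"
  shows "module R (quotient_module M H)"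
proof -
  let ?Q = "quotient_module M H" and ?p = "\<lambda>x. H +>\<^bsub>M\<^esub> x"
  note simps = add_quotient_module[OF H] smult_quotient_module[OF H] zero_quotient_module[OF H]
  show ?thesis
  proof (rule moduleI)
    show "cring R" by (rule R.is_cring)
    show "abelian_group ?Q"
    proof (rule abelian_groupI; (simp only: carrier_quotient_module)?; (elim imageE)?; (simp only:)?)
      fix x assume x: "x \<in> carrier M"
      have "?p (\<ominus>\<^bsub>M\<^esub> x) \<oplus>\<^bsub>?Q\<^esub> ?p x = \<zero>\<^bsub>?Q\<^esub>" using x by (simp add: simps M.l_neg)
      then show "\<exists>y\<in>?p ` carrier M. y \<oplus>\<^bsub>?Q\<^esub> ?p x = \<zero>\<^bsub>?Q\<^esub>" using x by blast
    qed (auto simp: simps M.a_ac)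
  next
    fix a X assume "a \<in> carrier R" "X \<in> carrier ?Q"
    then show "a \<odot>\<^bsub>?Q\<^esub> X \<in> carrier ?Q" by (auto simp: carrier_quotient_module simps)
  next
    fix a b X assume "a \<in> carrier R" "b \<in> carrier R" "X \<in> carrier ?Q"
    then show "(a \<oplus> b) \<odot>\<^bsub>?Q\<^esub> X = a \<odot>\<^bsub>?Q\<^esub> X \<oplus>\<^bsub>?Q\<^esub> b \<odot>\<^bsub>?Q\<^esub> X" "(a \<otimes> b) \<odot>\<^bsub>?Q\<^esub> X = a \<odot>\<^bsub>?Q\<^esub> (b \<odot>\<^bsub>?Q\<^esub> X)"
      by (auto simp: carrier_quotient_module simps smult_l_distr smult_assoc1)
  next
    fix a X Y assume "a \<in> carrier R" "X \<in> carrier ?Q" "Y \<in> carrier ?Q"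
    then show "a \<odot>\<^bsub>?Q\<^esub> (X \<oplus>\<^bsub>?Q\<^esub> Y) = a \<odot>\<^bsub>?Q\<^esub> X \<oplus>\<^bsub>?Q\<^esub> a \<odot>\<^bsub>?Q\<^esub> Y"
      by (auto simp: carrier_quotient_module simps smult_r_distr)
  next
    fix X assume "X \<in> carrier ?Q"
    then show "\<one> \<odot>\<^bsub>?Q\<^esub> X = X" by (auto simp: carrier_quotient_module simps)
  qed
qed

lemma quotient_hom:
  assumes H: "submodule H R M"
  shows "(\<lambda>x. H +>\<^bsub>M\<^esub> x) \<in> mod_hom R M (quotient_module M H)"
  by (auto simp: mod_hom_def carrier_quotient_module add_quotient_module[OF H] smult_quotient_module[OF H])

lemma quotient_zero_iff:
  assumes H: "submodule H R M" and "x \<in> carrier M"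
  shows "H +>\<^bsub>M\<^esub> x = \<zero>\<^bsub>quotient_module M H\<^esub> \<longleftrightarrow> x \<in> H"
  using coset_zero[OF assms] by (simp add: quotient_module_def)

lemma finitely_generated_iff_fg_over:
  "finitely_generated R M \<longleftrightarrow> fg_over R M {\<zero>\<^bsub>M\<^esub>} (carrier M)"
proof -
  have "(\<lambda>H. submodule H R M) hull S = carrier M \<longleftrightarrow> (\<forall>T. submodule T R M \<and> {\<zero>\<^bsub>M\<^esub>} \<subseteq> T \<and> S \<subseteq> T \<longrightarrow> carrier M \<subseteq> T)"
    if S: "S \<subseteq> carrier M" for S
  proof
    assume "(\<lambda>H. submodule H R M) hull S = carrier M"
    then show "\<forall>T. submodule T R M \<and> {\<zero>\<^bsub>M\<^esub>} \<subseteq> T \<and> S \<subseteq> T \<longrightarrow> carrier M \<subseteq> T"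
      unfolding hull_def by blast
  next
    assume "\<forall>T. submodule T R M \<and> {\<zero>\<^bsub>M\<^esub>} \<subseteq> T \<and> S \<subseteq> T \<longrightarrow> carrier M \<subseteq> T"
    then have "carrier M \<subseteq> T" if "submodule T R M" "S \<subseteq> T" for T
      using that submodule_zero[of T] by blast
    then show "(\<lambda>H. submodule H R M) hull S = carrier M"
      unfolding hull_def using S carrier_is_submodule by blast
  qed
  then show ?thesis
    unfolding finitely_generated_def fg_over_def by (simp cong: conj_cong)
qed

end

context noetherian_module
begin

text \<open>The modules of cosets from the definitions are exchanged here for pairs of
  submodules.\<close>

lemma finitely_generated_quotient_iff:
  assumes H: "submodule H R M"
  shows "finitely_generated R (quotient_module M H) \<longleftrightarrow> fg_over R M H (carrier M)"
proof -
  let ?Q = "quotient_module M H"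
  have M: "module R M" ..
  have Q: "module R ?Q" by (rule module_quotient_module[OF H])
  interpret Q: module R ?Q by (rule Q)
  have NQ: "noetherian_module R ?Q"
    using Q noetherian by (simp add: noetherian_module_def noetherian_module_axioms_def)
  note hom = quotient_hom[OF H]
  have HM: "H \<subseteq> carrier M" by (rule submoduleE(1)[OF H])
  show ?thesis unfolding Q.finitely_generated_iff_fg_over
  proof
    assume fg: "fg_over R M H (carrier M)"
    show "fg_over R ?Q {\<zero>\<^bsub>?Q\<^esub>} (carrier ?Q)"
    proof (rule fg_over_image[OF M Q hom carrier_is_submodule Q.submodule_trivial _ _ _ _ fg HM])
      show "(\<lambda>x. H +>\<^bsub>M\<^esub> x) ` (H \<inter> carrier M) \<subseteq> {\<zero>\<^bsub>?Q\<^esub>}" using quotient_zero_iff[OF H] by blast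
      fix z assume z: "z \<in> carrier ?Q"
      then obtain x where "x \<in> carrier M" "z = H +>\<^bsub>M\<^esub> x" by (auto simp: carrier_quotient_module)
      then show "\<exists>x\<in>carrier M. z \<ominus>\<^bsub>?Q\<^esub> (H +>\<^bsub>M\<^esub> x) \<in> {\<zero>\<^bsub>?Q\<^esub>}"
        using Q.minus_self[OF z] by blast
    qed (auto simp: carrier_quotient_module)
  next
    assume fg: "fg_over R ?Q {\<zero>\<^bsub>?Q\<^esub>} (carrier ?Q)"
    show "fg_over R M H (carrier M)"
    proof (rule fg_over_exact[OF M NQ hom carrier_is_submodule H Q.carrier_is_submodule Q.submodule_trivial _ fg])
      have "{z \<in> carrier M. H +>\<^bsub>M\<^esub> z \<in> {\<zero>\<^bsub>?Q\<^esub>}} \<subseteq> H" using quotient_zero_iff[OF H] by blast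
      then show "fg_over R M H {z \<in> carrier M. H +>\<^bsub>M\<^esub> z \<in> {\<zero>\<^bsub>?Q\<^esub>}}" by (rule fg_over_subset_base)
      show "(\<lambda>x. H +>\<^bsub>M\<^esub> x) ` carrier M \<subseteq> carrier ?Q" by (simp add: carrier_quotient_module)
      show "{\<zero>\<^bsub>?Q\<^esub>} \<subseteq> carrier ?Q" by simp
    qed
  qed
qed

lemma submodule_restrict:
  assumes Z: "submodule Z R M" and H: "submodule H R M" and HZ: "H \<subseteq> Z"
  shows "submodule H R (M\<lparr>carrier := Z\<rparr>)"
proof -
  interpret N: module R "M\<lparr>carrier := Z\<rparr>"
    using submodule.submodule_is_module[OF Z] module_axioms .
  show ?thesis
    by (rule N.submoduleI') (use HZ submodule_closed[OF H] in auto)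
qed

text \<open>The two sides test against different submodules, those inside Z and those of M, so the
  equivalence is obtained by moving along the inclusion.\<close>

lemma fg_over_restrict:
  assumes Z: "submodule Z R M" and H: "submodule H R M" and HZ: "H \<subseteq> Z"
  shows "fg_over R (M\<lparr>carrier := Z\<rparr>) H Z \<longleftrightarrow> fg_over R M H Z"
proof -
  let ?N = "M\<lparr>carrier := Z\<rparr>"
  have M: "module R M" ..
  have N: "module R ?N" by (rule submodule.submodule_is_module[OF Z M])
  interpret N: module R ?N by (rule N)
  have hom: "(\<lambda>x. x) \<in> mod_hom R ?N M" using submodule_mem[OF Z] by (auto simp: mod_hom_def)
  note HN = submodule_restrict[OF assms]
  have ZN: "submodule Z R ?N" by (rule submodule_restrict[OF Z Z]) simp
  show ?thesis
  proof
    assume fg: "fg_over R ?N H Z"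
    show "fg_over R M H Z"
    proof (rule fg_over_image[OF N M hom ZN H submoduleE(1)[OF Z] _ _ _ fg HZ])
      show "\<exists>y\<in>Z. z \<ominus>\<^bsub>M\<^esub> y \<in> H" if "z \<in> Z" for z
        using that minus_self[OF submodule_mem[OF Z that]] submodule_zero[OF H] by (intro bexI[of _ z]) auto
    qed auto
  next
    assume fg: "fg_over R M H Z"
    show "fg_over R ?N H Z"
    proof (rule fg_over_exact[OF N noetherian_module_axioms hom ZN HN Z H _ fg HZ])
      show "fg_over R ?N H {z \<in> Z. z \<in> H}" by (rule N.fg_over_subset_base) blast
    qed auto
  qed
qed

end

context resolution_module
begin

lemma into_trivial: "\<phi> \<in> into M n {\<zero>\<^bsub>M\<^esub>} \<longleftrightarrow> \<phi> = \<zero>\<^bsub>Hom_P M n\<^esub>"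
proof
  interpret X: module R "Hom_P M n" by (rule module_Hom_P)
  assume "\<phi> \<in> into M n {\<zero>\<^bsub>M\<^esub>}"
  then show "\<phi> = \<zero>\<^bsub>Hom_P M n\<^esub>"
    using intoD[of \<phi> n "{\<zero>\<^bsub>M\<^esub>}"] by (intro Hom_eqI[of _ R "P n" M]) (auto simp: Hom_apply)
qed (simp add: into_zero[OF submodule_trivial])

lemma into_carrier: "into M n (carrier M) = carrier (Hom_P M n)"
  using mod_homD(1)[OF Hom_carrierD(1), of _ R "P n" M] by (auto simp: into_def)

lemma cob_trivial:
  assumes Z: "submodule Z R M" shows "cob M n {\<zero>\<^bsub>M\<^esub>} Z = bnd M n Z"
proof -
  interpret X: module R "Hom_P M n" by (rule module_Hom_P)
  have "\<beta> \<in> bnd M n Z \<Longrightarrow> \<beta> \<in> carrier (Hom_P M n)" for \<beta>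
    using X.submodule_mem[OF submodule_bnd[OF Z]] .
  then show ?thesis
    unfolding cob_def into_trivial using X.minus_eq_zero by blast
qed

lemma cocycles_eq: "cocycles R P d M n = coc M n {\<zero>\<^bsub>M\<^esub>} (carrier M)"
  unfolding cocycles_def coc_def into_carrier
  using mod_homD(1)[OF cod_hom] by (auto simp: into_def cod_apply)

lemma coboundaries_eq: "coboundaries R P d M n = bnd M n (carrier M)"
  by (cases n) (auto simp: into_carrier pre_comp_def)

text \<open>For H = 0 and Z = M, \<open>coc\<close> is the set of cocycles and \<open>cob\<close>
  reduces to the coboundaries, so \<open>fgExt\<close> speaks of the cohomology as defined.\<close>

theorem finitely_generated_Hom_cohomology_iff:
  "finitely_generated R (Hom_cohomology R P d M n) \<longleftrightarrow> fgExt M n {\<zero>\<^bsub>M\<^esub>} (carrier M)"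
proof -
  interpret X: noetherian_module R "Hom_P M n" by (rule noetherian_Hom)
  let ?Z = "coc M n {\<zero>\<^bsub>M\<^esub>} (carrier M)" and ?H = "bnd M n (carrier M)"
  let ?C = "Hom_P M n\<lparr>carrier := ?Z\<rparr>"
  note sub = submodule_trivial carrier_is_submodule
  have Z: "submodule ?Z R (Hom_P M n)" by (rule submodule_coc[OF sub])
  have H: "submodule ?H R (Hom_P M n)" by (rule submodule_bnd[OF sub(2)])
  have HZ: "?H \<subseteq> ?Z" by (rule bnd_coc[OF sub])
  have "noetherian_module R ?C"
    using submodule.submodule_is_module[OF Z module_Hom_P] noetherian
    by (simp add: noetherian_module_def noetherian_module_axioms_def)
  then have "finitely_generated R (quotient_module ?C ?H) \<longleftrightarrow> fg_over R ?C ?H ?Z"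
    using noetherian_module.finitely_generated_quotient_iff[OF _ X.submodule_restrict[OF Z H HZ]] by simp
  then show ?thesis
    unfolding Hom_cohomology_def cocycles_eq coboundaries_eq fgExt_def cob_trivial[OF sub(2)]
    using X.fg_over_restrict[OF Z H HZ] by simp
qed

end

section \<open>The standard resolution of R/\<aa> as an instance\<close>

lemma (in cring) module_regular: "module R (regular_module R)"
proof (rule moduleI)
  show "cring R" by (rule is_cring)
  show "abelian_group (regular_module R)"
  proof (rule abelian_groupI)
    fix x assume "x \<in> carrier (regular_module R)"
    then have "x \<in> carrier R" by (simp add: regular_module_def)
    then show "\<exists>y\<in>carrier (regular_module R). y \<oplus>\<^bsub>regular_module R\<^esub> x = \<zero>\<^bsub>regular_module R\<^esub>"
      by (intro bexI[of _ "\<ominus> x"]) (simp_all add: regular_module_def l_neg)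
  qed (simp_all add: regular_module_def a_ac)
qed (simp_all add: regular_module_def l_distr r_distr m_assoc)

lemma (in cring) submodule_regular_of_ideal:
  assumes "ideal I R" shows "submodule I R (regular_module R)"
proof -
  interpret I: ideal I R by fact
  interpret M: module R "regular_module R" by (rule module_regular)
  show ?thesis
    by (rule M.submoduleI') (auto simp: regular_module_def I.I_l_closed)
qed

text \<open>The basis element at the coset of 1, in the role of e.\<close>

abbreviation std_unit :: "('a, 'r) ring_scheme \<Rightarrow> 'a set \<Rightarrow> ('a, 'a set) gen \<Rightarrow> 'a"
  where "std_unit R I \<equiv> basis R (Base (I +>\<^bsub>regular_module R\<^esub> \<one>\<^bsub>R\<^esub>))"

text \<open>The augmentation sends r e to the class of r, and its kernel is the image of the first
  differential; both conditions on e follow from this.\<close>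

theorem free_resolution_std_res:
  assumes R: "cring R" and N: "noetherian_ring R" and I: "ideal I R"
  shows "free_resolution R (gens R (quotient_module (regular_module R) I))
    (std_diff R (quotient_module (regular_module R) I)) (std_unit R I) I"
proof -
  interpret R: cring R by fact
  interpret M: module R "regular_module R" by (rule R.module_regular)
  note sub = R.submodule_regular_of_ideal[OF I]
  let ?A = "quotient_module (regular_module R) I" and ?p = "\<lambda>r. I +>\<^bsub>regular_module R\<^esub> r"
  interpret A: module R ?A by (rule M.module_quotient_module[OF sub])
  let ?P = "\<lambda>n. free_module R (gens R ?A n)"
  interpret P: module R "?P 0" by (rule R.module_free_module)
  note res = A.std_res_resolution[unfolded std_res_def]
  note aug = res(2)
  have cr: "carrier (regular_module R) = carrier R" by (simp add: regular_module_def)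
  have p1: "?p \<one>\<^bsub>R\<^esub> \<in> carrier ?A" using M.carrier_quotient_module[of I] cr by blast
  have unit: "std_unit R I \<in> carrier (?P 0)" using p1 by (intro R.basis_closed) simp
  have b: "Base (?p \<one>\<^bsub>R\<^esub>) \<in> gens R ?A 0" using p1 by simp
  have aug_unit: "std_aug R ?A (std_unit R I) = ?p \<one>\<^bsub>R\<^esub>"
    unfolding std_aug_def using A.lin_ext_basis[OF base_gens_0 b] by simp
  have sm: "r \<odot>\<^bsub>?A\<^esub> ?p \<one>\<^bsub>R\<^esub> = ?p r" if "r \<in> carrier R" for r
    using M.smult_quotient_module[OF sub that, of "\<one>\<^bsub>R\<^esub>"] that by (simp add: regular_module_def)
  have aug_r: "std_aug R ?A (r \<odot>\<^bsub>?P 0\<^esub> std_unit R I) = ?p r" if "r \<in> carrier R" for r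
    using mod_homD(3)[OF aug that unit] aug_unit sm[OF that] by simp
  have ker: "x \<in> std_diff R ?A 0 ` carrier (?P 1) \<longleftrightarrow> x \<in> carrier (?P 0) \<and> std_aug R ?A x = \<zero>\<^bsub>?A\<^esub>" for x
    using res(5) by auto
  show ?thesis
  proof (rule free_resolution.intro)
    show "cring R" "noetherian_ring R" "ideal I R" by fact+
    show "std_diff R ?A n \<in> mod_hom R (?P (Suc n)) (?P n)" for n by (rule res(3))
    show "std_diff R ?A (Suc n) ` carrier (?P (Suc (Suc n)))
      = {x \<in> carrier (?P (Suc n)). std_diff R ?A n x = \<zero>\<^bsub>?P n\<^esub>}" for n by (rule res(6))
    show "std_unit R I \<in> carrier (?P 0)" by (rule unit)
    show "\<exists>r\<in>carrier R. p \<ominus>\<^bsub>?P 0\<^esub> r \<odot>\<^bsub>?P 0\<^esub> std_unit R I \<in> std_diff R ?A 0 ` carrier (?P 1)"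
      if p: "p \<in> carrier (?P 0)" for p
    proof -
      have "std_aug R ?A p \<in> carrier ?A" by (rule mod_homD(1)[OF aug p])
      then obtain r where r: "r \<in> carrier R" "std_aug R ?A p = ?p r"
        using M.carrier_quotient_module[of I] cr by auto
      have ru: "r \<odot>\<^bsub>?P 0\<^esub> std_unit R I \<in> carrier (?P 0)" by (rule P.smult_closed[OF r(1) unit])
      have "std_aug R ?A (p \<ominus>\<^bsub>?P 0\<^esub> r \<odot>\<^bsub>?P 0\<^esub> std_unit R I) = ?p r \<ominus>\<^bsub>?A\<^esub> ?p r"
        using mod_hom_minus[OF P.module_axioms A.module_axioms aug p ru] r(2) aug_r[OF r(1)] by simp
      also have "\<dots> = \<zero>\<^bsub>?A\<^esub>"
        using mod_homD(1)[OF aug p] r(2) by (intro A.minus_self) simp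
      finally show ?thesis using ker P.M.minus_closed[OF p ru] r(1) by blast
    qed
    show "r \<odot>\<^bsub>?P 0\<^esub> std_unit R I \<in> std_diff R ?A 0 ` carrier (?P 1) \<longleftrightarrow> r \<in> I" if r: "r \<in> carrier R" for r
      using ker P.smult_closed[OF r unit] aug_r[OF r] M.quotient_zero_iff[OF sub, of r] r cr by metis
  qed
qed

section \<open>Support and dimension\<close>

text \<open>If every m is killed by some u outside \<pp>, the product of the elements that kill two
  numerators identifies the two fractions, so there is a single class. Conversely m/1 = 0 provides
  such a u.\<close>

lemma (in module) mem_Supp_iff:
  "\<pp> \<in> Supp R M \<longleftrightarrow> primeideal \<pp> R \<and> (\<exists>m\<in>carrier M. \<forall>u\<in>carrier R - \<pp>. u \<odot>\<^bsub>M\<^esub> m \<noteq> \<zero>\<^bsub>M\<^esub>)"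
proof (cases "primeideal \<pp> R")
  case True
  interpret \<pp>: primeideal \<pp> R by fact
  let ?S = "carrier R - \<pp>" and ?r = "frac_rel (carrier R - \<pp>) M"
  have one: "\<one> \<in> ?S" using \<pp>.I_notcarr \<pp>.one_imp_carrier by blast
  have mult: "u \<otimes> v \<in> ?S" if "u \<in> ?S" "v \<in> ?S" for u v using \<pp>.I_prime that by blast
  have loc: "carrier (localization R ?S M) = (\<lambda>x. ?r `` {x}) ` (carrier M \<times> ?S)"
    "\<zero>\<^bsub>localization R ?S M\<^esub> = ?r `` {(\<zero>\<^bsub>M\<^esub>, \<one>)}"
    by (auto simp: localization_def quotient_def)
  have z: "(\<zero>\<^bsub>M\<^esub>, \<one>) \<in> carrier M \<times> ?S" using one by simp
  have "carrier (localization R ?S M) = {\<zero>\<^bsub>localization R ?S M\<^esub>} \<longleftrightarrow>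
    (\<forall>m\<in>carrier M. \<exists>u\<in>?S. u \<odot>\<^bsub>M\<^esub> m = \<zero>\<^bsub>M\<^esub>)"
  proof
    assume *: "carrier (localization R ?S M) = {\<zero>\<^bsub>localization R ?S M\<^esub>}"
    show "\<forall>m\<in>carrier M. \<exists>u\<in>?S. u \<odot>\<^bsub>M\<^esub> m = \<zero>\<^bsub>M\<^esub>"
    proof
      fix m assume m: "m \<in> carrier M"
      have "?r `` {(m, \<one>)} \<in> carrier (localization R ?S M)"
        unfolding loc(1) by (rule imageI) (use m one in simp)
      then have "?r `` {(m, \<one>)} = ?r `` {(\<zero>\<^bsub>M\<^esub>, \<one>)}"
        unfolding * loc(2) by (rule singletonD)
      moreover have "(m, \<one>) \<in> ?r `` {(m, \<one>)}" using m one by (auto simp: frac_rel_def)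
      ultimately have "((\<zero>\<^bsub>M\<^esub>, \<one>), (m, \<one>)) \<in> ?r" by blast
      then obtain u where "u \<in> ?S" "u \<odot>\<^bsub>M\<^esub> (\<one> \<odot>\<^bsub>M\<^esub> \<zero>\<^bsub>M\<^esub>) = u \<odot>\<^bsub>M\<^esub> (\<one> \<odot>\<^bsub>M\<^esub> m)"
        by (auto simp: frac_rel_def)
      then show "\<exists>u\<in>?S. u \<odot>\<^bsub>M\<^esub> m = \<zero>\<^bsub>M\<^esub>" using m by (intro bexI[of _ u]) auto
    qed
  next
    assume kill: "\<forall>m\<in>carrier M. \<exists>u\<in>?S. u \<odot>\<^bsub>M\<^esub> m = \<zero>\<^bsub>M\<^esub>"
    have "((m, s), (n, t)) \<in> ?r" if mn: "m \<in> carrier M" "n \<in> carrier M" "s \<in> ?S" "t \<in> ?S" for m n s t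
    proof -
      obtain u v where uv: "u \<in> ?S" "u \<odot>\<^bsub>M\<^esub> m = \<zero>\<^bsub>M\<^esub>" "v \<in> ?S" "v \<odot>\<^bsub>M\<^esub> n = \<zero>\<^bsub>M\<^esub>"
        using kill mn by blast
      have c: "u \<in> carrier R" "v \<in> carrier R" "s \<in> carrier R" "t \<in> carrier R" using uv mn by auto
      have "(u \<otimes> v) \<odot>\<^bsub>M\<^esub> (t \<odot>\<^bsub>M\<^esub> m) = (v \<otimes> t) \<odot>\<^bsub>M\<^esub> (u \<odot>\<^bsub>M\<^esub> m)"
        using c mn by (simp add: smult_assoc1[symmetric] R.m_ac)
      moreover have "(u \<otimes> v) \<odot>\<^bsub>M\<^esub> (s \<odot>\<^bsub>M\<^esub> n) = (u \<otimes> s) \<odot>\<^bsub>M\<^esub> (v \<odot>\<^bsub>M\<^esub> n)"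
        using c mn by (simp add: smult_assoc1[symmetric] R.m_ac)
      ultimately have "(u \<otimes> v) \<odot>\<^bsub>M\<^esub> (t \<odot>\<^bsub>M\<^esub> m) = (u \<otimes> v) \<odot>\<^bsub>M\<^esub> (s \<odot>\<^bsub>M\<^esub> n)"
        using uv c by simp
      then show ?thesis using mult[OF uv(1,3)] mn unfolding frac_rel_def by blast
    qed
    then have rel: "(x, y) \<in> ?r" if "x \<in> carrier M \<times> ?S" "y \<in> carrier M \<times> ?S" for x y
      using that by (cases x, cases y) (simp only: mem_Sigma_iff)
    have "?r `` {x} = carrier M \<times> ?S" if x: "x \<in> carrier M \<times> ?S" for x
    proof (intro equalityI subsetI)
      show "y \<in> ?r `` {x}" if "y \<in> carrier M \<times> ?S" for y using rel[OF x that] by (rule ImageI) simp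
      show "y \<in> carrier M \<times> ?S" if "y \<in> ?r `` {x}" for y
        using that by (auto simp: frac_rel_def)
    qed
    then have "(\<lambda>x. ?r `` {x}) ` (carrier M \<times> ?S) = (\<lambda>x. carrier M \<times> ?S) ` (carrier M \<times> ?S)"
      "?r `` {(\<zero>\<^bsub>M\<^esub>, \<one>)} = carrier M \<times> ?S"
      using z by (auto intro: image_cong)
    then show "carrier (localization R ?S M) = {\<zero>\<^bsub>localization R ?S M\<^esub>}"
      unfolding loc using z by (simp only: image_constant)
  qed
  then show ?thesis using True unfolding Supp_def by blast
qed (simp add: Supp_def)

text \<open>If no power of x kills m, a prime over the annihilator of m that misses x lies in the
  support but not in V(\<aa>). Conversely, at a prime of the support some m is killed by no element
  outside it, while a power of each x in \<aa> kills m, so x lies in the prime.\<close>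

lemma (in resolution_module) Supp_subset_iff_tors:
  "Supp R M \<subseteq> zero_locus R \<aa> \<longleftrightarrow> tors {\<zero>\<^bsub>M\<^esub>} (carrier M)"
proof
  interpret NC: noetherian_cring R by (rule noetherian_cring_R)
  assume S: "Supp R M \<subseteq> zero_locus R \<aa>"
  have "\<exists>k::nat. (x [^]\<^bsub>R\<^esub> k) \<odot>\<^bsub>M\<^esub> m \<in> {\<zero>\<^bsub>M\<^esub>}" if m: "m \<in> carrier M" and x: "x \<in> \<aa>" for m x
  proof (rule ccontr)
    assume *: "\<nexists>k::nat. (x [^]\<^bsub>R\<^esub> k) \<odot>\<^bsub>M\<^esub> m \<in> {\<zero>\<^bsub>M\<^esub>}"
    let ?I = "col {\<zero>\<^bsub>M\<^esub>} {m}"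
    have "ideal ?I R" by (rule ideal_col[OF submodule_trivial]) (use m in simp)
    moreover have "x [^]\<^bsub>R\<^esub> k \<notin> ?I" for k :: nat using * by (simp add: col_def)
    ultimately obtain \<pp> where \<pp>: "primeideal \<pp> R" "?I \<subseteq> \<pp>" "x \<notin> \<pp>"
      using NC.prime_avoiding_powers[OF _ \<aa>_carrier[OF x]] by blast
    have "\<forall>u\<in>carrier R - \<pp>. u \<odot>\<^bsub>M\<^esub> m \<noteq> \<zero>\<^bsub>M\<^esub>" using \<pp>(2) by (auto simp: col_def)
    then have "\<pp> \<in> Supp R M" using mem_Supp_iff \<pp>(1) m by blast
    then show False using S \<pp>(3) x by (auto simp: zero_locus_def)
  qed
  then show "tors {\<zero>\<^bsub>M\<^esub>} (carrier M)" unfolding tors_def by blast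
next
  assume t: "tors {\<zero>\<^bsub>M\<^esub>} (carrier M)"
  show "Supp R M \<subseteq> zero_locus R \<aa>"
  proof
    fix \<pp> assume "\<pp> \<in> Supp R M"
    then obtain m where \<pp>: "primeideal \<pp> R" "m \<in> carrier M" "\<forall>u\<in>carrier R - \<pp>. u \<odot>\<^bsub>M\<^esub> m \<noteq> \<zero>\<^bsub>M\<^esub>"
      using mem_Supp_iff by blast
    interpret \<pp>: primeideal \<pp> R by (rule \<pp>(1))
    have "x \<in> \<pp>" if x: "x \<in> \<aa>" for x
    proof (rule ccontr)
      assume nx: "x \<notin> \<pp>"
      note xR = \<aa>_carrier[OF x]
      have pow: "x [^]\<^bsub>R\<^esub> k \<notin> \<pp>" for k :: nat
      proof (induction k)
        case 0
        then show ?case using \<pp>.I_notcarr \<pp>.one_imp_carrier by auto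
      next
        case (Suc k)
        then show ?case using \<pp>.I_prime[of "x [^]\<^bsub>R\<^esub> k" x] nx xR by auto
      qed
      obtain k :: nat where "(x [^]\<^bsub>R\<^esub> k) \<odot>\<^bsub>M\<^esub> m = \<zero>\<^bsub>M\<^esub>"
        using t \<pp>(2) x unfolding tors_def by blast
      then show False using \<pp>(3) pow[of k] xR by auto
    qed
    then show "\<pp> \<in> zero_locus R \<aa>" using \<pp>(1) by (auto simp: zero_locus_def)
  qed
qed

lemma (in cring) primeideal_quotient:
  assumes I: "ideal I R" and P: "primeideal P R" and IP: "I \<subseteq> P"
  shows "primeideal ((+>) I ` P) (R Quot I)"
    and "r \<in> carrier R \<Longrightarrow> I +> r \<in> (+>) I ` P \<longleftrightarrow> r \<in> P"
proof -
  interpret I: ideal I R by fact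
  interpret P: primeideal P R by fact
  have carr: "carrier (R Quot I) = (+>) I ` carrier R"
    by (auto simp: FactRing_def A_RCOSETS_def')
  have mem: "I +> r \<in> (+>) I ` P \<longleftrightarrow> r \<in> P" if r: "r \<in> carrier R" for r
  proof
    assume "I +> r \<in> (+>) I ` P"
    then obtain p where p: "p \<in> P" "I +> r = I +> p" by blast
    have pR: "p \<in> carrier R" using p(1) P.Icarr by blast
    have "r \<in> I +> p" using I.a_rcos_self[OF r] p(2) by simp
    then have "r \<ominus> p \<in> P" using I.a_rcos_module[OF pR r] IP by (auto simp: a_minus_def)
    then have "(r \<ominus> p) \<oplus> p \<in> P" using p(1) P.a_closed by blast
    then show "r \<in> P" using r pR by (simp add: a_minus_def a_assoc l_neg)
  qed blast
  then show "r \<in> carrier R \<Longrightarrow> I +> r \<in> (+>) I ` P \<longleftrightarrow> r \<in> P" .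
  show "primeideal ((+>) I ` P) (R Quot I)"
  proof (rule primeidealI)
    show "ideal ((+>) I ` P) (R Quot I)" by (rule ring_ideal_imp_quot_ideal[OF I P.is_ideal])
    show "cring (R Quot I)" by (rule I.quotient_is_cring[OF is_cring])
    have "\<one> \<notin> P" using P.I_notcarr P.one_imp_carrier by blast
    then show "carrier (R Quot I) \<noteq> (+>) I ` P" using mem[OF one_closed] one_closed unfolding carr by blast
    fix a b assume "a \<in> carrier (R Quot I)" "b \<in> carrier (R Quot I)"
      and ab: "a \<otimes>\<^bsub>R Quot I\<^esub> b \<in> (+>) I ` P"
    then obtain x y where xy: "x \<in> carrier R" "y \<in> carrier R" "a = I +> x" "b = I +> y"
      unfolding carr by blast
    have "a \<otimes>\<^bsub>R Quot I\<^esub> b = I +> (x \<otimes> y)"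
      using I.rcoset_mult_add[OF xy(1,2)] xy by (simp add: FactRing_def)
    then have "x \<otimes> y \<in> P" using ab mem xy by simp
    then show "a \<in> (+>) I ` P \<or> b \<in> (+>) I ` P" using P.I_prime xy by blast
  qed
qed

text \<open>A chain of n + 1 strict steps over I remains strict in R/I and would give dimension at
  least n + 1.\<close>

lemma (in cring) no_prime_chain_of_krull_dim:
  assumes I: "ideal I R" and dim: "krull_dim (R Quot I) \<le> ereal (real n)"
  shows "no_prime_chain R (Suc n) I"
  unfolding no_prime_chain_def
proof
  assume "\<exists>P. (\<forall>i\<le>Suc n. primeideal (P i) R \<and> I \<subseteq> P i) \<and> (\<forall>i<Suc n. P i \<subset> P (Suc i))"
  then obtain P where P: "\<And>i. i \<le> Suc n \<Longrightarrow> primeideal (P i) R \<and> I \<subseteq> P i"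
    "\<And>i. i < Suc n \<Longrightarrow> P i \<subset> P (Suc i)" by blast
  let ?Q = "\<lambda>i. (+>) I ` P i"
  have "primeideal (?Q i) (R Quot I)" if "i \<le> Suc n" for i
    using primeideal_quotient(1)[OF I] P(1)[OF that] by blast
  moreover have "?Q i \<subset> ?Q (Suc i)" if i: "i < Suc n" for i
  proof -
    obtain r where r: "r \<in> P (Suc i)" "r \<notin> P i" using P(2)[OF i] by blast
    have "r \<in> carrier R" using r(1) P(1)[of "Suc i"] i primeidealD(2) by auto
    then have "I +> r \<notin> ?Q i" using primeideal_quotient(2)[OF I] P(1)[of i] i r(2) by auto
    then show ?thesis using P(2)[OF i] r(1) by blast
  qed
  ultimately have "Suc n \<in> {n. \<exists>P :: nat \<Rightarrow> 'a set set. (\<forall>i\<le>n. primeideal (P i) (R Quot I)) \<and> (\<forall>i<n. P i \<subset> P (Suc i))}"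
    by (intro CollectI exI[of _ ?Q]) blast
  then have "ereal (real (Suc n)) \<le> krull_dim (R Quot I)"
    unfolding krull_dim_def by (rule SUP_upper)
  then show False using dim by (metis ereal_less_eq(3) of_nat_le_iff order_trans not_less_eq_eq order_refl)
qed

section \<open>Kernels and cokernels of cofinite modules\<close>

context resolution_module
begin

text \<open>The kernel appears in the definitions as a module record of its own;
  \<open>fgExt_iso\<close> along the inclusion brings its Ext back into M.\<close>

lemma submodule_hom_facts:
  assumes K: "submodule K R M"
  shows "module R (M\<lparr>carrier := K\<rparr>)" "(\<lambda>x. x) \<in> mod_hom R (M\<lparr>carrier := K\<rparr>) M"
    "fgExt (M\<lparr>carrier := K\<rparr>) n {\<zero>\<^bsub>M\<lparr>carrier := K\<rparr>\<^esub>} K \<longleftrightarrow> fgExt M n {\<zero>\<^bsub>M\<^esub>} K"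
proof -
  show N: "module R (M\<lparr>carrier := K\<rparr>)" by (rule submodule.submodule_is_module[OF K module_M])
  show hom: "(\<lambda>x. x) \<in> mod_hom R (M\<lparr>carrier := K\<rparr>) M"
    using submodule_mem[OF K] by (auto simp: mod_hom_def)
  interpret N: module R "M\<lparr>carrier := K\<rparr>" by (rule N)
  have Kc: "submodule K R (M\<lparr>carrier := K\<rparr>)" using N.carrier_is_submodule by simp
  show "fgExt (M\<lparr>carrier := K\<rparr>) n {\<zero>\<^bsub>M\<lparr>carrier := K\<rparr>\<^esub>} K \<longleftrightarrow> fgExt M n {\<zero>\<^bsub>M\<^esub>} K"
  proof (rule fgExt_iso[OF N module_M hom Kc N.submodule_trivial K submodule_trivial])
    show "\<exists>y\<in>K. z \<ominus>\<^bsub>M\<^esub> y \<in> {\<zero>\<^bsub>M\<^esub>}" if "z \<in> K" for z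
      using that minus_self[OF submodule_mem[OF K that]] by blast
  qed (use submodule_zero[OF K] in auto)
qed

lemma fgExt_quotient_module:
  assumes H: "submodule H R M"
  shows "fgExt (quotient_module M H) n {\<zero>\<^bsub>quotient_module M H\<^esub>} (carrier (quotient_module M H))
    \<longleftrightarrow> fgExt M n H (carrier M)"
proof -
  let ?Q = "quotient_module M H"
  have Q: "module R ?Q" by (rule module_quotient_module[OF H])
  interpret Q: module R ?Q by (rule Q)
  have "fgExt M n H (carrier M) \<longleftrightarrow> fgExt ?Q n {\<zero>\<^bsub>?Q\<^esub>} (carrier ?Q)"
  proof (rule fgExt_iso[OF module_M Q quotient_hom[OF H] carrier_is_submodule H
        Q.carrier_is_submodule Q.submodule_trivial submoduleE(1)[OF H]])
    show "{\<zero>\<^bsub>?Q\<^esub>} \<subseteq> carrier ?Q" by simp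
    show "(\<lambda>x. H +>\<^bsub>M\<^esub> x) ` carrier M \<subseteq> carrier ?Q" by (simp add: carrier_quotient_module)
    show "\<exists>x\<in>carrier M. z \<ominus>\<^bsub>?Q\<^esub> (H +>\<^bsub>M\<^esub> x) \<in> {\<zero>\<^bsub>?Q\<^esub>}" if z: "z \<in> carrier ?Q" for z
    proof -
      obtain x where "x \<in> carrier M" "z = H +>\<^bsub>M\<^esub> x" using z by (auto simp: carrier_quotient_module)
      then show ?thesis using Q.minus_self[OF z] by blast
    qed
    show "H +>\<^bsub>M\<^esub> z \<in> {\<zero>\<^bsub>?Q\<^esub>} \<longleftrightarrow> z \<in> H" if "z \<in> carrier M" for z
      using quotient_zero_iff[OF H that] by simp
  qed
  then show ?thesis by simp
qed

end

text \<open>The bridge from support and Ext as defined to \<open>tors\<close> and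
  \<open>fgExt\<close>, in which the argument runs.\<close>

lemma cofinite_module_iff:
  assumes R: "cring R" and N: "noetherian_ring R" and \<aa>: "ideal \<aa> R" and M: "module R M"
  defines "A \<equiv> quotient_module (regular_module R) \<aa>"
  shows "cofinite_module R \<aa> M \<longleftrightarrow> resolution_module.tors R \<aa> M {\<zero>\<^bsub>M\<^esub>} (carrier M) \<and>
    (\<forall>n. free_resolution.fgExt R (gens R A) (std_diff R A) M n {\<zero>\<^bsub>M\<^esub>} (carrier M))"
proof -
  interpret F: free_resolution R "gens R A" "std_diff R A" "std_unit R \<aa>" \<aa>
    unfolding A_def by (rule free_resolution_std_res[OF R N \<aa>])
  interpret M: resolution_module R "gens R A" "std_diff R A" "std_unit R \<aa>" \<aa> M
    by (rule F.resolution_moduleI[OF M])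
  have "std_res R A = (\<lambda>n. free_module R (gens R A n))"
    by (simp add: std_res_def fun_eq_iff)
  then show ?thesis
    unfolding cofinite_module_def Ext_def A_def[symmetric]
    using M M.Supp_subset_iff_tors M.finitely_generated_Hom_cohomology_iff by simp
qed

theorem proposition3p11:
  fixes R :: "('a, 'r) ring_scheme"
    and M :: "('a, 'm, 'k) module_scheme"
    and N :: "('a, 'n, 'l) module_scheme"
    and \<aa> :: "'a set" and f :: "'m \<Rightarrow> 'n"
  assumes "cring R" and "noetherian_ring R" and "ideal \<aa> R"
    and "module R M" and "module R N"
    and "cofinite_module R \<aa> M" and "in_D_le R 3 M"
    and "cofinite_module R \<aa> N" and "in_D_le R 3 N"
    and "f \<in> mod_hom R M N"
  shows "cofinite_module R \<aa> (ker_module M N f) \<and> cofinite_module R \<aa> (coker_module M N f)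
    \<longleftrightarrow> finitely_generated R (torsion_module (coker_module M N f) \<aa>)"
proof -
  note R = assms(1-3) and M = assms(4) and N = assms(5) and f = assms(10)
  let ?A = "quotient_module (regular_module R) \<aa>"
  let ?K = "a_kernel M N f" and ?I = "f ` carrier M"
  let ?C = "coker_module M N f"
  interpret F: free_resolution R "gens R ?A" "std_diff R ?A" "std_unit R \<aa>" \<aa>
    by (rule free_resolution_std_res[OF R])
  interpret M: resolution_module R "gens R ?A" "std_diff R ?A" "std_unit R \<aa>" \<aa> M
    by (rule F.resolution_moduleI[OF M])
  interpret N: resolution_module R "gens R ?A" "std_diff R ?A" "std_unit R \<aa>" \<aa> N
    by (rule F.resolution_moduleI[OF N])
  note cof_iff = cofinite_module_iff[OF R]
  note f0 = mod_hom_zero[OF M N f] and fc = mod_homD(1)[OF f]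
  have K_eq: "?K = {x \<in> carrier M. f x \<in> {\<zero>\<^bsub>N\<^esub>}}" by (simp add: a_kernel_def')
  have K: "submodule ?K R M" unfolding K_eq
    by (rule submodule_vimage[OF M N f M.carrier_is_submodule N.submodule_trivial])
  have I: "submodule ?I R N"
  proof (rule N.submoduleI')
    show "\<zero>\<^bsub>N\<^esub> \<in> ?I" using f0 M.M.zero_closed by (metis imageI)
    show "?I \<subseteq> carrier N" using fc by blast
    show "x \<oplus>\<^bsub>N\<^esub> y \<in> ?I" if xy: "x \<in> ?I" "y \<in> ?I" for x y
    proof -
      obtain u v where "u \<in> carrier M" "v \<in> carrier M" "x = f u" "y = f v" using xy by blast
      then show ?thesis using mod_homD(2)[OF f, of u v] by (metis M.M.a_closed imageI)
    qed
    show "r \<odot>\<^bsub>N\<^esub> y \<in> ?I" if y: "r \<in> carrier R" "y \<in> ?I" for r y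
    proof -
      obtain u where "u \<in> carrier M" "y = f u" using y by blast
      then show ?thesis using mod_homD(3)[OF f y(1), of u] by (metis M.smult_closed y(1) imageI)
    qed
  qed
  note M0 = M.submodule_trivial and N0 = N.submodule_trivial
  note Mc = M.carrier_is_submodule and Nc = N.carrier_is_submodule
  have K0: "{\<zero>\<^bsub>M\<^esub>} \<subseteq> ?K" using M.submodule_zero[OF K] by simp
  have I0: "{\<zero>\<^bsub>N\<^esub>} \<subseteq> ?I" using N.submodule_zero[OF I] by simp
  note KM = M.submoduleE(1)[OF K] and IN = N.submoduleE(1)[OF I]
  have C: "module R ?C" unfolding coker_module_def by (rule N.module_quotient_module[OF I])
  interpret C: resolution_module R "gens R ?A" "std_diff R ?A" "std_unit R \<aa>" \<aa> ?C
    by (rule F.resolution_moduleI[OF C])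
  have EC: "F.fgExt ?C n {\<zero>\<^bsub>?C\<^esub>} (carrier ?C) \<longleftrightarrow> F.fgExt N n ?I (carrier N)" for n
    unfolding coker_module_def by (rule N.fgExt_quotient_module[OF I])
  have tM: "M.tors {\<zero>\<^bsub>M\<^esub>} (carrier M)" and EM: "F.fgExt M n {\<zero>\<^bsub>M\<^esub>} (carrier M)" for n
    using assms(6) cof_iff[OF M] by auto
  have tN: "N.tors {\<zero>\<^bsub>N\<^esub>} (carrier N)" and EN: "F.fgExt N n {\<zero>\<^bsub>N\<^esub>} (carrier N)" for n
    using assms(8) cof_iff[OF N] by auto
  \<comment> \<open>Vanishing is written as membership in the zero submodule to match
    \<open>submodule_colon\<close> and \<open>fgExt_0_iff\<close>.\<close>
  let ?tC = "{x \<in> carrier ?C. \<forall>r\<in>\<aa>. r \<odot>\<^bsub>?C\<^esub> x \<in> {\<zero>\<^bsub>?C\<^esub>}}"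
  have tC: "submodule ?tC R ?C"
    by (rule C.submodule_colon[OF C.carrier_is_submodule C.submodule_trivial subsetI[OF C.\<aa>_carrier]])
  \<comment> \<open>The torsion part of the cokernel is its Ext in degree 0, which is transferred to
    N modulo the image of f.\<close>
  have fin: "finitely_generated R (torsion_module ?C \<aa>) \<longleftrightarrow> F.fgExt N 0 ?I (carrier N)"
  proof -
    have tor: "torsion_module ?C \<aa> = ?C\<lparr>carrier := ?tC\<rparr>" by (simp add: torsion_module_def)
    have tmod: "module R (?C\<lparr>carrier := ?tC\<rparr>)" by (rule submodule.submodule_is_module[OF tC C])
    have "finitely_generated R (torsion_module ?C \<aa>) \<longleftrightarrow> fg_over R ?C {\<zero>\<^bsub>?C\<^esub>} ?tC"
      unfolding tor module.finitely_generated_iff_fg_over[OF tmod]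
      using C.fg_over_restrict[OF tC C.submodule_trivial] C.submodule_zero[OF tC] by simp
    also have "\<dots> \<longleftrightarrow> F.fgExt ?C 0 {\<zero>\<^bsub>?C\<^esub>} (carrier ?C)"
      using C.fgExt_0_iff[OF C.submodule_trivial C.carrier_is_submodule] by simp
    finally show ?thesis using EC by simp
  qed
  show ?thesis
  proof
    assume "cofinite_module R \<aa> (ker_module M N f) \<and> cofinite_module R \<aa> ?C"
    then show "finitely_generated R (torsion_module ?C \<aa>)"
      using cof_iff[OF C] EC fin by blast
  next
    assume "finitely_generated R (torsion_module ?C \<aa>)"
    then have C0: "F.fgExt N 0 ?I (carrier N)" using fin by simp
    have I_0: "F.fgExt N 0 {\<zero>\<^bsub>N\<^esub>} ?I" by (rule N.fgExt_0_left[OF N0 I Nc I0 IN EN])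
    have I_1: "F.fgExt N (Suc 0) {\<zero>\<^bsub>N\<^esub>} ?I" by (rule N.fgExt_left[OF N0 I Nc I0 IN C0 EN])
    \<comment> \<open>M modulo the kernel is isomorphic to the image; this links the sequence in M
      with the one in N.\<close>
    have iso: "F.fgExt M n ?K (carrier M) \<longleftrightarrow> F.fgExt N n {\<zero>\<^bsub>N\<^esub>} ?I" for n
    proof (rule F.fgExt_iso[OF M N f Mc K I N0 KM I0])
      show "f ` carrier M \<subseteq> ?I" by simp
      show "\<exists>z\<in>carrier M. z' \<ominus>\<^bsub>N\<^esub> f z \<in> {\<zero>\<^bsub>N\<^esub>}" if z': "z' \<in> ?I" for z'
      proof -
        obtain z where "z \<in> carrier M" "z' = f z" using z' by blast
        then show ?thesis using N.minus_self fc by blast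
      qed
      show "f z \<in> {\<zero>\<^bsub>N\<^esub>} \<longleftrightarrow> z \<in> ?K" if "z \<in> carrier M" for z using that by (simp add: K_eq)
    qed
    have K_0: "F.fgExt M 0 {\<zero>\<^bsub>M\<^esub>} ?K" by (rule M.fgExt_0_left[OF M0 K Mc K0 KM EM])
    have K_1: "F.fgExt M 1 {\<zero>\<^bsub>M\<^esub>} ?K"
      using M.fgExt_left[OF M0 K Mc K0 KM _ EM] iso I_0 by simp
    have K_2: "F.fgExt M 2 {\<zero>\<^bsub>M\<^esub>} ?K"
      using M.fgExt_left[OF M0 K Mc K0 KM _ EM] iso I_1 by (simp add: numeral_2_eq_2)
    have tK: "M.tors {\<zero>\<^bsub>M\<^esub>} ?K" by (rule M.tors_mono[OF tM order_refl KM])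
    have "annihilator R M = M.col {\<zero>\<^bsub>M\<^esub>} (carrier M)" by (simp add: annihilator_def M.col_def)
    \<comment> \<open>Dimension at most 3 excludes chains with four strict steps. The bound passes
      to the kernel because its annihilator contains that of M.\<close>
    moreover have "no_prime_chain R (Suc 3) (M.col {\<zero>\<^bsub>M\<^esub>} (carrier M))"
      using assms(7) calculation
      by (intro cring.no_prime_chain_of_krull_dim[OF assms(1)] M.ideal_col[OF M0])
        (simp_all add: in_D_le_def dim_bar_def)
    ultimately have "no_prime_chain R 4 (M.col {\<zero>\<^bsub>M\<^esub>} ?K)"
      using M.col_mono[OF order_refl KM] no_prime_chain_mono by (simp add: eval_nat_numeral) blast
    then have EK: "F.fgExt M n {\<zero>\<^bsub>M\<^esub>} ?K" for n
      by (rule M.fgExt_of_dim_3[OF M0 K K0 K_0 K_1 K_2 _ tK])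
    \<comment> \<open>A quotient in degree n needs the submodule in degree n + 1, for the image and
      again for the cokernel, so the kernel had to be settled in all degrees first.\<close>
    have "F.fgExt M n ?K (carrier M)" for n
      by (rule M.fgExt_right[OF M0 K Mc K0 KM EM EK])
    then have EI: "F.fgExt N n {\<zero>\<^bsub>N\<^esub>} ?I" for n using iso by simp
    have ECN: "F.fgExt N n ?I (carrier N)" for n
      by (rule N.fgExt_right[OF N0 I Nc I0 IN EN EI])
    have ker: "ker_module M N f = M\<lparr>carrier := ?K\<rparr>" by (simp add: ker_module_def)
    note K_sub = M.submodule_hom_facts[OF K]
    interpret K: resolution_module R "gens R ?A" "std_diff R ?A" "std_unit R \<aa>" \<aa> "M\<lparr>carrier := ?K\<rparr>"
      by (rule F.resolution_moduleI[OF K_sub(1)])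
    have "K.tors {\<zero>\<^bsub>M\<lparr>carrier := ?K\<rparr>\<^esub>} (carrier (M\<lparr>carrier := ?K\<rparr>))"
      using tK unfolding K.tors_def M.tors_def by simp
    then have "cofinite_module R \<aa> (ker_module M N f)"
      unfolding ker cof_iff[OF K_sub(1)] using EK K_sub(3) by simp
    moreover have "C.tors {\<zero>\<^bsub>?C\<^esub>} (carrier ?C)"
      unfolding C.tors_def
    proof (intro ballI)
      fix z x assume z: "z \<in> carrier ?C" and x: "x \<in> \<aa>"
      obtain n where n: "n \<in> carrier N" "z = ?I +>\<^bsub>N\<^esub> n"
        using z by (auto simp: coker_module_def N.carrier_quotient_module)
      obtain k :: nat where k: "(x [^]\<^bsub>R\<^esub> k) \<odot>\<^bsub>N\<^esub> n = \<zero>\<^bsub>N\<^esub>"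
        using tN n(1) x unfolding N.tors_def by blast
      have xk: "x [^]\<^bsub>R\<^esub> k \<in> carrier R" using N.\<aa>_carrier[OF x] by simp
      have "(x [^]\<^bsub>R\<^esub> k) \<odot>\<^bsub>?C\<^esub> z = \<zero>\<^bsub>?C\<^esub>"
        using N.smult_quotient_module[OF I xk n(1)] N.zero_quotient_module[OF I] k n(2)
        by (simp add: coker_module_def)
      then show "\<exists>k::nat. (x [^]\<^bsub>R\<^esub> k) \<odot>\<^bsub>?C\<^esub> z \<in> {\<zero>\<^bsub>?C\<^esub>}" by blast
    qed
    then have "cofinite_module R \<aa> ?C"
      unfolding cof_iff[OF C] using ECN EC by simp
    ultimately show "cofinite_module R \<aa> (ker_module M N f) \<and> cofinite_module R \<aa> ?C" ..
  qed
qed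

end
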